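(* Consider the coupled discrete gradient flow algorithm (defined in the context). The following statements hold. (i) Suppose that $\tau$ satisfies $c_{\mathcal{H}}^2|a_0|\tau<2$. Then, for all $i\in\mathbb{N}_0$, the variational problem (C) admits a unique solution $(v_{1,h}^i,v_{2,h}^i)\in\mathcal{K}_h[m_{1,h}^i]\times\mathcal{K}_h[m_{2,h}^i]$. (ii) Under the assumption of part (i), suppose that $\tau$ additionally satisfies $c_{\mathcal{H}}c_{\mathcal{T}}|a_0|\tau<1$, where $c_{\mathcal{T}}>0$ is a constant which depends only on the shape-regularity of the family of meshes. Then the algorithm terminates within a finite number of iterations. In particular, the approximate stationary point $(m_{1,h},m_{2,h})$ is well defined. (iii) Under the assumption of part (i), for all $i\in\mathbb{N}_0$ the iterates of the algorithm satisfy $$\mathcal{E}[m_{1,h}^{i+1},m_{2,h}^{i+1}] - \mathcal{E}[m_{1,h}^i,m_{2,h}^i] = -\tau\sum_{\ell=1}^2\|v_{\ell,h}^i\|_{\mathcal{H}}^2 - \frac{\tau^2}{2}\sum_{\ell=1}^2 a_{\ell\ell}\|\nabla v_{\ell,h}^i\|^2.$$ In particular, the sequence of energies generated by the algorithm is monotonically decreasing, i.e., $\mathcal{E}[m_{1,h}^{i+1},m_{2,h}^{i+1}]\le\mathcal{E}[m_{1,h}^i,m_{2,h}^i]$. (iv) Under the assumptions of part (ii), there exists $C>0$ such that the approximate stationary point $(m_{1,h},m_{2,h})$ satisfies $$\|\mathcal{I}_h[|m_{\ell,h}|^2]-1\|_{L^1(\Omega)} \le C\tau\Big(1+\sum_{k=1}^2\|m_{k,h}^0\|_{H^1(\Omega)}^2\Big)\quad\text{for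 all } \ell=1,2.$$ The constant $C>0$ depends only on $a_{11},a_{12},a_{22},a_0,c_{\mathcal{H}}$ and the shape-regularity of the family of meshes.
   Context: $\Omega\subset\mathbb{R}^3$ is a bounded Lipschitz polyhedral domain; $\langle\cdot,\cdot\rangle$, $\|\cdot\|$ are the $L^2(\Omega)$ inner product and norm (also for vector- and matrix-valued functions). $a_{11},a_{22},a_{12},a_0\in\mathbb{R}$ satisfy $a_{11}+a_{22}>0$, $a_{11}a_{22}>a_{12}^2$, and $$\mathcal{E}[m_1,m_2] = \frac12\sum_{\ell=1}^2 a_{\ell\ell}\|\nabla m_\ell\|^2 + a_{12}\langle\nabla m_1,\nabla m_2\rangle - a_0\langle m_1,m_2\rangle.$$ $\mathcal{X}=\{(m_1,m_2)\in H^1(\Omega;\mathbb{R}^3)^2: |m_1|=|m_2|=1\text{ a.e.}\}$. $\mathcal{H}$ is a Hilbert space with inner product $\langle\cdot,\cdot\rangle_{\mathcal{H}}$ and norm $\|\cdot\|_{\mathcal{H}}$ such that $\mathcal{X}$ is continuously embedded in $\mathcal{H}\times\mathcal{H}$, and $c_{\mathcal{H}}\ge1$ is a constant with $c_{\mathcal{H}}^{-1}\|\phi\|\le\|\phi\|_{\mathcal{H}}\le c_{\mathcal{H}}\|\phi\|_{H^1(\Omega)}$ for all $\phi\in H^1(\Omega;\mathbb{R}^3)$ (so $H^1(\Omega;\mathbb{R}^3)\subset\mathcal{H}$). $\{\mathcal{T}_h\}_{h>0}$ is a shape-regular family of tetrahedral meshes of $\Omega$ with mesh size $h$ (maximal element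 diameter) and vertex set $\mathcal{N}_h$; $\mathcal{S}^1(\mathcal{T}_h)$ is the space of continuous piecewise affine functions, $\mathcal{I}_h$ the nodal interpolant onto it. For $m_h\in\mathcal{S}^1(\mathcal{T}_h)^3$ nonvanishing at all vertices, $\mathcal{K}_h[m_h]=\{\phi_h\in\mathcal{S}^1(\mathcal{T}_h)^3: m_h(z)\cdot\phi_h(z)=0\ \forall z\in\mathcal{N}_h\}$. Coupled discrete gradient flow algorithm. Parameters: $h>0$, time-step size $\tau>0$, tolerance $\varepsilon>0$. Input: $(m_{1,h}^0,m_{2,h}^0)\in\mathcal{S}^1(\mathcal{T}_h)^3\times\mathcal{S}^1(\mathcal{T}_h)^3$ with $|m_{\ell,h}^0(z)|=1$ for all $z\in\mathcal{N}_h$, $\ell=1,2$. For $i=0,1,2,\dots$: find $(v_{1,h}^i,v_{2,h}^i)\in\mathcal{K}_h[m_{1,h}^i]\times\mathcal{K}_h[m_{2,h}^i]$ such that for all $(\phi_{1,h},\phi_{2,h})\in\mathcal{K}_h[m_{1,h}^i]\times\mathcal{K}_h[m_{2,h}^i]$ and $\ell=1,2$, $$\text{(C)}\quad \langle v_{\ell,h}^i,\phi_{\ell,h}\rangle_{\mathcal{H}} + a_{\ell\ell}\tau\langle\nabla v_{\ell,h}^i,\nabla\phi_{\ell,h}\rangle + \tfrac{a_{12}}{2}\tau\langle\nabla v_{3-\ell,h}^i,\nabla\phi_{\ell,h}\rangle - \tfrac{a_0}{2}\tau\langle v_{3-\ell,h}^i,\phi_{\ell,h}\rangle$$ $$= -a_{\ell\ell}\langle\nabla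 m_{\ell,h}^i,\nabla\phi_{\ell,h}\rangle - a_{12}\langle\nabla m_{3-\ell,h}^i,\nabla\phi_{\ell,h}\rangle + a_0\langle m_{3-\ell,h}^i,\phi_{\ell,h}\rangle;$$ then set $m_{\ell,h}^{i+1}:=m_{\ell,h}^i+\tau v_{\ell,h}^i$, $\ell=1,2$. The algorithm terminates at the smallest integer $i^*\in\mathbb{N}_0$ (if any) such that $\max_{\ell=1,2}(\|v_{\ell,h}^{i^*}\|_{\mathcal{H}}^2+\tau\|\nabla v_{\ell,h}^{i^*}\|^2)\le\varepsilon^2|\Omega|$, and the output (approximate stationary point) is $(m_{1,h},m_{2,h}):=(m_{1,h}^{i^*},m_{2,h}^{i^*})$. In statements "for all $i$" the iteration is considered without stopping.
   Formalization: The constant c_T may depend on c_H as well as on shape-regularity (with c_T independent of c_H, part (ii) is false); the constants are stated for one carrier of the Hilbert space H at a time, which suffices since the image of H^1 is separable and embeds isometrically in l^2. *)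

theory Defs
  imports "HOL-Analysis.Analysis"
begin

section \<open>Lebesgue and Sobolev spaces on an open set of \<open>\<real>\<^sup>3\<close>\<close>

text \<open>
  Elements of \<open>L\<^sup>2(\<Omega>)\<close> and \<open>H\<^sup>1(\<Omega>)\<close> are represented by functions on all of \<open>\<real>\<^sup>3\<close>; only their
  values on \<open>\<Omega>\<close> matter. On matrices (\<open>real ^ 3 ^ 3\<close>) the inner product is the Frobenius one.
\<close>

definition L2 :: "(real^3) set \<Rightarrow> (real^3 \<Rightarrow> 'b::euclidean_space) set" where
  "L2 \<Omega> = {u. u \<in> borel_measurable (lebesgue_on \<Omega>) \<and>
               integrable (lebesgue_on \<Omega>) (\<lambda>x. (norm (u x))\<^sup>2)}"

definition L2_inner ::
  "(real^3) set \<Rightarrow> (real^3 \<Rightarrow> 'b::euclidean_space) \<Rightarrow> (real^3 \<Rightarrow> 'b) \<Rightarrow> real" where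
  "L2_inner \<Omega> u w = (\<integral>x. u x \<bullet> w x \<partial>lebesgue_on \<Omega>)"

definition L2_norm :: "(real^3) set \<Rightarrow> (real^3 \<Rightarrow> 'b::euclidean_space) \<Rightarrow> real" where
  "L2_norm \<Omega> u = sqrt (L2_inner \<Omega> u u)"

definition L1_norm :: "(real^3) set \<Rightarrow> (real^3 \<Rightarrow> 'b::euclidean_space) \<Rightarrow> real" where
  "L1_norm \<Omega> u = (\<integral>x. norm (u x) \<partial>lebesgue_on \<Omega>)"

definition partial :: "3 \<Rightarrow> (real^3 \<Rightarrow> real) \<Rightarrow> real^3 \<Rightarrow> real" where
  "partial j f x = frechet_derivative f (at x) (axis j 1)"

primrec Ck :: "nat \<Rightarrow> (real^3 \<Rightarrow> real) \<Rightarrow> bool" where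
  "Ck 0 f \<longleftrightarrow> continuous_on UNIV f"
| "Ck (Suc k) f \<longleftrightarrow> (\<forall>x. f differentiable (at x)) \<and> (\<forall>j. Ck k (partial j f))"

definition test_functions :: "(real^3) set \<Rightarrow> (real^3 \<Rightarrow> real) set" where
  "test_functions \<Omega> =
    {\<phi>. (\<forall>k. Ck k \<phi>) \<and> (\<exists>S. compact S \<and> S \<subseteq> \<Omega> \<and> (\<forall>x. x \<notin> S \<longrightarrow> \<phi> x = 0))}"

text \<open>The entry \<open>G x $ i $ j\<close> is the weak derivative of the \<open>i\<close>-th component in direction \<open>j\<close>.\<close>

definition has_weak_gradient ::
  "(real^3) set \<Rightarrow> (real^3 \<Rightarrow> real^3) \<Rightarrow> (real^3 \<Rightarrow> real^3^3) \<Rightarrow> bool" where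
  "has_weak_gradient \<Omega> u G \<longleftrightarrow> u \<in> L2 \<Omega> \<and> G \<in> L2 \<Omega> \<and>
    (\<forall>\<phi>\<in>test_functions \<Omega>. \<forall>i j.
       (\<integral>x. u x $ i * partial j \<phi> x \<partial>lebesgue_on \<Omega>) =
       - (\<integral>x. G x $ i $ j * \<phi> x \<partial>lebesgue_on \<Omega>))"

definition H1 :: "(real^3) set \<Rightarrow> (real^3 \<Rightarrow> real^3) set" where
  "H1 \<Omega> = {u. \<exists>G. has_weak_gradient \<Omega> u G}"

definition grad :: "(real^3) set \<Rightarrow> (real^3 \<Rightarrow> real^3) \<Rightarrow> real^3 \<Rightarrow> real^3^3" where
  "grad \<Omega> u = (SOME G. has_weak_gradient \<Omega> u G)"

definition H1_norm :: "(real^3) set \<Rightarrow> (real^3 \<Rightarrow> real^3) \<Rightarrow> real" where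
  "H1_norm \<Omega> u = sqrt ((L2_norm \<Omega> u)\<^sup>2 + (L2_norm \<Omega> (grad \<Omega> u))\<^sup>2)"

text \<open>
  The Hilbert space \<open>\<H>\<close> is a type of class \<open>real_inner\<close> and \<open>complete_space\<close>, and the inclusion
  of \<open>H\<^sup>1(\<Omega>; \<real>\<^sup>3)\<close> into \<open>\<H>\<close> is a linear map \<open>J\<close>. By the two bounds, \<open>J\<close> identifies exactly the
  functions that agree almost everywhere on \<open>\<Omega>\<close>, and \<open>J \<times> J\<close> is continuous on
  \<open>H\<^sup>1(\<Omega>; \<real>\<^sup>3)\<^sup>2\<close>, in particular on the subset of pairs of unit-length fields.
\<close>

definition hilbert_embedding ::
  "(real^3) set \<Rightarrow> real \<Rightarrow> ((real^3 \<Rightarrow> real^3) \<Rightarrow> 'h::{real_inner,complete_space}) \<Rightarrow> bool" where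
  "hilbert_embedding \<Omega> cH J \<longleftrightarrow>
    (\<forall>\<phi>\<in>H1 \<Omega>. \<forall>\<psi>\<in>H1 \<Omega>. J (\<lambda>x. \<phi> x + \<psi> x) = J \<phi> + J \<psi>) \<and>
    (\<forall>c. \<forall>\<phi>\<in>H1 \<Omega>. J (\<lambda>x. c *\<^sub>R \<phi> x) = c *\<^sub>R J \<phi>) \<and>
    (\<forall>\<phi>\<in>H1 \<Omega>. inverse cH * L2_norm \<Omega> \<phi> \<le> norm (J \<phi>) \<and> norm (J \<phi>) \<le> cH * H1_norm \<Omega> \<phi>)"


section \<open>Domains, meshes, finite elements\<close>

text \<open>Near each boundary point, \<open>\<Omega>\<close> is the strict subgraph, in some direction \<open>n\<close>, of a
  Lipschitz function \<open>g\<close> of the component orthogonal to \<open>n\<close>.\<close>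

definition lipschitz_boundary :: "(real^3) set \<Rightarrow> bool" where
  "lipschitz_boundary \<Omega> \<longleftrightarrow> (\<forall>p\<in>frontier \<Omega>. \<exists>n g L r. norm n = 1 \<and> lipschitz_on L UNIV g \<and> r > 0 \<and>
     (\<forall>x\<in>ball p r. x \<in> \<Omega> \<longleftrightarrow> (x - p) \<bullet> n < (g ((x - p) - ((x - p) \<bullet> n) *\<^sub>R n) :: real)))"

definition lipschitz_polyhedral_domain :: "(real^3) set \<Rightarrow> bool" where
  "lipschitz_polyhedral_domain \<Omega> \<longleftrightarrow>
    open \<Omega> \<and> connected \<Omega> \<and> \<Omega> \<noteq> {} \<and> bounded \<Omega> \<and> lipschitz_boundary \<Omega> \<and>
    (\<exists>\<P>. finite \<P> \<and> (\<forall>P\<in>\<P>. polytope P) \<and> closure \<Omega> = \<Union>\<P>)"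

definition tetrahedral_mesh :: "(real^3) set \<Rightarrow> (real^3) set set \<Rightarrow> bool" where
  "tetrahedral_mesh \<Omega> \<T> \<longleftrightarrow> triangulation \<T> \<and> (\<forall>K\<in>\<T>. 3 simplex K) \<and> \<Union>\<T> = closure \<Omega>"

definition inradius :: "(real^3) set \<Rightarrow> real" where
  "inradius K = Sup {r. \<exists>x. cball x r \<subseteq> K}"

text \<open>
  \<open>I\<close> is the set of mesh sizes occurring in the family. It cannot be all of \<open>{0<..}\<close>, since
  the mesh size is at most the diameter of the domain. The number \<open>\<kappa>\<close> quantifies the
  shape-regularity of the whole family.
\<close>

definition shape_regular_family ::
  "(real^3) set \<Rightarrow> real \<Rightarrow> real set \<Rightarrow> (real \<Rightarrow> (real^3) set set) \<Rightarrow> bool" where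
  "shape_regular_family \<Omega> \<kappa> I \<T> \<longleftrightarrow> (\<forall>h\<in>I. h > 0 \<and> tetrahedral_mesh \<Omega> (\<T> h) \<and>
     Max (diameter ` \<T> h) = h \<and> (\<forall>K\<in>\<T> h. diameter K \<le> \<kappa> * inradius K))"

definition vertices :: "(real^3) set set \<Rightarrow> (real^3) set" where
  "vertices \<T> = {z. \<exists>K\<in>\<T>. z extreme_point_of K}"

text \<open>Finite element functions are set to zero outside the closed domain, so that two of them
  are equal as HOL functions iff they agree on the closed domain. With values in
  \<open>real ^ 3\<close> this is \<open>S\<^sup>1(\<T>)\<^sup>3\<close>.\<close>

definition S1 :: "(real^3) set set \<Rightarrow> (real^3 \<Rightarrow> 'b::euclidean_space) set" where
  "S1 \<T> = {u. continuous_on (\<Union>\<T>) u \<and>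
     (\<forall>K\<in>\<T>. \<exists>A b. linear A \<and> (\<forall>x\<in>K. u x = A x + b)) \<and>
     (\<forall>x. x \<notin> \<Union>\<T> \<longrightarrow> u x = 0)}"

definition nodal_interp ::
  "(real^3) set set \<Rightarrow> (real^3 \<Rightarrow> 'b::euclidean_space) \<Rightarrow> real^3 \<Rightarrow> 'b" where
  "nodal_interp \<T> f = (THE u. u \<in> S1 \<T> \<and> (\<forall>z\<in>vertices \<T>. u z = f z))"

definition tangent_space ::
  "(real^3) set set \<Rightarrow> (real^3 \<Rightarrow> real^3) \<Rightarrow> (real^3 \<Rightarrow> real^3) set" where
  "tangent_space \<T> m = {\<phi> \<in> S1 \<T>. \<forall>z\<in>vertices \<T>. m z \<bullet> \<phi> z = 0}"


section \<open>Energy and coupled discrete gradient flow\<close>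

type_synonym field_pair = "(real^3 \<Rightarrow> real^3) \<times> (real^3 \<Rightarrow> real^3)"

definition energy :: "(real^3) set \<Rightarrow> real \<Rightarrow> real \<Rightarrow> real \<Rightarrow> real \<Rightarrow> field_pair \<Rightarrow> real" where
  "energy \<Omega> a11 a22 a12 a0 = (\<lambda>(m1, m2).
     1/2 * (a11 * (L2_norm \<Omega> (grad \<Omega> m1))\<^sup>2 + a22 * (L2_norm \<Omega> (grad \<Omega> m2))\<^sup>2)
     + a12 * L2_inner \<Omega> (grad \<Omega> m1) (grad \<Omega> m2)
     - a0 * L2_inner \<Omega> m1 m2)"

definition initial_pair :: "(real^3) set set \<Rightarrow> field_pair \<Rightarrow> bool" where
  "initial_pair \<T> = (\<lambda>(m1, m2). m1 \<in> S1 \<T> \<and> m2 \<in> S1 \<T> \<and>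
     (\<forall>z\<in>vertices \<T>. norm (m1 z) = 1 \<and> norm (m2 z) = 1))"

text \<open>One of the two equations of the variational problem, tested with \<open>\<phi>\<close>: \<open>m\<close>, \<open>v\<close> and \<open>a\<close> carry
  the index \<open>\<ell>\<close> of the equation, \<open>m'\<close> and \<open>v'\<close> carry the other index \<open>3 - \<ell>\<close>.\<close>

definition flow_equation ::
  "(real^3) set \<Rightarrow> ((real^3 \<Rightarrow> real^3) \<Rightarrow> 'h::{real_inner,complete_space}) \<Rightarrow>
   real \<Rightarrow> real \<Rightarrow> real \<Rightarrow> real \<Rightarrow>
   (real^3 \<Rightarrow> real^3) \<Rightarrow> (real^3 \<Rightarrow> real^3) \<Rightarrow> (real^3 \<Rightarrow> real^3) \<Rightarrow> (real^3 \<Rightarrow> real^3) \<Rightarrow>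
   (real^3 \<Rightarrow> real^3) \<Rightarrow> bool" where
  "flow_equation \<Omega> J a a12 a0 \<tau> m m' v v' \<phi> \<longleftrightarrow>
     J v \<bullet> J \<phi> + a * \<tau> * L2_inner \<Omega> (grad \<Omega> v) (grad \<Omega> \<phi>)
     + a12 / 2 * \<tau> * L2_inner \<Omega> (grad \<Omega> v') (grad \<Omega> \<phi>) - a0 / 2 * \<tau> * L2_inner \<Omega> v' \<phi>
     = - a * L2_inner \<Omega> (grad \<Omega> m) (grad \<Omega> \<phi>)
     - a12 * L2_inner \<Omega> (grad \<Omega> m') (grad \<Omega> \<phi>) + a0 * L2_inner \<Omega> m' \<phi>"

definition solves_flow_problem ::
  "(real^3) set \<Rightarrow> (real^3) set set \<Rightarrow> ((real^3 \<Rightarrow> real^3) \<Rightarrow> 'h::{real_inner,complete_space}) \<Rightarrow>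
   real \<Rightarrow> real \<Rightarrow> real \<Rightarrow> real \<Rightarrow> real \<Rightarrow> field_pair \<Rightarrow> field_pair \<Rightarrow> bool" where
  "solves_flow_problem \<Omega> \<T> J a11 a22 a12 a0 \<tau> = (\<lambda>(m1, m2) (v1, v2).
     v1 \<in> tangent_space \<T> m1 \<and> v2 \<in> tangent_space \<T> m2 \<and>
     (\<forall>\<phi>1\<in>tangent_space \<T> m1. \<forall>\<phi>2\<in>tangent_space \<T> m2.
        flow_equation \<Omega> J a11 a12 a0 \<tau> m1 m2 v1 v2 \<phi>1 \<and>
        flow_equation \<Omega> J a22 a12 a0 \<tau> m2 m1 v2 v1 \<phi>2))"

text \<open>The update computed from \<open>m\<close>; meaningful whenever the variational problem is uniquely
  solvable.\<close>

definition velocity ::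
  "(real^3) set \<Rightarrow> (real^3) set set \<Rightarrow> ((real^3 \<Rightarrow> real^3) \<Rightarrow> 'h::{real_inner,complete_space}) \<Rightarrow>
   real \<Rightarrow> real \<Rightarrow> real \<Rightarrow> real \<Rightarrow> real \<Rightarrow> field_pair \<Rightarrow> field_pair" where
  "velocity \<Omega> \<T> J a11 a22 a12 a0 \<tau> m = (THE v. solves_flow_problem \<Omega> \<T> J a11 a22 a12 a0 \<tau> m v)"

primrec flow_iterate ::
  "(real^3) set \<Rightarrow> (real^3) set set \<Rightarrow> ((real^3 \<Rightarrow> real^3) \<Rightarrow> 'h::{real_inner,complete_space}) \<Rightarrow>
   real \<Rightarrow> real \<Rightarrow> real \<Rightarrow> real \<Rightarrow> real \<Rightarrow> field_pair \<Rightarrow> nat \<Rightarrow> field_pair" where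
  "flow_iterate \<Omega> \<T> J a11 a22 a12 a0 \<tau> m0 0 = m0"
| "flow_iterate \<Omega> \<T> J a11 a22 a12 a0 \<tau> m0 (Suc i) =
    (let m = flow_iterate \<Omega> \<T> J a11 a22 a12 a0 \<tau> m0 i;
         v = velocity \<Omega> \<T> J a11 a22 a12 a0 \<tau> m
     in (\<lambda>x. fst m x + \<tau> *\<^sub>R fst v x, \<lambda>x. snd m x + \<tau> *\<^sub>R snd v x))"

definition stopping_criterion ::
  "(real^3) set \<Rightarrow> ((real^3 \<Rightarrow> real^3) \<Rightarrow> 'h::{real_inner,complete_space}) \<Rightarrow>
   real \<Rightarrow> real \<Rightarrow> field_pair \<Rightarrow> bool" where
  "stopping_criterion \<Omega> J \<tau> \<epsilon> = (\<lambda>(v1, v2).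
     max ((norm (J v1))\<^sup>2 + \<tau> * (L2_norm \<Omega> (grad \<Omega> v1))\<^sup>2)
         ((norm (J v2))\<^sup>2 + \<tau> * (L2_norm \<Omega> (grad \<Omega> v2))\<^sup>2) \<le> \<epsilon>\<^sup>2 * measure lebesgue \<Omega>)"

end

theory Submission
  imports Defs "HOL-Library.Function_Algebras"
begin

text \<open>
  Testing the two equations with \<open>v\<^sub>1\<close> and \<open>v\<^sub>2\<close> gives the energy identity, since the energy is
  quadratic. The update is orthogonal to \<open>m\<close> at every vertex, so \<open>|m|\<^sup>2\<close> grows there by \<open>\<tau>\<^sup>2 |v|\<^sup>2\<close> in each step.
  Since the elementwise maximum of \<open>|v|\<^sup>2\<close> over the vertices is controlled by its integral (with the
  universal constant 256), both the constraint violation and the growth of the \<open>L\<^sup>2\<close> norm of \<open>m\<close> are bounded by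
  \<open>\<tau>\<^sup>2\<close> times the sum of the \<open>\<parallel>v\<parallel>\<^sup>2\<close>, that is, by \<open>\<tau>\<close> times the energy drop.
  The energy is bounded below up to \<open>\<bar>a0\<bar>\<close> times the \<open>L\<^sup>2\<close> norms, so for \<open>256 cH\<^sup>2 \<bar>a0\<bar> \<tau> \<le> 1\<close> the drop
  absorbs this growth and is bounded by the initial data. Hence the velocities are square summable.
\<close>

section \<open>Smooth cut-off functions of boxes\<close>

text \<open>Most of the length is owed to \<open>grad\<close>, which is a choice among weak
  gradients. Energies are quadratic only once this choice is known to be unique almost everywhere,
  and that needs the fundamental lemma and hence explicit smooth functions of compact support. In
  turn, the iterates lie in the domain of \<open>grad\<close> only because piecewise affine
  functions are weakly differentiable.

  The mesh covers the closure of \<open>\<Omega>\<close>, whereas the norms are integrals over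
  \<open>\<Omega>\<close>; the Lipschitz condition on the boundary excludes slits and places the
  open elements inside \<open>\<Omega>\<close>.

  The constant 256 is the product of a volume ratio 64 and a loss of 4 in |v|^2, both realised by a
  homothety of the element. Applied to the initial field, whose nodal values are unit vectors, the
  same inequality bounds the volume of the domain by the initial mass, so that no size of
  \<open>\<Omega>\<close> enters the final constant.\<close>

definition flat_exp :: "real poly \<Rightarrow> real \<Rightarrow> real" where
  "flat_exp p t = (if t > 0 then poly p (1 / t) * exp (- 1 / t) else 0)"

lemma poly_times_exp_minus_tendsto_0: "((\<lambda>s::real. poly p s * exp (- s)) \<longlongrightarrow> 0) at_top"
proof -
  have "((\<lambda>s::real. \<Sum>i\<le>degree p. coeff p i * (s ^ i / exp s)) \<longlongrightarrow> (\<Sum>i\<le>degree p. coeff p i * 0)) at_top"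
    by (intro tendsto_intros tendsto_power_div_exp_0)
  then show ?thesis
    by (simp add: poly_altdef sum_distrib_right sum_divide_distrib exp_minus field_simps)
qed

lemma flat_exp_tendsto_0: "(flat_exp p \<longlongrightarrow> 0) (at 0)"
proof (subst filterlim_at_split, rule conjI)
  have "\<forall>\<^sub>F t in at_left (0::real). 0 = flat_exp p t"
    by (auto simp: flat_exp_def eventually_at_filter)
  then show "(flat_exp p \<longlongrightarrow> 0) (at_left 0)"
    by (rule Lim_transform_eventually[OF tendsto_const])
  have lim: "((\<lambda>t. poly p (inverse t) * exp (- inverse t)) \<longlongrightarrow> 0) (at_right 0)"
    by (rule filterlim_compose[OF poly_times_exp_minus_tendsto_0 filterlim_inverse_at_top_right])
  have "\<forall>\<^sub>F t in at_right (0::real). poly p (inverse t) * exp (- inverse t) = flat_exp p t"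
    by (auto simp: flat_exp_def inverse_eq_divide eventually_at_filter)
  with lim show "(flat_exp p \<longlongrightarrow> 0) (at_right 0)"
    by (rule Lim_transform_eventually)
qed

text \<open>With s = 1/t, differentiating p(s) exp(-s) in t gives s^2 (p(s) - p'(s)) exp(-s), which
  explains the factor \<open>[:0, 0, 1:]\<close>. The family is thus closed under differentiation,
  and smoothness of exp(-1/t) becomes an induction in which only the polynomial changes.\<close>

lemma flat_exp_has_derivative:
  "(flat_exp p has_real_derivative flat_exp ([:0, 0, 1:] * (p - pderiv p)) t) (at t)"
proof -
  consider "t > 0" | "t < 0" | "t = 0" by linarith
  then show ?thesis
  proof cases
    case 1
    have "((\<lambda>t. poly p (1 / t) * exp (- 1 / t)) has_real_derivative
        flat_exp ([:0, 0, 1:] * (p - pderiv p)) t) (at t)"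
      using 1
      by (auto intro!: derivative_eq_intros DERIV_chain2[OF poly_DERIV] simp: flat_exp_def field_simps)
    then show ?thesis
      by (rule has_field_derivative_transform_within_open[where S="{0<..}"])
        (use 1 in \<open>auto simp: flat_exp_def\<close>)
  next
    case 2
    have "((\<lambda>t. 0) has_real_derivative flat_exp ([:0, 0, 1:] * (p - pderiv p)) t) (at t)"
      using 2 by (auto simp: flat_exp_def)
    then show ?thesis
      by (rule has_field_derivative_transform_within_open[where S="{..<0}"])
        (use 2 in \<open>auto simp: flat_exp_def\<close>)
  next
    case 3
    \<comment> \<open>Dividing by h multiplies the polynomial by s = 1/h, so the difference quotient
      at 0 is again a member of the family and tends to 0.\<close>
    have "((\<lambda>h. (flat_exp p (0 + h) - flat_exp p 0) / h) \<longlongrightarrow> 0) (at 0)"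
      by (rule Lim_transform_eventually[OF flat_exp_tendsto_0[of "[:0,1:] * p"]])
        (auto simp: flat_exp_def eventually_at_filter)
    then show ?thesis
      using 3 by (simp add: DERIV_def flat_exp_def)
  qed
qed

section \<open>Calculus rules for functions differentiable to a given order\<close>

lemma partial_eqI: "(f has_derivative f') (at x) \<Longrightarrow> partial j f x = f' (axis j 1)"
  unfolding partial_def by (metis frechet_derivative_at)

text \<open>The Leibniz rule pairs a derivative of one factor with the other factor itself, so
  \<open>Ck_mult\<close> has to lower the order of the undifferentiated factor.\<close>

lemma Ck_Suc_imp_Ck: "Ck (Suc k) f \<Longrightarrow> Ck k f"
proof (induction k arbitrary: f)
  case 0
  then show ?case
    by (auto intro!: differentiable_imp_continuous_on simp: differentiable_on_def
        intro: differentiable_at_withinI)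
next
  case (Suc k)
  then show ?case by (metis Ck.simps(2))
qed

lemma Ck_add: "Ck k f \<Longrightarrow> Ck k g \<Longrightarrow> Ck k (\<lambda>x. f x + g x)"
proof (induction k arbitrary: f g)
  case 0
  then show ?case by (simp add: continuous_on_add)
next
  case (Suc k)
  have "partial j (\<lambda>x. f x + g x) = (\<lambda>x. partial j f x + partial j g x)" for j
  proof
    fix x
    have "(f has_derivative frechet_derivative f (at x)) (at x)"
      "(g has_derivative frechet_derivative g (at x)) (at x)"
      using Suc.prems by (simp_all add: frechet_derivative_works[symmetric])
    from has_derivative_add[OF this] show "partial j (\<lambda>x. f x + g x) x = partial j f x + partial j g x"
      by (subst partial_eqI) (auto simp: partial_def)
  qed
  with Suc show ?case by simp
qed

lemma Ck_mult: "Ck k f \<Longrightarrow> Ck k g \<Longrightarrow> Ck k (\<lambda>x. f x * g x)"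
proof (induction k arbitrary: f g)
  case 0
  then show ?case by (simp add: continuous_on_mult)
next
  case (Suc k)
  have "partial j (\<lambda>x. f x * g x) = (\<lambda>x. f x * partial j g x + partial j f x * g x)" for j
  proof
    fix x
    have "(f has_derivative frechet_derivative f (at x)) (at x)"
      "(g has_derivative frechet_derivative g (at x)) (at x)"
      using Suc.prems by (simp_all add: frechet_derivative_works[symmetric])
    from has_derivative_mult[OF this]
    show "partial j (\<lambda>x. f x * g x) x = f x * partial j g x + partial j f x * g x"
      by (subst partial_eqI) (auto simp: partial_def)
  qed
  moreover have "Ck k f" "Ck k g" using Suc.prems Ck_Suc_imp_Ck by blast+
  ultimately show ?case using Suc by (auto intro!: Ck_add Suc.IH)
qed

lemma Ck_const: "Ck k (\<lambda>x. c)"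
proof (induction k arbitrary: c)
  case (Suc k)
  have "partial j (\<lambda>x. c) = (\<lambda>x. 0)" for j
    by (rule ext, subst partial_eqI[OF has_derivative_const]) simp
  with Suc show ?case by simp
qed simp

lemma Ck_prod: "(\<And>i. i \<in> I \<Longrightarrow> Ck k (f i)) \<Longrightarrow> Ck k (\<lambda>x. \<Prod>i\<in>I. f i x)"
  by (induction I rule: infinite_finite_induct) (auto intro: Ck_const Ck_mult)

text \<open>The induction needs \<open>p\<close> arbitrary, since each partial derivative replaces
  it. Affine arguments suffice because every factor of a box bump depends on one coordinate
  only.\<close>

lemma Ck_flat_exp_affine: "Ck k (\<lambda>x. flat_exp p (c + w \<bullet> x))"
proof (induction k arbitrary: p)
  case 0
  have "continuous_on UNIV (flat_exp p)"
    using flat_exp_has_derivative DERIV_isCont continuous_at_imp_continuous_on by blast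
  then have "continuous_on UNIV (\<lambda>x. flat_exp p (c + w \<bullet> x))"
    by (rule continuous_on_compose2) (auto intro!: continuous_intros)
  then show ?case by simp
next
  case (Suc k)
  let ?q = "[:0, 0, 1:] * (p - pderiv p)"
  have der: "((\<lambda>x. flat_exp p (c + w \<bullet> x)) has_derivative
      (\<lambda>h. flat_exp ?q (c + w \<bullet> x) * (w \<bullet> h))) (at x)" for x
  proof -
    have "((\<lambda>x. c + w \<bullet> x) has_derivative (\<lambda>h. w \<bullet> h)) (at x)"
      by (auto intro!: derivative_eq_intros)
    from has_derivative_compose[OF this flat_exp_has_derivative[of p "c + w \<bullet> x", unfolded has_field_derivative_def]]
    show ?thesis by (simp add: mult.commute)
  qed
  have "partial j (\<lambda>x. flat_exp p (c + w \<bullet> x)) = (\<lambda>x. (w \<bullet> axis j 1) * flat_exp ?q (c + w \<bullet> x))" for j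
    by (rule ext, subst partial_eqI[OF der]) simp
  moreover have "\<forall>x. (\<lambda>x. flat_exp p (c + w \<bullet> x)) differentiable at x"
    using der differentiable_def by blast
  ultimately show ?case using Suc.IH[of ?q] by (simp add: Ck_mult Ck_const del: mult_pCons_left)
qed

text \<open>For r > 0 this is a smooth function that is positive exactly in the open box, with one
  factor per face. The parameter r steepens it: exp(-1/(r s)) tends to 1 for every s > 0, so the
  bumps tend to the indicator of the box pointwise while staying between 0 and 1.\<close>

definition box_bump :: "real \<Rightarrow> real^3 \<Rightarrow> real^3 \<Rightarrow> real^3 \<Rightarrow> real" where
  "box_bump r a b x = (\<Prod>i\<in>UNIV. flat_exp 1 (r * (x $ i - a $ i)) * flat_exp 1 (r * (b $ i - x $ i)))"

lemma flat_exp_1_bounds: "0 \<le> flat_exp 1 t" "flat_exp 1 t \<le> 1"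
  by (auto simp: flat_exp_def)

lemma box_bump_bounds: "0 \<le> box_bump r a b x" "box_bump r a b x \<le> 1"
  unfolding box_bump_def
  by (auto intro!: prod_nonneg prod_le_1 mult_nonneg_nonneg mult_le_one flat_exp_1_bounds)

lemma Ck_box_bump: "Ck k (box_bump r a b)"
proof -
  have "Ck k (\<lambda>x. flat_exp 1 (r * (x $ i - a $ i)) * flat_exp 1 (r * (b $ i - x $ i)))" for i
  proof -
    have "r * (x $ i - a $ i) = - r * a $ i + axis i r \<bullet> x"
      "r * (b $ i - x $ i) = r * b $ i + axis i (- r) \<bullet> x" for x :: "real^3"
      by (simp_all add: inner_axis' algebra_simps)
    then show ?thesis by (simp only:) (intro Ck_mult Ck_flat_exp_affine)
  qed
  then show ?thesis unfolding box_bump_def by (intro Ck_prod)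
qed

lemma box_bump_outside:
  assumes "r > 0" "x \<notin> box a b"
  shows "box_bump r a b x = 0"
proof -
  obtain i where "\<not> (a $ i < x $ i \<and> x $ i < b $ i)"
    using assms(2) by (auto simp: mem_box_cart)
  then have "flat_exp 1 (r * (x $ i - a $ i)) * flat_exp 1 (r * (b $ i - x $ i)) = 0"
    using assms(1) by (auto simp: flat_exp_def zero_less_mult_iff)
  then show ?thesis unfolding box_bump_def by (meson finite prod_zero UNIV_I)
qed

lemma box_bump_test_function:
  assumes "r > 0" "cbox a b \<subseteq> \<Omega>"
  shows "box_bump r a b \<in> test_functions \<Omega>"
proof -
  have "box_bump r a b x = 0" if "x \<notin> cbox a b" for x
    using that assms(1) box_bump_outside box_subset_cbox by blast
  then show ?thesis
    unfolding test_functions_def using assms by (auto simp: Ck_box_bump intro!: exI[of _ "cbox a b"])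
qed

lemma box_bump_tendsto:
  "(\<lambda>n. box_bump (real (Suc n)) a b x) \<longlonglongrightarrow> indicator (box a b) x"
proof (cases "x \<in> box a b")
  case True
  have "(\<lambda>n. flat_exp 1 (real (Suc n) * s)) \<longlonglongrightarrow> 1" if "s > 0" for s
  proof -
    have "(\<lambda>n. exp (- (1 / s) * inverse (real (Suc n)))) \<longlonglongrightarrow> exp (- (1 / s) * 0)"
      by (intro tendsto_intros LIMSEQ_inverse_real_of_nat)
    moreover have "flat_exp 1 (real (Suc n) * s) = exp (- (1 / s) * inverse (real (Suc n)))" for n
      using that by (simp add: flat_exp_def zero_less_mult_iff field_simps add_pos_nonneg)
    ultimately show ?thesis by simp
  qed
  then have "(\<lambda>n. box_bump (real (Suc n)) a b x) \<longlonglongrightarrow> (\<Prod>i\<in>(UNIV::3 set). 1 * 1)"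
    unfolding box_bump_def using True
    by (intro tendsto_prod tendsto_mult) (auto simp: mem_box_cart)
  then show ?thesis using True by simp
next
  case False
  then show ?thesis by (simp add: box_bump_outside)
qed

section \<open>The fundamental lemma of the calculus of variations\<close>

text \<open>Open boxes are stable under intersection and generate the Borel sets, so Dynkin's
  argument carries the vanishing of integrals to all Borel sets, where uniqueness of densities
  applies. A Borel version \<open>g\<close> stands in for \<open>f\<close> because boxes generate
  only the Borel sets.\<close>

lemma AE_zero_if_box_integrals_zero:
  fixes f :: "'a::euclidean_space \<Rightarrow> real"
  assumes f: "integrable lebesgue f"
    and box0: "\<And>a b. (LINT x:box a b|lebesgue. f x) = 0"
  shows "AE x in lebesgue. f x = 0"
proof -
  obtain g where [measurable]: "g \<in> borel_measurable lborel" and fg: "AE x in lborel. f x = g x"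
    using completion_ex_borel_measurable_real[OF borel_measurable_integrable[OF f]] by auto
  have fg': "AE x in lebesgue. f x = g x"
    using fg by (rule AE_completion)
  have [measurable]: "g \<in> borel_measurable lebesgue" "f \<in> borel_measurable lebesgue"
    using f by (auto intro: measurable_completion)
  have "integrable lebesgue g"
    using integrable_cong_AE_imp[OF f _ fg'] by simp
  then have g: "integrable lborel g"
    by (simp add: integrable_completion)
  have g_on: "set_integrable lborel A g" if "A \<in> sets borel" for A
    unfolding set_integrable_def using that by (intro integrable_mult_indicator g) simp
  have gbox: "(LINT x:box a b|lborel. g x) = 0" for a b
  proof -
    have "(LINT x:box a b|lborel. g x) = (LINT x:box a b|lebesgue. g x)"
      unfolding set_lebesgue_integral_def by (subst integral_completion) auto
    also have "\<dots> = (LINT x:box a b|lebesgue. f x)"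
      unfolding set_lebesgue_integral_def
    proof (rule integral_cong_AE)
      show "AE x in lebesgue. indicator (box a b) x *\<^sub>R g x = indicator (box a b) x *\<^sub>R f x"
        using fg' by eventually_elim simp
    qed (intro borel_measurable_scaleR borel_measurable_indicator; simp)+
    finally show ?thesis using box0 by simp
  qed
  \<comment> \<open>Complements in the Dynkin induction require the integral over the whole space,
    obtained from boxes growing to fill it.\<close>
  have total: "(\<integral>x. g x \<partial>lborel) = 0"
  proof -
    let ?B = "\<lambda>n. box (- real n *\<^sub>R One) (real n *\<^sub>R One) :: 'a set"
    have "(\<lambda>n. LINT x|lborel. indicator (?B n) x *\<^sub>R g x) \<longlonglongrightarrow> (LINT x|lborel. g x)"
    proof (rule integral_dominated_convergence[where w="\<lambda>x. norm (g x)"])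
      show "AE x in lborel. (\<lambda>n. indicator (?B n) x *\<^sub>R g x) \<longlonglongrightarrow> g x"
      proof (rule AE_I2, rule tendsto_eventually)
        fix x :: 'a
        obtain N :: nat where N: "norm x < real N" using reals_Archimedean2 by blast
        have "x \<in> ?B n" if "n \<ge> N" for n
        proof -
          have "norm x < real n" using N that by (meson of_nat_mono less_le_trans)
          then have "\<bar>x \<bullet> e\<bar> < real n" if "e \<in> Basis" for e
            using Basis_le_norm[OF that, of x] by (rule le_less_trans[rotated])
          then have "- real n < x \<bullet> e \<and> x \<bullet> e < real n" if "e \<in> Basis" for e
            using that by (simp add: abs_less_iff minus_less_iff)
          then show ?thesis by (simp add: mem_box)
        qed
        then show "\<forall>\<^sub>F n in sequentially. indicator (?B n) x *\<^sub>R g x = g x"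
          unfolding eventually_sequentially by (intro exI[of _ N]) auto
      qed
      show "AE x in lborel. norm (indicator (?B n) x *\<^sub>R g x) \<le> norm (g x)" for n
        by (rule AE_I2) (simp add: indicator_def)
      show "integrable lborel (\<lambda>x. norm (g x))" using g by (rule integrable_norm)
    qed simp_all
    then have "(\<lambda>n::nat. 0) \<longlonglongrightarrow> (LINT x|lborel. g x)"
      using gbox unfolding set_lebesgue_integral_def by simp
    then show ?thesis by (simp add: LIMSEQ_const_iff)
  qed
  have "(LINT x:A|lborel. g x) = 0" if "A \<in> sets borel" for A
  proof -
    have A: "A \<in> sigma_sets UNIV (range (\<lambda>(a, b). box a b))"
      using that by (subst (asm) borel_eq_box) simp
    have stable: "Int_stable (range (\<lambda>(a, b). box a b :: 'a set))"
      by (auto simp: Int_stable_def box_Int_box)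
    have borel: "B \<in> sets borel" if "B \<in> sigma_sets UNIV (range (\<lambda>(a, b). box a b))" for B :: "'a set"
      using that by (subst borel_eq_box) simp
    show ?thesis
    proof (rule sigma_sets_induct_disjoint[OF stable _ A, where P="\<lambda>A. (LINT x:A|lborel. g x) = 0"])
      fix A assume compl: "A \<in> sigma_sets UNIV (range (\<lambda>(a, b). box a b))" "(LINT x:A|lborel. g x) = 0"
      have [measurable]: "A \<in> sets borel" using borel compl by blast
      have "(LINT x:UNIV - A|lborel. g x) = (LINT x|lborel. g x - indicator A x *\<^sub>R g x)"
        unfolding set_lebesgue_integral_def
        by (intro Bochner_Integration.integral_cong) (auto simp: indicator_def)
      also have "\<dots> = 0"
        using total compl g_on[of A] g
        by (subst Bochner_Integration.integral_diff) (auto simp: set_integrable_def set_lebesgue_integral_def)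
      finally show "(LINT x:UNIV - A|lborel. g x) = 0" .
    next
      fix A :: "nat \<Rightarrow> 'a set"
      assume union: "disjoint_family A" "range A \<subseteq> sigma_sets UNIV (range (\<lambda>(a, b). box a b))"
        "\<And>i. (LINT x:A i|lborel. g x) = 0"
      have "range A \<subseteq> sets borel" using borel union by blast
      then have "(LINT x:(\<Union>i. A i)|lborel. g x) = (\<Sum>i. (LINT x:(A i)|lborel. g x))"
        using union by (intro lebesgue_integral_countable_add g_on) (auto simp: disjoint_family_on_def)
      then show "(LINT x:(\<Union>i. A i)|lborel. g x) = 0" using union by simp
    next
      show "(LINT x:{}|lborel. g x) = 0" by (simp add: set_lebesgue_integral_def)
    next
      fix A assume "A \<in> range (\<lambda>(a, b). box a b :: 'a set)"
      then show "(LINT x:A|lborel. g x) = 0" using gbox by auto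
    qed simp
  qed
  then have "AE x in lborel. g x = 0"
    by (intro density_unique_real g) auto
  then have "AE x in lebesgue. g x = 0" by (rule AE_completion)
  with fg' show ?thesis by eventually_elim simp
qed

text \<open>Box bumps are admissible test functions as soon as the closed box lies in
  \<open>\<Omega>\<close>; |f| dominates the products, because bumps take values in [0,1].\<close>

lemma integral_box_eq_0_if_orthogonal_to_test_functions:
  assumes f: "integrable (lebesgue_on \<Omega>) f"
    and orth: "\<And>\<phi>. \<phi> \<in> test_functions \<Omega> \<Longrightarrow> (\<integral>x. f x * \<phi> x \<partial>lebesgue_on \<Omega>) = 0"
    and sub: "cbox a b \<subseteq> \<Omega>" and \<Omega>: "\<Omega> \<in> sets lebesgue"
  shows "(\<integral>x. f x * indicator (box a b) x \<partial>lebesgue_on \<Omega>) = 0"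
proof -
  have Ck0: "continuous_on UNIV (box_bump r a b)" for r
    using Ck_box_bump[of 0] by simp
  have [measurable]: "box_bump r a b \<in> borel_measurable (lebesgue_on \<Omega>)" for r
    using Ck0 by (auto intro!: measurable_restrict_space1 borel_measurable_continuous_onI measurable_completion)
  have [measurable]: "f \<in> borel_measurable (lebesgue_on \<Omega>)" using f by auto
  have [measurable]: "(indicator (box a b) :: _ \<Rightarrow> real) \<in> borel_measurable (lebesgue_on \<Omega>)"
    by (intro measurable_restrict_space1 borel_measurable_indicator) auto
  have "(\<lambda>n. \<integral>x. f x * box_bump (real (Suc n)) a b x \<partial>lebesgue_on \<Omega>)
      \<longlonglongrightarrow> (\<integral>x. f x * indicator (box a b) x \<partial>lebesgue_on \<Omega>)"
  proof (rule integral_dominated_convergence[where w="\<lambda>x. norm (f x)"])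
    show "AE x in lebesgue_on \<Omega>. (\<lambda>n. f x * box_bump (real (Suc n)) a b x)
        \<longlonglongrightarrow> f x * indicator (box a b) x"
      by (intro AE_I2 tendsto_mult tendsto_const box_bump_tendsto)
    show "AE x in lebesgue_on \<Omega>. norm (f x * box_bump (real (Suc n)) a b x) \<le> norm (f x)" for n
      using box_bump_bounds by (auto simp: abs_mult mult_left_le)
  qed (use f in auto)
  moreover have "(\<integral>x. f x * box_bump (real (Suc n)) a b x \<partial>lebesgue_on \<Omega>) = 0" for n
    by (rule orth[OF box_bump_test_function[OF _ sub]]) simp
  ultimately show ?thesis by (simp add: LIMSEQ_const_iff)
qed

text \<open>Boxes that leave \<open>\<Omega>\<close> carry no admissible bump, so \<open>f\<close>
  is first restricted to a box whose closure lies in \<open>\<Omega>\<close>; intersecting that box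
  with an arbitrary one stays inside. Countably many closed boxes exhaust
  \<open>\<Omega>\<close>.\<close>

lemma AE_zero_if_orthogonal_to_test_functions:
  assumes "open \<Omega>" and f: "integrable (lebesgue_on \<Omega>) f"
    and orth: "\<And>\<phi>. \<phi> \<in> test_functions \<Omega> \<Longrightarrow> (\<integral>x. f x * \<phi> x \<partial>lebesgue_on \<Omega>) = 0"
  shows "AE x in lebesgue_on \<Omega>. f x = 0"
proof -
  have \<Omega>[simp]: "\<Omega> \<in> sets lebesgue" using \<open>open \<Omega>\<close> by auto
  have local: "AE x in lebesgue. x \<in> cbox c d \<longrightarrow> f x = 0" if cd: "cbox c d \<subseteq> \<Omega>" for c d
  proof -
    let ?g = "\<lambda>x. indicator (box c d) x * f x"
    have eq: "indicator (box c d) x *\<^sub>R (indicator \<Omega> x *\<^sub>R f x) = ?g x" for x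
      using cd box_subset_cbox[of c d] by (auto simp: indicator_def)
    have "integrable lebesgue (\<lambda>x. indicator \<Omega> x *\<^sub>R f x)"
      using f integrable_restrict_space[of \<Omega> lebesgue f] by (simp only: space_completion space_lborel) auto
    then have g: "integrable lebesgue ?g"
      by (subst eq[symmetric]) (rule integrable_mult_indicator, auto)
    have "AE x in lebesgue. ?g x = 0"
    proof (rule AE_zero_if_box_integrals_zero[OF g])
      fix a b :: "real^3"
      \<comment> \<open>The same corners serve the open and the closed intersection, so
        \<open>cbox p q\<close> stays inside \<open>cbox c d\<close>.\<close>
      obtain p q where pq: "box a b \<inter> box c d = box p q" "cbox a b \<inter> cbox c d = cbox p q"
        using that[OF box_Int_box Int_interval] by blast
      have "(LINT x:box a b|lebesgue. ?g x) = (LINT x|lebesgue. indicator \<Omega> x *\<^sub>R (f x * indicator (box p q) x))"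
        unfolding set_lebesgue_integral_def pq(1)[symmetric] using cd box_subset_cbox[of c d]
        by (intro Bochner_Integration.integral_cong) (auto simp: indicator_def)
      also have "\<dots> = (\<integral>x. f x * indicator (box p q) x \<partial>lebesgue_on \<Omega>)"
        by (simp add: integral_restrict_space)
      also have "\<dots> = 0"
        using pq cd by (intro integral_box_eq_0_if_orthogonal_to_test_functions[OF f orth]) auto
      finally show "(LINT x:box a b|lebesgue. ?g x) = 0" .
    qed
    \<comment> \<open>The cut-off lives on the open box, while the countable cover below uses closed
      ones; the frontier between them is null.\<close>
    moreover have "AE x in lebesgue. x \<notin> cbox c d - box c d"
      using negligible_frontier_interval[of c d] by (simp only: negligible_iff_null_sets AE_not_in)
    ultimately show ?thesis by eventually_elim auto
  qed
  obtain \<D> where \<D>: "countable \<D>" "\<D> \<subseteq> Pow \<Omega>" "\<And>X. X \<in> \<D> \<Longrightarrow> \<exists>a b. X = cbox a b" "\<Union>\<D> = \<Omega>"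
    using open_countable_Union_open_cbox[OF \<open>open \<Omega>\<close>] by metis
  have "AE x in lebesgue. \<forall>X\<in>\<D>. x \<in> X \<longrightarrow> f x = 0"
    using \<D>(1) by (rule AE_ball_countable'[rotated]) (use \<D>(2,3) local in blast)
  then have "AE x in lebesgue. x \<in> \<Omega> \<longrightarrow> f x = 0"
    by eventually_elim (use \<D>(4) in blast)
  then show ?thesis by (subst AE_restrict_space_iff) auto
qed

section \<open>Weak gradients\<close>

lemma L2_measurable: "u \<in> L2 \<Omega> \<Longrightarrow> u \<in> borel_measurable (lebesgue_on \<Omega>)"
  by (simp add: L2_def)

lemma L2_integrable_norm_sq: "u \<in> L2 \<Omega> \<Longrightarrow> integrable (lebesgue_on \<Omega>) (\<lambda>x. (norm (u x))\<^sup>2)"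
  by (simp add: L2_def)

lemma abs_inner_le_norm_sq: "\<bar>x \<bullet> y\<bar> \<le> (norm x)\<^sup>2 + (norm y)\<^sup>2"
proof -
  have "\<bar>x \<bullet> y\<bar> \<le> norm x * norm y" by (rule Cauchy_Schwarz_ineq2)
  also have "2 * (norm x * norm y) \<le> (norm x)\<^sup>2 + (norm y)\<^sup>2"
    using sum_squares_bound[of "norm x" "norm y"] by simp
  finally show ?thesis using mult_nonneg_nonneg[OF norm_ge_zero[of x] norm_ge_zero[of y]] by linarith
qed

lemma L2_integrable_inner:
  assumes "u \<in> L2 \<Omega>" "w \<in> L2 \<Omega>"
  shows "integrable (lebesgue_on \<Omega>) (\<lambda>x. u x \<bullet> w x)"
proof (rule Bochner_Integration.integrable_bound)
  show "integrable (lebesgue_on \<Omega>) (\<lambda>x. (norm (u x))\<^sup>2 + (norm (w x))\<^sup>2)"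
    using assms by (intro Bochner_Integration.integrable_add L2_integrable_norm_sq)
  show "(\<lambda>x. u x \<bullet> w x) \<in> borel_measurable (lebesgue_on \<Omega>)"
    using assms by (intro borel_measurable_inner L2_measurable)
  show "AE x in lebesgue_on \<Omega>. norm (u x \<bullet> w x) \<le> norm ((norm (u x))\<^sup>2 + (norm (w x))\<^sup>2)"
    using abs_inner_le_norm_sq by (auto intro!: AE_I2 order_trans[OF abs_inner_le_norm_sq])
qed

lemma L2_add:
  assumes "u \<in> L2 \<Omega>" "w \<in> L2 \<Omega>"
  shows "(\<lambda>x. u x + w x) \<in> L2 \<Omega>"
proof -
  have "(norm (u x + w x))\<^sup>2 = (norm (u x))\<^sup>2 + 2 * (u x \<bullet> w x) + (norm (w x))\<^sup>2" for x
    by (simp add: power2_norm_eq_inner inner_add_left inner_add_right inner_commute)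
  then show ?thesis
    using assms L2_integrable_inner[OF assms] by (auto simp: L2_def intro!: borel_measurable_add)
qed

lemma L2_scaleR: "u \<in> L2 \<Omega> \<Longrightarrow> (\<lambda>x. c *\<^sub>R u x) \<in> L2 \<Omega>"
  by (auto simp: L2_def power_mult_distrib intro!: borel_measurable_scaleR)

lemma L2_inner_commute: "L2_inner \<Omega> u w = L2_inner \<Omega> w u"
  by (simp add: L2_inner_def inner_commute)

lemma L2_inner_nonneg: "0 \<le> L2_inner \<Omega> u u"
  by (simp add: L2_inner_def)

lemma L2_norm_sq: "(L2_norm \<Omega> u)\<^sup>2 = L2_inner \<Omega> u u"
  by (simp add: L2_norm_def L2_inner_nonneg)

lemma L2_norm_nonneg: "0 \<le> L2_norm \<Omega> u"
  by (simp add: L2_norm_def L2_inner_nonneg)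

lemma L2_inner_add_left:
  assumes "u \<in> L2 \<Omega>" "v \<in> L2 \<Omega>" "w \<in> L2 \<Omega>"
  shows "L2_inner \<Omega> (\<lambda>x. u x + v x) w = L2_inner \<Omega> u w + L2_inner \<Omega> v w"
  using assms by (simp add: L2_inner_def inner_add_left L2_integrable_inner)

lemma L2_inner_scaleR_left: "L2_inner \<Omega> (\<lambda>x. c *\<^sub>R u x) w = c * L2_inner \<Omega> u w"
  by (simp add: L2_inner_def)

lemma L2_inner_cong_AE:
  assumes "u \<in> L2 \<Omega>" "u' \<in> L2 \<Omega>" "w \<in> L2 \<Omega>" and "AE x in lebesgue_on \<Omega>. u x = u' x"
  shows "L2_inner \<Omega> u w = L2_inner \<Omega> u' w"
  unfolding L2_inner_def using assms(4)
  by (intro integral_cong_AE borel_measurable_inner L2_measurable assms(1-3)) (auto elim: eventually_mono)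

lemma L2_imp_integrable:
  assumes "u \<in> L2 \<Omega>" "\<Omega> \<in> lmeasurable"
  shows "integrable (lebesgue_on \<Omega>) u"
proof (rule Bochner_Integration.integrable_bound)
  interpret finite_measure "lebesgue_on \<Omega>"
    using assms(2) by (rule finite_measure_lebesgue_on)
  show "integrable (lebesgue_on \<Omega>) (\<lambda>x. 1 + (norm (u x))\<^sup>2)"
    using assms by (intro Bochner_Integration.integrable_add L2_integrable_norm_sq integrable_const)
  show "u \<in> borel_measurable (lebesgue_on \<Omega>)"
    using assms by (intro L2_measurable)
  have "t \<le> 1 + t\<^sup>2" for t :: real
  proof -
    have "2 * t \<le> t\<^sup>2 + 1" "0 \<le> t\<^sup>2" using sum_squares_bound[of t 1] by simp_all
    then show ?thesis by linarith
  qed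
  then show "AE x in lebesgue_on \<Omega>. norm (u x) \<le> norm (1 + (norm (u x))\<^sup>2)"
    by (auto simp: intro!: AE_I2)
qed

section \<open>Support and bounds of test functions\<close>

lemma test_function_derivative:
  assumes "\<phi> \<in> test_functions \<Omega>"
  shows "(\<phi> has_derivative frechet_derivative \<phi> (at x)) (at x)"
  using assms frechet_derivative_works by (force simp: test_functions_def dest: spec[of _ 1])

lemma test_function_continuous:
  assumes "\<phi> \<in> test_functions \<Omega>"
  shows "continuous_on UNIV \<phi>" "continuous_on UNIV (partial j \<phi>)"
proof -
  have "Ck 0 \<phi>" "Ck 1 \<phi>" using assms by (auto simp: test_functions_def)
  then show "continuous_on UNIV \<phi>" "continuous_on UNIV (partial j \<phi>)" by auto
qed

lemma test_function_support:
  assumes "\<phi> \<in> test_functions \<Omega>"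
  obtains S where "compact S" "S \<subseteq> \<Omega>"
    "\<And>x. x \<notin> S \<Longrightarrow> \<phi> x = 0" "\<And>x j. x \<notin> S \<Longrightarrow> partial j \<phi> x = 0"
proof -
  obtain S where S: "compact S" "S \<subseteq> \<Omega>" "\<And>x. x \<notin> S \<Longrightarrow> \<phi> x = 0"
    using assms by (auto simp: test_functions_def)
  have "partial j \<phi> x = 0" if "x \<notin> S" for x j
  proof (rule partial_eqI)
    show "(\<phi> has_derivative (\<lambda>h. 0)) (at x)"
      by (rule has_derivative_transform_within_open[where s="- S" and f="\<lambda>x. 0"])
        (use S that in \<open>auto simp: compact_imp_closed open_Compl\<close>)
  qed
  with S that show thesis by blast
qed

lemma test_function_bounded:
  assumes "\<phi> \<in> test_functions \<Omega>"
  obtains B where "\<And>x. \<bar>\<phi> x\<bar> \<le> B" "\<And>x j. \<bar>partial j \<phi> x\<bar> \<le> B"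
proof -
  obtain S where S: "compact S"
    "\<And>x. x \<notin> S \<Longrightarrow> \<phi> x = 0" "\<And>x j. x \<notin> S \<Longrightarrow> partial j \<phi> x = 0"
    using test_function_support[OF assms] by metis
  have bd: "\<exists>B. \<forall>x. \<bar>f x\<bar> \<le> B"
    if "continuous_on UNIV f" "\<And>x. x \<notin> S \<Longrightarrow> f x = 0" for f :: "real^3 \<Rightarrow> real"
  proof -
    have "bounded (f ` S)"
      using S(1) that(1) by (intro compact_imp_bounded compact_continuous_image) (auto intro: continuous_on_subset)
    then obtain B where "\<forall>x\<in>S. \<bar>f x\<bar> \<le> B" by (auto simp: bounded_iff)
    then show ?thesis using that(2) by (metis abs_ge_zero abs_zero max.cobounded1 max.cobounded2 order_trans)
  qed
  obtain B0 where B0: "\<forall>x. \<bar>\<phi> x\<bar> \<le> B0"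
    using bd test_function_continuous[OF assms] S by metis
  have "\<forall>j. \<exists>B. \<forall>x. \<bar>partial j \<phi> x\<bar> \<le> B"
    using bd test_function_continuous[OF assms] S by metis
  then obtain B1 where B1: "\<And>j x. \<bar>partial j \<phi> x\<bar> \<le> B1 j" by metis
  have "\<bar>partial j \<phi> x\<bar> \<le> Max (insert B0 (range B1))" for j x
    by (rule order_trans[OF B1[of j x] Max_ge]) auto
  moreover have "\<bar>\<phi> x\<bar> \<le> Max (insert B0 (range B1))" for x
    using B0 by (meson Max_ge finite_insert finite_imageI finite insertI1 order_trans)
  ultimately show thesis using that by blast
qed

lemma integrable_mult_bounded_continuous:
  fixes f \<phi> :: "real^3 \<Rightarrow> real"
  assumes "integrable (lebesgue_on \<Omega>) f" "continuous_on UNIV \<phi>" "\<And>x. \<bar>\<phi> x\<bar> \<le> B"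
  shows "integrable (lebesgue_on \<Omega>) (\<lambda>x. f x * \<phi> x)"
proof (rule Bochner_Integration.integrable_bound)
  show "integrable (lebesgue_on \<Omega>) (\<lambda>x. B * f x)" using assms by simp
  have "\<phi> \<in> borel_measurable (lebesgue_on \<Omega>)"
    using assms by (auto intro!: measurable_restrict_space1 borel_measurable_continuous_onI measurable_completion)
  then show "(\<lambda>x. f x * \<phi> x) \<in> borel_measurable (lebesgue_on \<Omega>)"
    using assms by auto
  have "\<bar>f x * \<phi> x\<bar> \<le> \<bar>B * f x\<bar>" for x
  proof -
    have "\<bar>\<phi> x\<bar> \<le> \<bar>B\<bar>" using assms(3)[of x] by linarith
    then show ?thesis using mult_left_mono[of "\<bar>\<phi> x\<bar>" "\<bar>B\<bar>" "\<bar>f x\<bar>"] by (simp add: abs_mult mult.commute)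
  qed
  then show "AE x in lebesgue_on \<Omega>. norm (f x * \<phi> x) \<le> norm (B * f x)"
    by auto
qed

lemma integrable_vec_nth:
  fixes f :: "'a \<Rightarrow> ('b::euclidean_space)^'n"
  assumes "integrable M f" shows "integrable M (\<lambda>x. f x $ i)"
  by (rule integrable_bounded_linear[OF bounded_linear_vec_nth assms])

lemma has_weak_gradient_integrable:
  assumes "\<Omega> \<in> lmeasurable" "has_weak_gradient \<Omega> u G" "\<phi> \<in> test_functions \<Omega>"
  shows "integrable (lebesgue_on \<Omega>) (\<lambda>x. u x $ i * partial j \<phi> x)"
    "integrable (lebesgue_on \<Omega>) (\<lambda>x. G x $ i $ j * \<phi> x)"
proof -
  obtain B where "\<And>x. \<bar>\<phi> x\<bar> \<le> B" "\<And>x j. \<bar>partial j \<phi> x\<bar> \<le> B"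
    using test_function_bounded[OF assms(3)] by blast
  moreover have "u \<in> L2 \<Omega>" "G \<in> L2 \<Omega>" using assms(2) by (auto simp: has_weak_gradient_def)
  ultimately show "integrable (lebesgue_on \<Omega>) (\<lambda>x. u x $ i * partial j \<phi> x)"
    and "integrable (lebesgue_on \<Omega>) (\<lambda>x. G x $ i $ j * \<phi> x)"
    by - (intro integrable_mult_bounded_continuous[where B=B] integrable_vec_nth L2_imp_integrable
        test_function_continuous[OF assms(3)] assms(1); assumption)+
qed

lemma has_weak_gradient_add:
  assumes "\<Omega> \<in> lmeasurable" "has_weak_gradient \<Omega> u G" "has_weak_gradient \<Omega> w H"
  shows "has_weak_gradient \<Omega> (\<lambda>x. u x + w x) (\<lambda>x. G x + H x)"
  unfolding has_weak_gradient_def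
proof (intro conjI ballI allI)
  fix \<phi> and i j :: 3 assume \<phi>: "\<phi> \<in> test_functions \<Omega>"
  show "(\<integral>x. (u x + w x) $ i * partial j \<phi> x \<partial>lebesgue_on \<Omega>) =
       - (\<integral>x. (G x + H x) $ i $ j * \<phi> x \<partial>lebesgue_on \<Omega>)"
    using assms(2,3) \<phi> has_weak_gradient_integrable[OF assms(1,2) \<phi>]
      has_weak_gradient_integrable[OF assms(1,3) \<phi>]
    by (simp add: distrib_right has_weak_gradient_def)
qed (use assms in \<open>auto simp: has_weak_gradient_def intro: L2_add\<close>)

lemma has_weak_gradient_scaleR:
  assumes "has_weak_gradient \<Omega> u G"
  shows "has_weak_gradient \<Omega> (\<lambda>x. c *\<^sub>R u x) (\<lambda>x. c *\<^sub>R G x)"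
  using assms by (auto simp: has_weak_gradient_def L2_scaleR mult.assoc)

text \<open>Two weak gradients define the same functional on test functions, so the differences of
  their entries are orthogonal to all of these. This makes the choice in \<open>grad\<close>
  harmless: it is linear up to null sets, which integrals do not see.\<close>

lemma has_weak_gradient_unique:
  assumes "open \<Omega>" "\<Omega> \<in> lmeasurable" "has_weak_gradient \<Omega> u G" "has_weak_gradient \<Omega> u H"
  shows "AE x in lebesgue_on \<Omega>. G x = H x"
proof -
  have "AE x in lebesgue_on \<Omega>. G x $ i $ j - H x $ i $ j = 0" for i j
  proof (rule AE_zero_if_orthogonal_to_test_functions[OF assms(1)])
    show "integrable (lebesgue_on \<Omega>) (\<lambda>x. G x $ i $ j - H x $ i $ j)"
      using assms by (intro Bochner_Integration.integrable_diff integrable_vec_nth L2_imp_integrable)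
        (auto simp: has_weak_gradient_def)
    fix \<phi> assume \<phi>: "\<phi> \<in> test_functions \<Omega>"
    have "(\<integral>x. G x $ i $ j * \<phi> x \<partial>lebesgue_on \<Omega>) = (\<integral>x. H x $ i $ j * \<phi> x \<partial>lebesgue_on \<Omega>)"
      using assms(3,4) \<phi> by (fastforce simp: has_weak_gradient_def)
    then show "(\<integral>x. (G x $ i $ j - H x $ i $ j) * \<phi> x \<partial>lebesgue_on \<Omega>) = 0"
      using has_weak_gradient_integrable[OF assms(2,3) \<phi>] has_weak_gradient_integrable[OF assms(2,4) \<phi>]
      by (simp add: left_diff_distrib)
  qed
  then have "AE x in lebesgue_on \<Omega>. \<forall>i j. G x $ i $ j - H x $ i $ j = 0"
    by (auto simp: AE_all_countable)
  then show ?thesis by eventually_elim (simp add: vec_eq_iff)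
qed

lemma grad_works: "u \<in> H1 \<Omega> \<Longrightarrow> has_weak_gradient \<Omega> u (grad \<Omega> u)"
  unfolding grad_def H1_def by (auto intro: someI[where P="has_weak_gradient \<Omega> u"])

lemma grad_L2: "u \<in> H1 \<Omega> \<Longrightarrow> grad \<Omega> u \<in> L2 \<Omega>"
  using grad_works by (auto simp: has_weak_gradient_def)

lemma H1_add: "\<Omega> \<in> lmeasurable \<Longrightarrow> u \<in> H1 \<Omega> \<Longrightarrow> w \<in> H1 \<Omega> \<Longrightarrow> (\<lambda>x. u x + w x) \<in> H1 \<Omega>"
  using has_weak_gradient_add unfolding H1_def by blast

lemma H1_scaleR: "u \<in> H1 \<Omega> \<Longrightarrow> (\<lambda>x. c *\<^sub>R u x) \<in> H1 \<Omega>"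
  using has_weak_gradient_scaleR unfolding H1_def by blast

text \<open>The Dirichlet form. Since \<open>grad\<close> itself is linear only almost everywhere,
  bilinearity is recorded for this integral, where it holds exactly.\<close>

definition grad_inner :: "(real^3) set \<Rightarrow> (real^3 \<Rightarrow> real^3) \<Rightarrow> (real^3 \<Rightarrow> real^3) \<Rightarrow> real" where
  "grad_inner \<Omega> u w = L2_inner \<Omega> (grad \<Omega> u) (grad \<Omega> w)"

lemma grad_inner_add_left:
  assumes "open \<Omega>" "\<Omega> \<in> lmeasurable" and H1: "u \<in> H1 \<Omega>" "v \<in> H1 \<Omega>" "w \<in> H1 \<Omega>"
  shows "grad_inner \<Omega> (\<lambda>x. u x + v x) w = grad_inner \<Omega> u w + grad_inner \<Omega> v w"
proof -
  have "AE x in lebesgue_on \<Omega>. grad \<Omega> (\<lambda>x. u x + v x) x = grad \<Omega> u x + grad \<Omega> v x"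
    using assms by (intro has_weak_gradient_unique[OF _ _ grad_works] has_weak_gradient_add grad_works H1_add)
  then have "grad_inner \<Omega> (\<lambda>x. u x + v x) w = L2_inner \<Omega> (\<lambda>x. grad \<Omega> u x + grad \<Omega> v x) (grad \<Omega> w)"
    unfolding grad_inner_def using assms by (intro L2_inner_cong_AE L2_add grad_L2 H1_add)
  also have "\<dots> = grad_inner \<Omega> u w + grad_inner \<Omega> v w"
    unfolding grad_inner_def using H1 by (intro L2_inner_add_left grad_L2)
  finally show ?thesis .
qed

lemma grad_inner_scaleR_left:
  assumes "open \<Omega>" "\<Omega> \<in> lmeasurable" and H1: "u \<in> H1 \<Omega>" "w \<in> H1 \<Omega>"
  shows "grad_inner \<Omega> (\<lambda>x. c *\<^sub>R u x) w = c * grad_inner \<Omega> u w"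
proof -
  have "AE x in lebesgue_on \<Omega>. grad \<Omega> (\<lambda>x. c *\<^sub>R u x) x = c *\<^sub>R grad \<Omega> u x"
    using assms by (intro has_weak_gradient_unique[OF _ _ grad_works] has_weak_gradient_scaleR grad_works H1_scaleR)
  then have "grad_inner \<Omega> (\<lambda>x. c *\<^sub>R u x) w = L2_inner \<Omega> (\<lambda>x. c *\<^sub>R grad \<Omega> u x) (grad \<Omega> w)"
    unfolding grad_inner_def using assms by (intro L2_inner_cong_AE L2_scaleR grad_L2 H1_scaleR)
  then show ?thesis unfolding grad_inner_def by (simp add: L2_inner_scaleR_left)
qed

section \<open>Tetrahedral meshes and nodal interpolation\<close>

text \<open>For general open sets this fails, for instance for a ball with a flat disc removed. A
  Lipschitz graph leaves room for a full cone outside \<open>\<Omega>\<close> at each boundary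
  point, so such a point is not interior to the closure. Meshes cover only the closure, and this is
  the link from elements back to \<open>\<Omega>\<close>.\<close>

lemma interior_closure_subset_if_lipschitz_boundary:
  assumes "open \<Omega>" "lipschitz_boundary \<Omega>"
  shows "interior (closure \<Omega>) \<subseteq> \<Omega>"
proof
  fix p assume p: "p \<in> interior (closure \<Omega>)"
  show "p \<in> \<Omega>"
  proof (rule ccontr)
    assume "p \<notin> \<Omega>"
    then have "p \<in> frontier \<Omega>"
      using p assms(1) interior_subset by (auto simp: frontier_def interior_open)
    then obtain n and g :: "real^3 \<Rightarrow> real" and L r where n: "norm n = 1" and g: "lipschitz_on L UNIV g" and "r > 0"
      and graph: "\<And>x. x \<in> ball p r \<Longrightarrow> x \<in> \<Omega> \<longleftrightarrow> (x - p) \<bullet> n < g ((x - p) - ((x - p) \<bullet> n) *\<^sub>R n)"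
      using assms(2) unfolding lipschitz_boundary_def by blast
    have g0: "g 0 \<le> 0"
      using graph[of p] \<open>p \<notin> \<Omega>\<close> \<open>r > 0\<close> by simp
    \<comment> \<open>An open cone with apex \<open>p\<close> above the graph of \<open>g\<close>.\<close>
    define V where "V = {y \<in> ball p r. L * norm ((y - p) - ((y - p) \<bullet> n) *\<^sub>R n) < (y - p) \<bullet> n}"
    have "open V"
      unfolding V_def ball_def mem_Collect_eq by (intro open_Collect_conj open_Collect_less continuous_intros)
    have "y \<notin> \<Omega>" if "y \<in> V" for y
    proof -
      let ?o = "(y - p) - ((y - p) \<bullet> n) *\<^sub>R n"
      have "g ?o \<le> g 0 + L * norm ?o"
        using lipschitz_onD[OF g, of ?o 0] by (auto simp: dist_norm abs_le_iff)
      then show ?thesis using that graph[of y] g0 unfolding V_def by auto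
    qed
    then have "V \<inter> closure \<Omega> = {}"
      using \<open>open V\<close> by (subst open_Int_closure_eq_empty) auto
    have "open (ball p r \<inter> interior (closure \<Omega>))" "p \<in> ball p r \<inter> interior (closure \<Omega>)"
      using p \<open>r > 0\<close> by auto
    then obtain e where "e > 0" and e: "cball p e \<subseteq> ball p r \<inter> interior (closure \<Omega>)"
      using open_contains_cball by blast
    have "p + e *\<^sub>R n \<in> cball p e" using n \<open>e > 0\<close> by (simp add: dist_norm)
    with e have "p + e *\<^sub>R n \<in> ball p r" "p + e *\<^sub>R n \<in> closure \<Omega>"
      using interior_subset by blast+
    moreover have "n \<bullet> n = 1" using n by (simp add: dot_square_norm)
    ultimately have "p + e *\<^sub>R n \<in> V \<inter> closure \<Omega>" using \<open>e > 0\<close> by (simp add: V_def)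
    with \<open>V \<inter> closure \<Omega> = {}\<close> show False by blast
  qed
qed

text \<open>Moving one of the points to the origin turns affine into linear independence, and any
  values on an independent set extend to a linear map.\<close>

lemma affine_interpolation:
  fixes f :: "'a::euclidean_space \<Rightarrow> 'b::real_vector"
  assumes "\<not> affine_dependent C"
  shows "\<exists>A b. linear A \<and> (\<forall>z\<in>C. A z + b = f z)"
proof (cases "C = {}")
  case True
  then show ?thesis using linear_zero by blast
next
  case False
  then obtain z0 where z0: "z0 \<in> C" by blast
  then have "independent ((\<lambda>x. - z0 + x) ` (C - {z0}))"
    using assms affine_dependent_iff_dependent2 by blast
  from linear_independent_extend[OF this, of "\<lambda>y. f (y + z0) - f z0"]
  obtain A :: "'a \<Rightarrow> 'b" where A: "linear A" "\<forall>y\<in>(\<lambda>x. - z0 + x) ` (C - {z0}). A y = f (y + z0) - f z0"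
    by (elim exE conjE)
  have "A z + (f z0 - A z0) = f z" if "z \<in> C" for z
  proof (cases "z = z0")
    case False
    then have "A (- z0 + z) = f z - f z0" using A(2) that by auto
    then show ?thesis using A(1) by (simp add: linear_diff algebra_simps)
  qed simp
  with A(1) show ?thesis by blast
qed

section \<open>Barycentric coordinates and the vertices of elements\<close>

definition corners :: "(real^3) set \<Rightarrow> (real^3) set" where
  "corners K = {z. z extreme_point_of K}"

lemma simplex_corners:
  assumes "3 simplex K"
  shows "finite (corners K)" "\<not> affine_dependent (corners K)" "K = convex hull corners K"
    "corners K \<noteq> {}" "compact K" "convex K"
proof -
  obtain C where C: "\<not> affine_dependent C" "int (card C) = 3 + 1" "K = convex hull C"
    using assms unfolding simplex_def by blast
  moreover from C have "corners K = C"
    unfolding corners_def using extreme_point_of_convex_hull_affine_independent by blast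
  moreover have "finite C" using C(1) aff_independent_finite by blast
  ultimately show "finite (corners K)" "\<not> affine_dependent (corners K)" "K = convex hull corners K"
    "corners K \<noteq> {}" "compact K" "convex K"
    by (auto simp: finite_imp_compact_convex_hull)
qed

lemma corners_subset: "corners K \<subseteq> K"
  by (auto simp: corners_def extreme_point_of_def)

lemma S1_affineE:
  assumes "u \<in> S1 \<T>" "K \<in> \<T>"
  obtains A b where "linear A" "\<And>x. x \<in> K \<Longrightarrow> u x = A x + b"
proof -
  have "\<exists>A b. linear A \<and> (\<forall>x\<in>K. u x = A x + b)" using assms by (simp add: S1_def)
  then show thesis using that by blast
qed

lemma affine_eq_barycentric:
  assumes "linear A" "sum l V = 1"
  shows "A (\<Sum>z\<in>V. l z *\<^sub>R z) + b = (\<Sum>z\<in>V. l z *\<^sub>R (A z + b))"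
  using assms by (simp add: linear_sum linear_cmul scaleR_add_right sum.distrib flip: scaleR_left.sum)

locale mesh =
  fixes \<Omega> :: "(real^3) set" and \<T> :: "(real^3) set set"
  assumes dom: "lipschitz_polyhedral_domain \<Omega>" and mesh: "tetrahedral_mesh \<Omega> \<T>"
begin

lemma open_\<Omega>: "open \<Omega>" and bounded_\<Omega>: "bounded \<Omega>" and \<Omega>_nonempty: "\<Omega> \<noteq> {}"
  using dom by (auto simp: lipschitz_polyhedral_domain_def)

lemma lmeasurable_\<Omega>: "\<Omega> \<in> lmeasurable"
  using open_\<Omega> bounded_\<Omega> by (rule lmeasurable_open[rotated])

lemma sets_\<Omega>[simp]: "\<Omega> \<in> sets lebesgue"
  using lmeasurable_\<Omega> by auto

lemma measure_\<Omega>_pos: "measure lebesgue \<Omega> > 0"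
proof -
  have "\<not> negligible \<Omega>" using open_not_negligible open_\<Omega> \<Omega>_nonempty by blast
  then show ?thesis using lmeasurable_\<Omega>
    by (simp add: negligible_iff_measure zero_less_measure_iff)
qed

lemma finite_\<T>: "finite \<T>" and simplex_\<T>: "K \<in> \<T> \<Longrightarrow> 3 simplex K"
  and face_\<T>: "K \<in> \<T> \<Longrightarrow> K' \<in> \<T> \<Longrightarrow> (K \<inter> K') face_of K"
  and Union_\<T>: "\<Union>\<T> = closure \<Omega>"
  using mesh by (auto simp: tetrahedral_mesh_def triangulation_def)

lemmas corners = simplex_corners[OF simplex_\<T>]

lemma vertices_eq: "vertices \<T> = (\<Union>K\<in>\<T>. corners K)"
  by (auto simp: vertices_def corners_def)

lemma finite_vertices: "finite (vertices \<T>)"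
  using finite_\<T> corners(1) by (simp add: vertices_eq)

lemma interior_subset_\<Omega>: "K \<in> \<T> \<Longrightarrow> interior K \<subseteq> \<Omega>"
proof -
  assume "K \<in> \<T>"
  then have "K \<subseteq> closure \<Omega>" using Union_\<T> by blast
  then show "interior K \<subseteq> \<Omega>"
    using interior_closure_subset_if_lipschitz_boundary[OF open_\<Omega>] dom interior_mono
    unfolding lipschitz_polyhedral_domain_def by blast
qed

text \<open>Conformity makes the intersection a face of each element, and a face that meets the
  relative interior of a convex set is the whole set.\<close>

lemma interiors_disjoint:
  assumes "K \<in> \<T>" "K' \<in> \<T>" "x \<in> interior K" "x \<in> interior K'"
  shows "K = K'"
proof -
  have "K1 \<subseteq> K2" if "K1 \<in> \<T>" "K2 \<in> \<T>" "x \<in> interior K1" "x \<in> interior K2" for K1 K2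
  proof -
    have "K1 \<subseteq> K1 \<inter> K2"
    proof (rule subset_of_face_of[OF face_\<T>[OF that(1,2)]])
      show "K1 \<inter> K2 \<inter> rel_interior K1 \<noteq> {}"
        using that subsetD[OF interior_subset that(3)] subsetD[OF interior_subset that(4)]
          subsetD[OF interior_subset_rel_interior that(3)] by blast
    qed simp
    then show ?thesis by blast
  qed
  with assms show ?thesis by blast
qed

text \<open>Frontiers of convex sets are null, so that statements on the open elements suffice under
  an integral.\<close>

lemma AE_in_interiors: "AE x in lebesgue_on \<Omega>. \<exists>K\<in>\<T>. x \<in> interior K"
proof -
  have "negligible (\<Union>K\<in>\<T>. frontier K)"
    using finite_\<T> corners(6) negligible_convex_frontier by (intro negligible_Union) auto
  then have "AE x in lebesgue. x \<notin> (\<Union>K\<in>\<T>. frontier K)"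
    by (simp only: negligible_iff_null_sets AE_not_in)
  then have "AE x in lebesgue. x \<in> \<Omega> \<longrightarrow> (\<exists>K\<in>\<T>. x \<in> interior K)"
  proof eventually_elim
    case (elim x)
    show ?case
    proof
      assume "x \<in> \<Omega>"
      then obtain K where K: "K \<in> \<T>" "x \<in> K" using Union_\<T> closure_subset by blast
      then show "\<exists>K\<in>\<T>. x \<in> interior K"
        using elim closure_subset[of K] unfolding frontier_def by blast
    qed
  qed
  then show ?thesis by (subst AE_restrict_space_iff) auto
qed

lemma barycentric:
  assumes "K \<in> \<T>" "x \<in> K"
  obtains l where "\<And>z. z \<in> corners K \<Longrightarrow> 0 \<le> l z" "sum l (corners K) = 1"
    "x = (\<Sum>z\<in>corners K. l z *\<^sub>R z)"
proof -
  have "x \<in> convex hull corners K" using assms corners(3) by blast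
  then show thesis
    using that unfolding convex_hull_finite[OF corners(1)[OF assms(1)]] by blast
qed

lemma S1_barycentric:
  assumes "u \<in> S1 \<T>" "K \<in> \<T>" "x \<in> K" "sum l (corners K) = 1" "x = (\<Sum>z\<in>corners K. l z *\<^sub>R z)"
  shows "u x = (\<Sum>z\<in>corners K. l z *\<^sub>R u z)"
proof -
  obtain A b where A: "linear A" "\<And>x. x \<in> K \<Longrightarrow> u x = A x + b"
    using S1_affineE[OF assms(1,2)] by metis
  have "(\<Sum>z\<in>corners K. l z *\<^sub>R u z) = (\<Sum>z\<in>corners K. l z *\<^sub>R (A z + b))"
    using A(2) corners_subset by (intro sum.cong) auto
  also have "\<dots> = A (\<Sum>z\<in>corners K. l z *\<^sub>R z) + b"
    using affine_eq_barycentric[OF A(1) assms(4)] by simp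
  also have "\<dots> = u x" using A(2)[OF assms(3)] assms(5) by simp
  finally show ?thesis by simp
qed

lemma S1_eqI:
  assumes "u \<in> S1 \<T>" "w \<in> S1 \<T>" "\<And>z. z \<in> vertices \<T> \<Longrightarrow> u z = w z"
  shows "u = w"
proof
  fix x show "u x = w x"
  proof (cases "x \<in> \<Union>\<T>")
    case True
    then obtain K where K: "K \<in> \<T>" "x \<in> K" by blast
    obtain l where l: "sum l (corners K) = 1" "x = (\<Sum>z\<in>corners K. l z *\<^sub>R z)"
      using barycentric[OF K] by blast
    have "(\<Sum>z\<in>corners K. l z *\<^sub>R u z) = (\<Sum>z\<in>corners K. l z *\<^sub>R w z)"
      using assms(3) K(1) by (intro sum.cong) (auto simp: vertices_eq)
    then show ?thesis
      using S1_barycentric[OF assms(1) K l] S1_barycentric[OF assms(2) K l] by simp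
  next
    case False
    then show ?thesis using assms by (simp add: S1_def)
  qed
qed

text \<open>Affine interpolants chosen separately on each element agree where elements meet, so they
  glue to one function; continuity follows because the elements form a finite closed cover.\<close>

lemma S1_interpolation:
  fixes f :: "real^3 \<Rightarrow> 'b::euclidean_space"
  shows "\<exists>u\<in>S1 \<T>. \<forall>z\<in>vertices \<T>. u z = f z"
proof -
  have "\<forall>K\<in>\<T>. \<exists>A b. linear A \<and> (\<forall>z\<in>corners K. A z + b = f z)"
    using affine_interpolation corners(2) by blast
  then obtain A b where A: "\<And>K. K \<in> \<T> \<Longrightarrow> linear (A K)"
    "\<And>K z. K \<in> \<T> \<Longrightarrow> z \<in> corners K \<Longrightarrow> A K z + b K = f z" by metis
  \<comment> \<open>Two elements meet in a common face, which is spanned by common vertices.\<close>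
  have agree: "A K x + b K = A K' x + b K'" if K: "K \<in> \<T>" "K' \<in> \<T>" "x \<in> K" "x \<in> K'" for K K' x
  proof -
    define F where "F = K \<inter> K'"
    have F: "F face_of K" "F face_of K'"
      using face_\<T>[OF K(1,2)] face_\<T>[OF K(2,1)] by (simp_all add: F_def Int_commute)
    have "compact F" "convex F" using corners(5,6) K by (auto simp: F_def compact_Int convex_Int)
    then have hull: "F = convex hull corners F"
      unfolding corners_def by (rule Krein_Milman_Minkowski)
    have sub: "corners F \<subseteq> corners K" "corners F \<subseteq> corners K'"
      using F extreme_point_of_face by (auto simp: corners_def)
    then have "finite (corners F)" using corners(1) K finite_subset by blast
    moreover have "x \<in> convex hull corners F" using hull K by (auto simp: F_def)
    ultimately obtain l where l: "sum l (corners F) = 1" "x = (\<Sum>z\<in>corners F. l z *\<^sub>R z)"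
      by (auto simp: convex_hull_finite)
    have "A K z + b K = A K' z + b K'" if "z \<in> corners F" for z
      using A(2) K sub that by (metis subsetD)
    then have "(\<Sum>z\<in>corners F. l z *\<^sub>R (A K z + b K)) = (\<Sum>z\<in>corners F. l z *\<^sub>R (A K' z + b K'))"
      by simp
    then show ?thesis
      using affine_eq_barycentric[OF A(1)[OF K(1)] l(1), of "b K"]
        affine_eq_barycentric[OF A(1)[OF K(2)] l(1), of "b K'"] by (simp flip: l(2))
  qed
  \<comment> \<open>An arbitrary element containing \<open>x\<close>; by \<open>agree\<close> the
    value does not depend on the choice.\<close>
  define E where "E x = (SOME K. K \<in> \<T> \<and> x \<in> K)" for x
  define u where "u x = (if x \<in> \<Union>\<T> then A (E x) x + b (E x) else 0)" for x
  have u: "u x = A K x + b K" if "K \<in> \<T>" "x \<in> K" for K x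
  proof -
    have "E x \<in> \<T> \<and> x \<in> E x" unfolding E_def by (rule someI[where x=K]) (simp add: that)
    then have "A (E x) x + b (E x) = A K x + b K" using that by (elim conjE) (rule agree)
    moreover have "x \<in> \<Union>\<T>" using that by blast
    ultimately show ?thesis by (simp only: u_def if_True)
  qed
  have "continuous_on (\<Union>K\<in>\<T>. K) u"
  proof (rule continuous_on_closed_Union[OF finite_\<T>])
    fix K assume K: "K \<in> \<T>"
    then show "closed K" using corners(5) compact_imp_closed by blast
    have "continuous_on K (\<lambda>x. A K x + b K)"
      using A(1)[OF K] by (intro continuous_intros linear_continuous_on) (simp add: linear_conv_bounded_linear)
    then show "continuous_on K u" using u[OF K] by (simp cong: continuous_on_cong)
  qed
  moreover have "\<exists>A b. linear A \<and> (\<forall>x\<in>K. u x = A x + b)" if "K \<in> \<T>" for K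
    using u[OF that] A(1)[OF that] by blast
  moreover have "u x = 0" if "x \<notin> \<Union>\<T>" for x
    using that by (simp only: u_def if_False)
  ultimately have "u \<in> S1 \<T>" by (simp add: S1_def)
  moreover have "u z = f z" if "z \<in> vertices \<T>" for z
    using that u A(2) corners_subset unfolding vertices_eq by fastforce
  ultimately show ?thesis by blast
qed

lemma nodal_interp_works:
  "nodal_interp \<T> f \<in> S1 \<T>" "z \<in> vertices \<T> \<Longrightarrow> nodal_interp \<T> f z = f z"
proof -
  have "\<exists>!u. u \<in> S1 \<T> \<and> (\<forall>z\<in>vertices \<T>. u z = f z)"
    using S1_interpolation[of f] by (auto intro: S1_eqI)
  from theI'[OF this] show "nodal_interp \<T> f \<in> S1 \<T>" "z \<in> vertices \<T> \<Longrightarrow> nodal_interp \<T> f z = f z"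
    unfolding nodal_interp_def by auto
qed

section \<open>Closure and measurability properties of finite element functions\<close>

lemma S1_add: "u \<in> S1 \<T> \<Longrightarrow> w \<in> S1 \<T> \<Longrightarrow> (\<lambda>x. u x + w x) \<in> S1 \<T>"
proof -
  assume u: "u \<in> S1 \<T>" and w: "w \<in> S1 \<T>"
  have "\<exists>A b. linear A \<and> (\<forall>x\<in>K. u x + w x = A x + b)" if K: "K \<in> \<T>" for K
  proof -
    obtain A b where A: "linear A" "\<And>x. x \<in> K \<Longrightarrow> u x = A x + b"
      using S1_affineE[OF u K] by metis
    obtain A' b' where A': "linear A'" "\<And>x. x \<in> K \<Longrightarrow> w x = A' x + b'"
      using S1_affineE[OF w K] by metis
    show ?thesis
      by (rule exI[of _ "\<lambda>x. A x + A' x"], rule exI[of _ "b + b'"])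
        (simp add: A A' linear_compose_add)
  qed
  with u w show ?thesis by (auto simp: S1_def intro: continuous_on_add)
qed

lemma S1_linear_image:
  assumes u: "u \<in> S1 \<T>" and f: "linear (f :: 'b::euclidean_space \<Rightarrow> 'c::euclidean_space)"
  shows "(\<lambda>x. f (u x)) \<in> S1 \<T>"
proof -
  have "\<exists>A b. linear A \<and> (\<forall>x\<in>K. f (u x) = A x + b)" if K: "K \<in> \<T>" for K
  proof -
    obtain A b where A: "linear A" "\<And>x. x \<in> K \<Longrightarrow> u x = A x + b"
      using S1_affineE[OF u K] by metis
    show ?thesis
      by (rule exI[of _ "f \<circ> A"], rule exI[of _ "f b"]) (simp add: A f linear_compose linear_add)
  qed
  moreover have "continuous_on (\<Union>\<T>) (\<lambda>x. f (u x))"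
    using u linear_continuous_on_compose[OF _ f] by (auto simp: S1_def)
  ultimately show ?thesis using u f by (simp add: S1_def linear_0)
qed

lemma S1_scaleR: "u \<in> S1 \<T> \<Longrightarrow> (\<lambda>x. c *\<^sub>R u x) \<in> S1 \<T>"
  by (rule S1_linear_image[where f="\<lambda>y. c *\<^sub>R y"]) simp_all

lemma S1_zero: "(\<lambda>x. 0 :: 'b::euclidean_space) \<in> S1 \<T>"
proof -
  have "\<exists>(A :: real^3 \<Rightarrow> 'b) b. linear A \<and> (\<forall>x\<in>K. 0 = A x + b)" for K
    by (rule exI[of _ "\<lambda>x. 0"], rule exI[of _ 0], rule conjI[OF linear_zero]) simp
  then show ?thesis by (simp add: S1_def)
qed

lemma S1_sum: "(\<And>i. i \<in> I \<Longrightarrow> f i \<in> S1 \<T>) \<Longrightarrow> (\<lambda>x. \<Sum>i\<in>I. f i x) \<in> S1 \<T>"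
  by (induction I rule: infinite_finite_induct) (auto intro: S1_zero S1_add)

lemma S1_borel_measurable:
  assumes "u \<in> S1 \<T>" shows "u \<in> borel_measurable borel"
proof -
  have "(\<lambda>x. if x \<in> \<Union>\<T> then u x else 0) \<in> borel_measurable borel"
    using assms by (intro borel_measurable_continuous_on_if) (auto simp: S1_def Union_\<T>)
  moreover have "(\<lambda>x. if x \<in> \<Union>\<T> then u x else 0) = u"
    using assms by (auto simp: S1_def)
  ultimately show ?thesis by simp
qed

lemma S1_measurable:
  assumes "u \<in> S1 \<T>" shows "u \<in> borel_measurable (lebesgue_on \<Omega>)"
  using S1_borel_measurable[OF assms] by (intro measurable_restrict_space1 measurable_completion) simp

lemma S1_bounded:
  assumes "u \<in> S1 \<T>" obtains B where "B > 0" "\<And>x. norm (u x) \<le> B"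
proof -
  have "compact (\<Union>\<T>)" using finite_\<T> corners(5) by (intro compact_Union) auto
  then have "bounded (u ` \<Union>\<T>)"
    using assms by (intro compact_imp_bounded compact_continuous_image) (auto simp: S1_def)
  then obtain B where "B > 0" "\<forall>x\<in>\<Union>\<T>. norm (u x) \<le> B" by (auto simp: bounded_pos)
  moreover have "norm (u x) \<le> B" if "x \<notin> \<Union>\<T>" for x
    using assms that \<open>B > 0\<close> by (simp add: S1_def)
  ultimately show thesis using that by blast
qed

lemma bounded_measurable_integrable:
  fixes f :: "real^3 \<Rightarrow> 'b::euclidean_space"
  assumes "f \<in> borel_measurable (lebesgue_on \<Omega>)" "\<And>x. norm (f x) \<le> B"
  shows "integrable (lebesgue_on \<Omega>) f"
proof -
  interpret finite_measure "lebesgue_on \<Omega>"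
    using lmeasurable_\<Omega> by (rule finite_measure_lebesgue_on)
  show ?thesis using assms by (intro integrable_const_bound[where B=B]) auto
qed

lemma bounded_measurable_L2:
  fixes f :: "real^3 \<Rightarrow> 'b::euclidean_space"
  assumes "f \<in> borel_measurable (lebesgue_on \<Omega>)" "\<And>x. norm (f x) \<le> B"
  shows "f \<in> L2 \<Omega>"
  unfolding L2_def
  using assms by (auto intro!: bounded_measurable_integrable[where B="B\<^sup>2"] power_mono borel_measurable_power)

lemma S1_L2: "u \<in> S1 \<T> \<Longrightarrow> u \<in> L2 \<Omega>"
  by (metis S1_bounded S1_measurable bounded_measurable_L2)

section \<open>Elementwise integration and the nodal maximum\<close>

lemma integral_indicator_subset_\<Omega>:
  assumes "S \<subseteq> \<Omega>" "S \<in> sets lebesgue"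
  shows "(\<integral>x. indicator S x \<partial>lebesgue_on \<Omega>) = measure lebesgue S"
    "integrable (lebesgue_on \<Omega>) (indicator S :: _ \<Rightarrow> real)"
proof -
  have meas: "S \<in> sets (lebesgue_on \<Omega>)" using assms by (auto simp: sets_restrict_space)
  show "(\<integral>x. indicator S x \<partial>lebesgue_on \<Omega>) = measure lebesgue S"
    using meas assms by (simp add: Int_absorb2 measure_restrict_space)
  interpret finite_measure "lebesgue_on \<Omega>"
    using lmeasurable_\<Omega> by (rule finite_measure_lebesgue_on)
  show "integrable (lebesgue_on \<Omega>) (indicator S :: _ \<Rightarrow> real)"
    using meas by (intro integrable_real_indicator) (auto simp: less_top[symmetric])
qed

text \<open>For \<open>v\<close> in \<open>S1 \<T>\<close> this is the maximum of |v|^2 over the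
  whole element, since values in an element are convex combinations of those at its corners. It
  links bounds at vertices, where the tangency condition acts, to integrals.\<close>

definition nodal_max :: "(real^3 \<Rightarrow> real^3) \<Rightarrow> (real^3) set \<Rightarrow> real" where
  "nodal_max v K = Max ((\<lambda>z. (norm (v z))\<^sup>2) ` corners K)"

lemma nodal_max_ge: "K \<in> \<T> \<Longrightarrow> z \<in> corners K \<Longrightarrow> (norm (v z))\<^sup>2 \<le> nodal_max v K"
  unfolding nodal_max_def using corners(1) by (intro Max_ge) auto

lemma nodal_max_attained:
  assumes "K \<in> \<T>" obtains z where "z \<in> corners K" "nodal_max v K = (norm (v z))\<^sup>2"
proof -
  have "nodal_max v K \<in> (\<lambda>z. (norm (v z))\<^sup>2) ` corners K"
    unfolding nodal_max_def using corners(1,4) assms by (intro Max_in) auto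
  then show thesis using that by blast
qed

lemma nodal_max_nonneg: "K \<in> \<T> \<Longrightarrow> 0 \<le> nodal_max v K"
  by (metis nodal_max_attained zero_le_power2)

lemma S1_norm_le_corners:
  assumes u: "u \<in> S1 \<T>" and K: "K \<in> \<T>" "x \<in> K" and B: "\<And>z. z \<in> corners K \<Longrightarrow> norm (u z) \<le> B"
  shows "norm (u x) \<le> B"
proof -
  obtain l where l: "\<And>z. z \<in> corners K \<Longrightarrow> 0 \<le> l z" "sum l (corners K) = 1"
    "x = (\<Sum>z\<in>corners K. l z *\<^sub>R z)" using barycentric[OF K] by blast
  have "u x = (\<Sum>z\<in>corners K. l z *\<^sub>R u z)" using S1_barycentric[OF u K l(2,3)] .
  also have "norm \<dots> \<le> (\<Sum>z\<in>corners K. l z * B)"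
    using l(1) B by (intro sum_norm_le) (simp add: mult_left_mono)
  also have "\<dots> = B" using l(2) by (simp flip: sum_distrib_right)
  finally show ?thesis .
qed

lemma S1_norm_sq_le_nodal_max:
  assumes "u \<in> S1 \<T>" "K \<in> \<T>" "x \<in> K"
  shows "(norm (u x))\<^sup>2 \<le> nodal_max u K"
proof -
  have "norm (u x) \<le> sqrt (nodal_max u K)"
    by (rule S1_norm_le_corners[OF assms]) (rule real_le_rsqrt[OF nodal_max_ge[OF assms(2)]])
  then show ?thesis
    using power_mono[of "norm (u x)" _ 2] nodal_max_nonneg[OF assms(2), of u] by fastforce
qed

text \<open>The sign of \<open>c\<close> also covers functions \<open>f\<close> that are not
  integrable, whose integral has the default value 0. The comparison function is a sum of indicators
  of open elements, of which almost every point of \<open>\<Omega>\<close> sees exactly one.\<close>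

lemma integral_le_elementwise:
  fixes f :: "real^3 \<Rightarrow> real"
  assumes "\<And>K. K \<in> \<T> \<Longrightarrow> 0 \<le> c K" "\<And>K x. K \<in> \<T> \<Longrightarrow> x \<in> K \<Longrightarrow> f x \<le> c K"
  shows "(\<integral>x. f x \<partial>lebesgue_on \<Omega>) \<le> (\<Sum>K\<in>\<T>. c K * measure lebesgue (interior K))"
proof -
  let ?g = "\<lambda>x. \<Sum>K\<in>\<T>. c K * indicator (interior K) x"
  have int: "integrable (lebesgue_on \<Omega>) ?g"
    using interior_subset_\<Omega> by (intro Bochner_Integration.integrable_sum integrable_mult_right integral_indicator_subset_\<Omega>) auto
  have "(\<integral>x. f x \<partial>lebesgue_on \<Omega>) \<le> (\<integral>x. ?g x \<partial>lebesgue_on \<Omega>)"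
  proof (rule integral_mono_AE'[OF int])
    show "AE x in lebesgue_on \<Omega>. f x \<le> ?g x"
      using AE_in_interiors
    proof eventually_elim
      case (elim x)
      then obtain K where K: "K \<in> \<T>" "x \<in> interior K" by blast
      then have "f x \<le> c K * indicator (interior K) x"
        using assms(2) interior_subset by auto
      also have "\<dots> \<le> ?g x"
        using K assms(1) finite_\<T> by (intro member_le_sum) auto
      finally show ?case .
    qed
    show "AE x in lebesgue_on \<Omega>. 0 \<le> ?g x"
      using assms(1) by (auto intro!: sum_nonneg)
  qed
  also have "\<dots> = (\<Sum>K\<in>\<T>. c K * measure lebesgue (interior K))"
    using interior_subset_\<Omega> integral_indicator_subset_\<Omega> by (subst Bochner_Integration.integral_sum) auto
  finally show ?thesis .
qed

text \<open>On the homothetic copy of an element shrunk by the factor \<open>1/4\<close> towards the vertex where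
  \<open>norm v\<close> is maximal, \<open>v\<close> is at least half as large as at this vertex, and the volume of the copy is
  \<open>1/64\<close> of that of the element.\<close>

lemma nodal_max_sum_le:
  assumes v: "v \<in> S1 \<T>"
  shows "(\<Sum>K\<in>\<T>. nodal_max v K * measure lebesgue (interior K)) \<le> 256 * L2_inner \<Omega> v v"
proof -
  have "\<forall>K\<in>\<T>. \<exists>z. z \<in> corners K \<and> nodal_max v K = (norm (v z))\<^sup>2"
    using nodal_max_attained by metis
  then obtain z where z: "\<And>K. K \<in> \<T> \<Longrightarrow> z K \<in> corners K"
    "\<And>K. K \<in> \<T> \<Longrightarrow> nodal_max v K = (norm (v (z K)))\<^sup>2" by metis
  define P where "P K = (\<lambda>y. (1/4) *\<^sub>R y + (3/4) *\<^sub>R z K) ` interior K" for K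
  have P_sub: "P K \<subseteq> interior K" if "K \<in> \<T>" for K
  proof
    fix x assume "x \<in> P K"
    then obtain y where y: "y \<in> interior K" "x = (1/4) *\<^sub>R y + (3/4) *\<^sub>R z K" by (auto simp: P_def)
    have "z K - (1/4) *\<^sub>R (z K - y) \<in> interior K"
      using y(1) z(1) that corners(6) corners_subset by (intro mem_interior_convex_shrink) auto
    also have "z K - (1/4) *\<^sub>R (z K - y) = (1/4) *\<^sub>R y + (1 - 1/4) *\<^sub>R z K"
      by (simp only: scaleR_diff_right scaleR_diff_left) simp
    finally show "x \<in> interior K" using y(2) by simp
  qed
  have P_meas: "measure lebesgue (P K) = measure lebesgue (interior K) / 64" for K
    unfolding P_def by (subst measure_lebesgue_affine) (simp add: power3_eq_cube)
  have "open (P K)" for K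
    unfolding P_def using open_affinity[of "interior K" "1/4" "(3/4) *\<^sub>R z K"]
    by (simp add: add.commute)
  then have P_sets: "P K \<in> sets lebesgue" for K by (intro sets_completionI_sets) simp
  have P_ge: "nodal_max v K / 4 \<le> (norm (v x))\<^sup>2" if K: "K \<in> \<T>" and x: "x \<in> P K" for K x
  proof -
    obtain y where y: "y \<in> interior K" "x = (1/4) *\<^sub>R y + (3/4) *\<^sub>R z K"
      using x by (auto simp: P_def)
    obtain A b where A: "linear A" "\<And>x. x \<in> K \<Longrightarrow> v x = A x + b"
      using S1_affineE[OF v K] by metis
    have "x \<in> K" "y \<in> K" "z K \<in> K"
      using P_sub[OF K] interior_subset[of K] x y(1) z(1)[OF K] corners_subset[of K] by auto
    then have vx: "v x = (1/4) *\<^sub>R v y + (3/4) *\<^sub>R v (z K)"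
      unfolding y(2) using A y(2)
      by (simp add: linear_add linear_cmul scaleR_add_right flip: scaleR_left_distrib)
    have "norm (v y) \<le> norm (v (z K))"
      using S1_norm_sq_le_nodal_max[OF v that(1) \<open>y \<in> K\<close>] z(2) that(1)
      by (simp add: power2_le_iff_abs_le)
    moreover have "norm ((3/4) *\<^sub>R v (z K)) - norm ((1/4) *\<^sub>R v y) \<le> norm (v x)"
      unfolding vx using norm_diff_ineq[of "(3/4) *\<^sub>R v (z K)" "(1/4) *\<^sub>R v y"] by (simp add: add.commute)
    \<comment> \<open>3/4 - 1/4 = 1/2, because \<open>v y\<close> is no longer than
      \<open>v (z K)\<close>.\<close>
    ultimately have "norm (v (z K)) / 2 \<le> norm (v x)" by simp
    then have "(norm (v (z K)) / 2)\<^sup>2 \<le> (norm (v x))\<^sup>2" by (intro power_mono) auto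
    then show ?thesis using z(2) that(1) by (simp add: power_divide)
  qed
  let ?g = "\<lambda>x. \<Sum>K\<in>\<T>. nodal_max v K / 4 * indicator (P K) x"
  have P_\<Omega>: "P K \<subseteq> \<Omega>" if "K \<in> \<T>" for K
    using P_sub interior_subset_\<Omega> that by blast
  have int: "integrable (lebesgue_on \<Omega>) ?g"
    using P_\<Omega> P_sets by (intro Bochner_Integration.integrable_sum integrable_mult_right integral_indicator_subset_\<Omega>) auto
  have "?g x \<le> v x \<bullet> v x" for x
  proof (cases "\<exists>K\<in>\<T>. x \<in> P K")
    case True
    then obtain K where K: "K \<in> \<T>" "x \<in> P K" by blast
    \<comment> \<open>The shrunk copies are disjoint, so at most one summand is nonzero at each
      point.\<close>
    have "x \<notin> P K'" if "K' \<in> \<T> - {K}" for K'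
      using interiors_disjoint[of K K' x] K that P_sub by blast
    then have "?g x = nodal_max v K / 4"
      using K finite_\<T> by (simp add: sum.remove[of \<T> K])
    then show ?thesis using P_ge[OF K] by (simp add: power2_norm_eq_inner)
  next
    case False
    then have "?g x = 0" by (auto intro!: sum.neutral)
    then show ?thesis by simp
  qed
  then have "(\<integral>x. ?g x \<partial>lebesgue_on \<Omega>) \<le> L2_inner \<Omega> v v"
    unfolding L2_inner_def using v int by (intro integral_mono L2_integrable_inner S1_L2)
  moreover have "(\<integral>x. ?g x \<partial>lebesgue_on \<Omega>) = (\<Sum>K\<in>\<T>. nodal_max v K / 4 * measure lebesgue (P K))"
    using P_\<Omega> P_sets integral_indicator_subset_\<Omega> by (subst Bochner_Integration.integral_sum) auto
  \<comment> \<open>256 = 4 * 64: halving |v| costs 4 in its square, and the volume of the copy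
    costs 64.\<close>
  moreover have "\<dots> = (\<Sum>K\<in>\<T>. nodal_max v K * measure lebesgue (interior K)) / 256"
    unfolding P_meas sum_divide_distrib by (intro sum.cong) auto
  ultimately show ?thesis by simp
qed

end

section \<open>Finite element functions are weakly differentiable\<close>

lemma integral_translate_lborel:
  fixes f :: "'a::euclidean_space \<Rightarrow> real"
  assumes "integrable lborel f"
  shows "integrable lborel (\<lambda>x. f (x + c))" "(\<integral>x. f (x + c) \<partial>lborel) = (\<integral>x. f x \<partial>lborel)"
proof -
  have [measurable]: "f \<in> borel_measurable borel" using assms by auto
  have f: "integrable (distr lborel borel ((+) c)) f"
    using assms by (simp add: lborel_distr_plus)
  show "integrable lborel (\<lambda>x. f (x + c))"
    using f by (subst (asm) integrable_distr_eq) (auto simp: add.commute)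
  have "(\<integral>x. f x \<partial>lborel) = (\<integral>x. f x \<partial>distr lborel borel ((+) c))"
    by (simp add: lborel_distr_plus)
  also have "\<dots> = (\<integral>x. f (x + c) \<partial>lborel)"
    by (subst integral_distr) (auto simp: add.commute)
  finally show "(\<integral>x. f (x + c) \<partial>lborel) = (\<integral>x. f x \<partial>lborel)" by simp
qed

lemma test_function_directional_derivative:
  assumes "\<phi> \<in> test_functions \<Omega>"
  shows "((\<lambda>s. \<phi> (x + s *\<^sub>R axis j 1)) has_real_derivative partial j \<phi> (x + s *\<^sub>R axis j 1)) (at s)"
proof -
  let ?y = "x + s *\<^sub>R axis j 1"
  have D: "(\<phi> has_derivative frechet_derivative \<phi> (at ?y)) (at ?y)"
    by (rule test_function_derivative[OF assms])
  have "((\<lambda>s. x + s *\<^sub>R axis j (1::real)) has_derivative (\<lambda>s. s *\<^sub>R axis j 1)) (at s)"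
    by (auto intro!: derivative_eq_intros)
  from has_derivative_compose[OF this D]
  have "((\<lambda>s. \<phi> (x + s *\<^sub>R axis j 1)) has_derivative
      (\<lambda>s. frechet_derivative \<phi> (at ?y) (s *\<^sub>R axis j 1))) (at s)" .
  moreover have "frechet_derivative \<phi> (at ?y) (s *\<^sub>R axis j 1) = partial j \<phi> ?y * s" for s
    using has_derivative_linear[OF D] by (simp add: linear_cmul partial_def mult.commute)
  ultimately show ?thesis by (simp add: has_field_derivative_def)
qed

lemma test_function_increment_le:
  assumes "\<phi> \<in> test_functions \<Omega>" and B: "\<And>x. \<bar>partial j \<phi> x\<bar> \<le> B" and "t > 0"
  shows "\<bar>\<phi> (x + t *\<^sub>R axis j 1) - \<phi> x\<bar> \<le> B * t"
proof -
  have "\<exists>z. z > 0 \<and> z < t \<and> \<phi> (x + t *\<^sub>R axis j 1) - \<phi> (x + 0 *\<^sub>R axis j 1)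
      = (t - 0) * partial j \<phi> (x + z *\<^sub>R axis j 1)"
    using assms(3) by (intro MVT2 test_function_directional_derivative[OF assms(1)])
  then obtain z where "\<phi> (x + t *\<^sub>R axis j 1) - \<phi> x = t * partial j \<phi> (x + z *\<^sub>R axis j 1)"
    by auto
  then show ?thesis
    using assms(3) B[of "x + z *\<^sub>R axis j 1"] by (simp add: abs_mult mult.commute)
qed

context mesh
begin

lemma S1_lipschitz_on_segments:
  fixes w :: "real^3 \<Rightarrow> real"
  assumes A: "\<And>K. K \<in> \<T> \<Longrightarrow> linear (A K)" "\<And>K x. K \<in> \<T> \<Longrightarrow> x \<in> K \<Longrightarrow> w x = A K x + b K"
  obtains L where "L \<ge> 0"
    "\<And>x e t. norm e = 1 \<Longrightarrow> t \<ge> 0 \<Longrightarrow> (\<And>s. 0 \<le> s \<Longrightarrow> s \<le> t \<Longrightarrow> x + s *\<^sub>R e \<in> \<Omega>) \<Longrightarrow>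
      \<bar>w (x + t *\<^sub>R e) - w x\<bar> \<le> L * t"
proof -
  have "\<forall>K. \<exists>l\<ge>0. K \<in> \<T> \<longrightarrow> (\<forall>x. norm (A K x) \<le> l * norm x)"
    using linear_bounded_pos[OF A(1)] by (metis less_imp_le order_refl)
  then obtain l where l: "\<And>K. 0 \<le> l K" "\<And>K x. K \<in> \<T> \<Longrightarrow> norm (A K x) \<le> l K * norm x" by metis
  define L where "L = sum l \<T>"
  have lL: "l K \<le> L" if "K \<in> \<T>" for K
    unfolding L_def using that finite_\<T> l(1) by (intro member_le_sum) auto
  have "L \<ge> 0" unfolding L_def using l(1) by (intro sum_nonneg)
  moreover have "\<bar>w (x + t *\<^sub>R e) - w x\<bar> \<le> L * t"
    if e: "norm e = 1" and t: "t \<ge> 0" and seg: "\<And>s. 0 \<le> s \<Longrightarrow> s \<le> t \<Longrightarrow> x + s *\<^sub>R e \<in> \<Omega>" for x e t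
  proof -
    define U where "U K = (\<lambda>s. x + s *\<^sub>R e) -` K" for K
    have "lipschitz_on L {0..t} (\<lambda>s. w (x + s *\<^sub>R e))"
    proof (rule lipschitz_on_closed_Union[where I=\<T> and U=U])
      fix K assume K: "K \<in> \<T>"
      show "closed (U K)"
        unfolding U_def using corners(5)[OF K] compact_imp_closed
        by (intro closed_vimage) (auto intro!: continuous_intros)
      show "lipschitz_on L (U K) (\<lambda>s. w (x + s *\<^sub>R e))"
      proof (rule lipschitz_onI)
        fix r s assume rs: "r \<in> U K" "s \<in> U K"
        then have "w (x + r *\<^sub>R e) - w (x + s *\<^sub>R e) = A K ((r - s) *\<^sub>R e)"
          using A(2)[OF K] linear_diff[OF A(1)[OF K]] by (simp add: U_def algebra_simps flip: linear_diff[OF A(1)[OF K]])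
        then have "\<bar>w (x + r *\<^sub>R e) - w (x + s *\<^sub>R e)\<bar> \<le> l K * \<bar>r - s\<bar>"
          using l(2)[OF K, of "(r - s) *\<^sub>R e"] e by simp
        also have "\<dots> \<le> L * \<bar>r - s\<bar>" using lL[OF K] by (intro mult_right_mono) auto
        finally show "dist (w (x + r *\<^sub>R e)) (w (x + s *\<^sub>R e)) \<le> L * dist r s"
          by (simp add: dist_real_def)
      qed (fact \<open>L \<ge> 0\<close>)
    next
      show "{0..t} \<subseteq> (\<Union>K\<in>\<T>. U K)"
      proof
        fix s assume "s \<in> {0..t}"
        then have "x + s *\<^sub>R e \<in> \<Union>\<T>" using seg closure_subset Union_\<T> by auto
        then show "s \<in> (\<Union>K\<in>\<T>. U K)" by (auto simp: U_def)
      qed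
    qed (use finite_\<T> \<open>L \<ge> 0\<close> in auto)
    from lipschitz_onD[OF this, of t 0] show ?thesis using t by (simp add: dist_real_def)
  qed
  ultimately show thesis using that by blast
qed

lemma integral_\<Omega>_eq_lborel:
  fixes f :: "real^3 \<Rightarrow> real"
  assumes "f \<in> borel_measurable borel" "\<And>x. x \<notin> \<Omega> \<Longrightarrow> f x = 0"
  shows "(\<integral>x. f x \<partial>lebesgue_on \<Omega>) = (\<integral>x. f x \<partial>lborel)"
    "integrable (lebesgue_on \<Omega>) f \<longleftrightarrow> integrable lborel f"
proof -
  have eq: "indicator \<Omega> x *\<^sub>R f x = f x" for x using assms(2) by (auto simp: indicator_def)
  show "(\<integral>x. f x \<partial>lebesgue_on \<Omega>) = (\<integral>x. f x \<partial>lborel)"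
    using assms(1) by (subst integral_restrict_space) (simp_all add: eq integral_completion del: real_scaleR_def)
  show "integrable (lebesgue_on \<Omega>) f \<longleftrightarrow> integrable lborel f"
    using assms(1) by (subst integrable_restrict_space) (simp_all add: eq integrable_completion del: real_scaleR_def)
qed

text \<open>The integral of a difference quotient of \<open>w \<phi>\<close> over the whole space vanishes by translation
  invariance; dominated convergence then gives the formula for piecewise affine \<open>w\<close> without
  boundary terms on the elements.\<close>

lemma S1_integration_by_parts:
  fixes w :: "real^3 \<Rightarrow> real"
  assumes w: "w \<in> S1 \<T>" and \<phi>: "\<phi> \<in> test_functions \<Omega>"
    and A: "\<And>K. K \<in> \<T> \<Longrightarrow> linear (A K)" "\<And>K x. K \<in> \<T> \<Longrightarrow> x \<in> K \<Longrightarrow> w x = A K x + b K"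
    and g: "g \<in> borel_measurable borel" "\<And>K x. K \<in> \<T> \<Longrightarrow> x \<in> interior K \<Longrightarrow> g x = A K (axis j 1)"
      "\<And>x. \<bar>g x\<bar> \<le> Bg"
  shows "(\<integral>x. w x * partial j \<phi> x \<partial>lebesgue_on \<Omega>) = - (\<integral>x. g x * \<phi> x \<partial>lebesgue_on \<Omega>)"
proof -
  let ?e = "axis j 1 :: real^3"
  have e: "norm ?e = 1" by simp
  obtain S where S: "compact S" "S \<subseteq> \<Omega>" "\<And>x. x \<notin> S \<Longrightarrow> \<phi> x = 0" "\<And>x j. x \<notin> S \<Longrightarrow> partial j \<phi> x = 0"
    using test_function_support[OF \<phi>] by metis
  obtain B where B: "\<And>x. \<bar>\<phi> x\<bar> \<le> B" "\<And>x j. \<bar>partial j \<phi> x\<bar> \<le> B"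
    using test_function_bounded[OF \<phi>] by metis
  obtain Bw where Bw: "Bw > 0" "\<And>x. norm (w x) \<le> Bw" using S1_bounded[OF w] by metis
  obtain L where L: "L \<ge> 0" "\<And>x e t. norm e = 1 \<Longrightarrow> t \<ge> 0 \<Longrightarrow> (\<And>s. 0 \<le> s \<Longrightarrow> s \<le> t \<Longrightarrow> x + s *\<^sub>R e \<in> \<Omega>) \<Longrightarrow>
      \<bar>w (x + t *\<^sub>R e) - w x\<bar> \<le> L * t"
    using S1_lipschitz_on_segments[of A w b, OF A] by metis
  have "B \<ge> 0" using B(1) abs_ge_zero order_trans by blast
  obtain \<delta> where \<delta>: "\<delta> > 0" "(\<Union>x\<in>S. ball x \<delta>) \<subseteq> \<Omega>"
    using compact_subset_open_imp_ball_epsilon_subset[OF S(1) open_\<Omega> S(2)] by blast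
  have near: "x + s *\<^sub>R ?e \<in> \<Omega>" if "x \<in> S" "\<bar>s\<bar> < \<delta>" for x s
  proof -
    have "x + s *\<^sub>R ?e \<in> ball x \<delta>" using that(2) by (simp add: dist_norm)
    with \<delta>(2) that(1) show ?thesis by blast
  qed
  have [measurable]: "w \<in> borel_measurable borel" "g \<in> borel_measurable borel"
    "\<phi> \<in> borel_measurable borel" "partial j \<phi> \<in> borel_measurable borel"
    using S1_borel_measurable[OF w] g(1) test_function_continuous[OF \<phi>]
    by (auto intro: borel_measurable_continuous_onI)
  have bm: "f \<in> borel_measurable borel \<Longrightarrow> f \<in> borel_measurable (lebesgue_on \<Omega>)" for f :: "real^3 \<Rightarrow> real"
    by (intro measurable_restrict_space1 measurable_completion) simp
  define F where "F x = w x * \<phi> x" for x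
  have F_meas [measurable]: "F \<in> borel_measurable borel" unfolding F_def by measurable
  have F0: "F x = 0" if "x \<notin> S" for x using S(3) that by (simp add: F_def)
  have F_bd: "norm (F x) \<le> Bw * B" for x
    unfolding F_def using B(1)[of x] Bw \<open>B \<ge> 0\<close> by (auto simp: abs_mult intro!: mult_mono)
  have F_int: "integrable lborel F"
    using integral_\<Omega>_eq_lborel(2)[OF F_meas] F0 S(2) bounded_measurable_integrable[OF bm[OF F_meas] F_bd] by blast
  \<comment> \<open>The double \<open>Suc\<close> keeps even the first step strictly below
    \<open>\<delta>\<close>.\<close>
  define t where "t n = \<delta> * inverse (real (Suc (Suc n)))" for n
  have t: "t n > 0" "t n < \<delta>" for n using \<delta>(1) by (simp_all add: t_def field_simps add_pos_nonneg)
  have t_lim: "filterlim t (at 0) sequentially"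
  proof (rule filterlim_atI)
    show "t \<longlonglongrightarrow> 0" unfolding t_def
      using tendsto_mult[OF tendsto_const LIMSEQ_Suc[OF LIMSEQ_inverse_real_of_nat], of \<delta>] by simp
    show "\<forall>\<^sub>F n in sequentially. t n \<noteq> 0" using t(1) by (auto intro!: always_eventually simp: less_imp_neq[symmetric])
  qed
  define D where "D n x = (F (x + t n *\<^sub>R ?e) - F x) / t n" for n x
  have D_meas [measurable]: "D n \<in> borel_measurable borel" for n unfolding D_def by measurable
  \<comment> \<open>A shift shorter than \<open>\<delta>\<close> cannot carry a point outside
    \<open>\<Omega>\<close> into \<open>S\<close>, so the difference quotients still live on
    \<open>\<Omega>\<close> and their integrals can be taken over the whole space.\<close>
  have D0: "D n x = 0" if "x \<notin> \<Omega>" for n x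
  proof -
    have "x + t n *\<^sub>R ?e \<notin> S" using near[of "x + t n *\<^sub>R ?e" "- t n"] t[of n] that by auto
    then show ?thesis using F0 that S(2) by (auto simp: D_def)
  qed
  have "(\<integral>x. D n x \<partial>lebesgue_on \<Omega>) = 0" for n
  proof -
    have "(\<integral>x. D n x \<partial>lebesgue_on \<Omega>) = (\<integral>x. D n x \<partial>lborel)"
      by (rule integral_\<Omega>_eq_lborel(1)[OF D_meas D0])
    also have "\<dots> = ((\<integral>x. F (x + t n *\<^sub>R ?e) \<partial>lborel) - (\<integral>x. F x \<partial>lborel)) / t n"
      unfolding D_def using integral_translate_lborel(1)[OF F_int] F_int by simp
    also have "\<dots> = 0" using integral_translate_lborel(2)[OF F_int] by simp
    finally show ?thesis .
  qed
  moreover have "(\<lambda>n. \<integral>x. D n x \<partial>lebesgue_on \<Omega>) \<longlonglongrightarrow> (\<integral>x. g x * \<phi> x + w x * partial j \<phi> x \<partial>lebesgue_on \<Omega>)"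
  \<comment> \<open>The two summands bound the two halves of the discrete product rule:
    \<open>w\<close> at the shifted point times the increment of \<open>\<phi>\<close>, and the
    increment of \<open>w\<close> times \<open>\<phi> x\<close>.\<close>
  proof (rule integral_dominated_convergence[where w="\<lambda>x. Bw * B + L * B"])
    interpret finite_measure "lebesgue_on \<Omega>"
      using lmeasurable_\<Omega> by (rule finite_measure_lebesgue_on)
    show "integrable (lebesgue_on \<Omega>) (\<lambda>x. Bw * B + L * B)" by simp
    show "AE x in lebesgue_on \<Omega>. (\<lambda>n. D n x) \<longlonglongrightarrow> g x * \<phi> x + w x * partial j \<phi> x"
      using AE_in_interiors
    proof eventually_elim
      case (elim x)
      then obtain K where K: "K \<in> \<T>" "x \<in> interior K" by blast
      have "((\<lambda>s. A K x + s * A K ?e + b K) has_real_derivative A K ?e) (at 0)"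
        by (auto intro!: derivative_eq_intros)
      then have "((\<lambda>s. w (x + s *\<^sub>R ?e)) has_real_derivative A K ?e) (at 0)"
      proof (rule has_field_derivative_transform_within_open[where S="(\<lambda>s. x + s *\<^sub>R ?e) -` interior K"])
        show "open ((\<lambda>s. x + s *\<^sub>R ?e) -` interior K)"
          by (intro open_vimage) (auto intro!: continuous_intros)
        show "0 \<in> (\<lambda>s. x + s *\<^sub>R ?e) -` interior K" using K by simp
        fix s assume "s \<in> (\<lambda>s. x + s *\<^sub>R ?e) -` interior K"
        then have "x + s *\<^sub>R ?e \<in> K" using interior_subset by auto
        then show "A K x + s * A K ?e + b K = w (x + s *\<^sub>R ?e)"
          using A(2)[OF K(1)] A(1)[OF K(1)] by (simp add: linear_add linear_cmul)
      qed
      from DERIV_mult[OF this test_function_directional_derivative[OF \<phi>, of x j 0]]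
      have "((\<lambda>s. F (x + s *\<^sub>R ?e)) has_real_derivative g x * \<phi> x + w x * partial j \<phi> x) (at 0)"
        using g(2)[OF K] by (simp add: F_def[abs_def] algebra_simps)
      then have "((\<lambda>s. (F (x + (0 + s) *\<^sub>R ?e) - F (x + 0 *\<^sub>R ?e)) / s) \<longlongrightarrow> g x * \<phi> x + w x * partial j \<phi> x) (at 0)"
        unfolding DERIV_def .
      from filterlim_compose[OF this t_lim] show ?case by (simp add: D_def)
    qed
    show "AE x in lebesgue_on \<Omega>. norm (D n x) \<le> Bw * B + L * B" for n
    proof (rule AE_I2)
      fix x
      \<comment> \<open>The factor \<open>\<phi> x\<close> vanishes off \<open>S\<close>, so the
        Lipschitz bound is needed only for segments that start in \<open>S\<close> and thus stay in
        \<open>\<Omega>\<close>.\<close>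
      have "\<bar>w (x + t n *\<^sub>R ?e) - w x\<bar> * \<bar>\<phi> x\<bar> \<le> L * t n * B"
      proof (cases "x \<in> S")
        case True
        have "\<bar>w (x + t n *\<^sub>R ?e) - w x\<bar> \<le> L * t n"
          using t[of n] near[OF True] by (intro L(2)[OF e]) auto
        then show ?thesis using B(1)[of x] L(1) t(1)[of n] by (intro mult_mono) auto
      next
        case False
        then show ?thesis using S(3) L(1) t(1)[of n] \<open>B \<ge> 0\<close> by simp
      qed
      moreover have "\<bar>w (x + t n *\<^sub>R ?e)\<bar> * \<bar>\<phi> (x + t n *\<^sub>R ?e) - \<phi> x\<bar> \<le> Bw * (B * t n)"
        using Bw test_function_increment_le[OF \<phi> B(2) t(1)] by (intro mult_mono) auto
      moreover have "F (x + t n *\<^sub>R ?e) - F x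
          = w (x + t n *\<^sub>R ?e) * (\<phi> (x + t n *\<^sub>R ?e) - \<phi> x) + (w (x + t n *\<^sub>R ?e) - w x) * \<phi> x"
        by (simp add: F_def algebra_simps)
      ultimately have "\<bar>F (x + t n *\<^sub>R ?e) - F x\<bar> \<le> Bw * (B * t n) + L * t n * B"
        using abs_triangle_ineq[of "w (x + t n *\<^sub>R ?e) * (\<phi> (x + t n *\<^sub>R ?e) - \<phi> x)"
            "(w (x + t n *\<^sub>R ?e) - w x) * \<phi> x"] by (simp only: abs_mult)
      also have "\<dots> = (Bw * B + L * B) * t n" by (simp add: algebra_simps)
      finally show "norm (D n x) \<le> Bw * B + L * B"
        using t(1)[of n] by (simp add: D_def divide_le_eq)
    qed
  qed (auto intro!: bm)
  ultimately have "(\<integral>x. g x * \<phi> x + w x * partial j \<phi> x \<partial>lebesgue_on \<Omega>) = 0"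
    by (simp add: LIMSEQ_const_iff)
  moreover have "integrable (lebesgue_on \<Omega>) (\<lambda>x. g x * \<phi> x)"
    using g(3) B(1) by (intro bounded_measurable_integrable[where B="Bg * B"] bm)
      (auto simp: abs_mult intro!: mult_mono order_trans[OF abs_ge_zero g(3)])
  moreover have "integrable (lebesgue_on \<Omega>) (\<lambda>x. w x * partial j \<phi> x)"
    using Bw B(2) by (intro bounded_measurable_integrable[where B="Bw * B"] bm)
      (auto simp: abs_mult intro!: mult_mono)
  ultimately show ?thesis by simp
qed

text \<open>The candidate is the matrix of the affine piece on each open element and 0 elsewhere.
  Continuity across faces keeps jump terms out of the distributional derivative; it enters through
  the Lipschitz bound on segments.\<close>

lemma S1_H1:
  assumes u: "u \<in> S1 \<T>"
  shows "u \<in> H1 \<Omega>"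
proof -
  have "\<forall>K\<in>\<T>. \<exists>A b. linear A \<and> (\<forall>x\<in>K. u x = A x + b)"
    using u by (simp add: S1_def)
  then obtain A b where A: "\<And>K. K \<in> \<T> \<Longrightarrow> linear (A K)"
    "\<And>K x. K \<in> \<T> \<Longrightarrow> x \<in> K \<Longrightarrow> u x = A K x + b K" by metis
  define G where "G x = (\<Sum>K\<in>\<T>. indicator (interior K) x *\<^sub>R matrix (A K))" for x
  have G_meas [measurable]: "G \<in> borel_measurable borel"
    unfolding G_def by measurable
  have G_bd: "norm (G x) \<le> (\<Sum>K\<in>\<T>. norm (matrix (A K)))" for x
    unfolding G_def by (intro sum_norm_le) (auto simp: indicator_def)
  have G_eq: "G x = matrix (A K)" if K: "K \<in> \<T>" "x \<in> interior K" for K x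
  proof -
    have "indicator (interior K') x *\<^sub>R matrix (A K') = 0" if "K' \<in> \<T> - {K}" for K'
      using interiors_disjoint[of K K' x] K that by (simp add: indicator_def) blast
    then have "G x = (\<Sum>K'\<in>{K}. indicator (interior K') x *\<^sub>R matrix (A K'))"
      unfolding G_def using K finite_\<T> by (intro sum.mono_neutral_right) auto
    then show ?thesis using K by simp
  qed
  have "G \<in> L2 \<Omega>"
    using G_bd by (intro bounded_measurable_L2 measurable_restrict_space1 measurable_completion) auto
  moreover have "(\<integral>x. u x $ i * partial j \<phi> x \<partial>lebesgue_on \<Omega>) = - (\<integral>x. G x $ i $ j * \<phi> x \<partial>lebesgue_on \<Omega>)"
    if \<phi>: "\<phi> \<in> test_functions \<Omega>" for \<phi> i j
  proof (rule S1_integration_by_parts[where A="\<lambda>K x. A K x $ i" and b="\<lambda>K. b K $ i"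
        and Bg="\<Sum>K\<in>\<T>. norm (matrix (A K))"])
    show "(\<lambda>x. u x $ i) \<in> S1 \<T>"
      by (rule S1_linear_image[OF u]) (simp add: bounded_linear_vec_nth bounded_linear.linear)
    show "linear (\<lambda>x. A K x $ i)" if "K \<in> \<T>" for K
      using linear_compose[OF A(1)[OF that], of "\<lambda>y. y $ i"]
      by (simp add: o_def bounded_linear_vec_nth bounded_linear.linear)
    show "\<bar>G x $ i $ j\<bar> \<le> (\<Sum>K\<in>\<T>. norm (matrix (A K)))" for x
      using component_le_norm_cart[of "G x $ i" j] Finite_Cartesian_Product.norm_nth_le[of "G x" i] G_bd[of x] by simp
    show "(\<lambda>x. G x $ i $ j) \<in> borel_measurable borel"
      by (rule measurable_compose[OF G_meas borel_measurable_continuous_onI])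
        (auto intro!: continuous_intros)
  qed (use \<phi> A(2) G_eq in \<open>auto simp: matrix_def\<close>)
  ultimately have "has_weak_gradient \<Omega> u G"
    unfolding has_weak_gradient_def using S1_L2[OF u] by blast
  then show ?thesis unfolding H1_def by blast
qed

end

section \<open>Linear problems on finite element spaces\<close>

text \<open>Gram-Schmidt orthogonalisation of the new generator \<open>s\<close> against the old ones.\<close>

lemma positive_bilinear_form_represents:
  fixes scale :: "real \<Rightarrow> 'v::ab_group_add \<Rightarrow> 'v" (infixr "*s" 75)
    and B :: "'v \<Rightarrow> 'v \<Rightarrow> real" and F :: "'v \<Rightarrow> real"
  assumes vs: "vector_space scale" and "finite S" and V: "module.subspace scale V" and "S \<subseteq> V"
    and add_left: "\<And>x y z. x \<in> V \<Longrightarrow> y \<in> V \<Longrightarrow> z \<in> V \<Longrightarrow> B (x + y) z = B x z + B y z"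
    and scale_left: "\<And>c x z. x \<in> V \<Longrightarrow> z \<in> V \<Longrightarrow> B (c *s x) z = c * B x z"
    and add_right: "\<And>x y z. x \<in> V \<Longrightarrow> y \<in> V \<Longrightarrow> z \<in> V \<Longrightarrow> B z (x + y) = B z x + B z y"
    and scale_right: "\<And>c x z. x \<in> V \<Longrightarrow> z \<in> V \<Longrightarrow> B z (c *s x) = c * B z x"
    and pos: "\<And>x. x \<in> V \<Longrightarrow> x \<noteq> 0 \<Longrightarrow> B x x > 0"
    and F_add: "\<And>x y. x \<in> V \<Longrightarrow> y \<in> V \<Longrightarrow> F (x + y) = F x + F y"
    and F_scale: "\<And>c x. x \<in> V \<Longrightarrow> F (c *s x) = c * F x"
  shows "\<exists>v\<in>module.span scale S. \<forall>w\<in>module.span scale S. B v w = F w"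
proof -
  interpret vs: vector_space scale by (rule vs)
  show ?thesis
    using assms(2,4) F_add F_scale
  proof (induction S arbitrary: F rule: finite_induct)
  case empty
  have "B 0 0 = 0 * B 0 0" "F 0 = 0 * F 0"
    using scale_left[of 0 0 0] empty(3)[of 0 0] vs.subspace_0[OF V] by auto
  then show ?case by auto
next
  case (insert s S)
  have S: "S \<subseteq> V" "s \<in> V" using insert.prems by auto
  have span: "vs.span S \<subseteq> V" using S V by (simp add: vs.span_minimal)
  obtain v0 where v0: "v0 \<in> vs.span S" "\<And>w. w \<in> vs.span S \<Longrightarrow> B v0 w = F w"
    using insert.IH[OF S(1) insert.prems(2,3)] by blast
  \<comment> \<open>The induction hypothesis is used a second time, now for the functional
    \<open>B s\<close>: its representative \<open>p\<close> is the projection of \<open>s\<close>,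
    so that \<open>e\<close> below is orthogonal to the old span.\<close>
  obtain p where p: "p \<in> vs.span S" "\<And>w. w \<in> vs.span S \<Longrightarrow> B p w = B s w"
    using insert.IH[of "B s"] S add_right scale_right by blast
  have in_V: "x \<in> V" if "x \<in> vs.span S" for x using span that by blast
  define e where "e = s + (-1) *s p"
  have pV: "p \<in> V" "v0 \<in> V" using in_V p v0 by auto
  have e: "e \<in> V" unfolding e_def using V S pV by (intro vs.subspace_add vs.subspace_scale)
  have e_orth: "B e w = 0" if "w \<in> vs.span S" for w
    unfolding e_def using add_left[of s "(-1) *s p" w] scale_left[of p w "-1"] S pV in_V[OF that] p(2)[OF that]
      vs.subspace_scale[OF V pV(1), of "-1"] by simp
  show ?case
  proof (cases "e = 0")
    case True
    then have "s = p" by (simp add: e_def)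
    then have "vs.span (insert s S) = vs.span S" using p(1) by (simp add: vs.span_redundant)
    then show ?thesis using v0 by auto
  next
    case False
    then have pos_e: "B e e > 0" using pos e by blast
    \<comment> \<open>The coefficient solves the one new equation, with test vector
      \<open>e\<close>; adding a multiple of \<open>e\<close> leaves the old equations
      intact.\<close>
    define c where "c = (F e - B v0 e) / B e e"
    define v where "v = v0 + c *s e"
    have "s \<in> vs.span (insert s S)" "p \<in> vs.span (insert s S)" "v0 \<in> vs.span (insert s S)"
      using p(1) v0(1) vs.span_mono[of S "insert s S"] by (auto intro: vs.span_base)
    then have "v \<in> vs.span (insert s S)"
      unfolding v_def e_def by (intro vs.span_add vs.span_scale)
    moreover have "B v w = F w" if w_in: "w \<in> vs.span (insert s S)" for w
    proof -
      obtain k where k: "w - k *s s \<in> vs.span S" using w_in by (auto simp: vs.span_breakdown_eq)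
      \<comment> \<open>Exchanging \<open>s\<close> for \<open>e\<close> moves the correction by
        \<open>p\<close> into the old span, so testing with \<open>w\<close> reduces to testing with
        \<open>q\<close> and with \<open>e\<close>.\<close>
      define q where "q = (w - k *s s) + k *s p"
      have q: "q \<in> vs.span S" unfolding q_def using k p(1) by (intro vs.span_add vs.span_scale)
      have w: "w = q + k *s e" by (simp add: q_def e_def vs.scale_right_distrib vs.scale_right_diff_distrib)
      have ke: "k *s e \<in> V" "c *s e \<in> V" using V e by (auto intro: vs.subspace_scale)
      have v: "v \<in> V" unfolding v_def using V pV ke by (intro vs.subspace_add)
      have Bv: "B v x = B v0 x + c * B e x" if "x \<in> V" for x
        unfolding v_def using add_left[OF pV(2) ke(2) that] scale_left[OF e that] by simp
      have "B v w = B v q + k * B v e"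
        unfolding w using add_right[OF in_V[OF q] ke(1) v] scale_right[OF e v] by simp
      also have "\<dots> = F q + k * F e"
        using Bv[OF in_V[OF q]] Bv[OF e] e_orth[OF q] v0(2)[OF q] pos_e by (simp add: c_def)
      also have "\<dots> = F w"
        unfolding w using insert.prems(2)[OF in_V[OF q] ke(1)] insert.prems(3)[OF e] by simp
      finally show ?thesis .
    qed
    ultimately show ?thesis by blast
  qed
qed
qed

lemma vector_space_fun: "vector_space (\<lambda>c (f :: 'a \<Rightarrow> 'b::real_vector) x. c *\<^sub>R f x)"
  by unfold_locales (auto simp: fun_eq_iff algebra_simps)

lemma sum_fun_apply: "(\<Sum>i\<in>I. f i) x = (\<Sum>i\<in>I. f i x)"
  for f :: "'i \<Rightarrow> 'a \<Rightarrow> 'b::comm_monoid_add"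
  by (induction I rule: infinite_finite_induct) auto

context mesh
begin

text \<open>The generators are the vector-valued nodal basis: one hat function for every vertex and
  every coordinate direction.\<close>

lemma S1_finitely_spanned:
  "\<exists>H :: (real^3 \<Rightarrow> 'b::euclidean_space) set. finite H \<and>
     S1 \<T> \<subseteq> module.span (\<lambda>c f x. c *\<^sub>R f x) H"
proof -
  interpret fs: vector_space "\<lambda>c (f :: real^3 \<Rightarrow> 'b) x. c *\<^sub>R f x" by (rule vector_space_fun)
  define hat :: "real^3 \<Rightarrow> 'b \<Rightarrow> real^3 \<Rightarrow> 'b" where
    "hat z b = nodal_interp \<T> (\<lambda>y. if y = z then b else 0)" for z b
  define H where "H = (\<lambda>(z, b). hat z b) ` (vertices \<T> \<times> Basis)"
  have "u \<in> fs.span H" if u: "u \<in> S1 \<T>" for u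
  proof -
    let ?s = "\<Sum>(z, b)\<in>vertices \<T> \<times> Basis. (\<lambda>x. (u z \<bullet> b) *\<^sub>R hat z b x)"
    have s_eq: "?s = (\<lambda>x. \<Sum>(z, b)\<in>vertices \<T> \<times> Basis. (u z \<bullet> b) *\<^sub>R hat z b x)"
      by (rule ext) (simp add: sum_fun_apply split_def)
    have "u = ?s"
    proof (rule S1_eqI[OF u])
      show "?s \<in> S1 \<T>"
        by (subst s_eq, unfold split_def, intro S1_sum S1_scaleR, simp add: hat_def nodal_interp_works)
      fix y assume y: "y \<in> vertices \<T>"
      have "?s y = (\<Sum>z\<in>vertices \<T>. \<Sum>b\<in>Basis. (u z \<bullet> b) *\<^sub>R (if y = z then b else 0))"
        unfolding s_eq unfolding hat_def using y by (simp add: nodal_interp_works sum.cartesian_product)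
      also have "\<dots> = (\<Sum>z\<in>vertices \<T>. if y = z then (\<Sum>b\<in>Basis. (u z \<bullet> b) *\<^sub>R b) else 0)"
        by (intro sum.cong) auto
      also have "\<dots> = u y" using y finite_vertices by (simp add: euclidean_representation)
      finally show "u y = ?s y" by simp
    qed
    moreover have "?s \<in> fs.span H"
      unfolding split_def H_def by (intro fs.span_sum fs.span_scale fs.span_base) auto
    ultimately show ?thesis by simp
  qed
  moreover have "finite H" unfolding H_def using finite_vertices by simp
  ultimately show ?thesis by blast
qed

text \<open>Solvability of a linear problem with a positive form on a finite-dimensional space.
  Linearity is required on \<open>V\<close> alone, because integrals are additive only for
  integrable functions.\<close>

lemma S1_subspace_represents:
  fixes V :: "(real^3 \<Rightarrow> 'b::euclidean_space) set" and B :: "(real^3 \<Rightarrow> 'b) \<Rightarrow> (real^3 \<Rightarrow> 'b) \<Rightarrow> real"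
  assumes "V \<subseteq> S1 \<T>" and zero: "(\<lambda>x. 0) \<in> V"
    and add: "\<And>u w. u \<in> V \<Longrightarrow> w \<in> V \<Longrightarrow> (\<lambda>x. u x + w x) \<in> V"
    and scale: "\<And>c u. u \<in> V \<Longrightarrow> (\<lambda>x. c *\<^sub>R u x) \<in> V"
    and "\<And>u v w. u \<in> V \<Longrightarrow> v \<in> V \<Longrightarrow> w \<in> V \<Longrightarrow> B (\<lambda>x. u x + v x) w = B u w + B v w"
    and "\<And>c u w. u \<in> V \<Longrightarrow> w \<in> V \<Longrightarrow> B (\<lambda>x. c *\<^sub>R u x) w = c * B u w"
    and "\<And>u v w. u \<in> V \<Longrightarrow> v \<in> V \<Longrightarrow> w \<in> V \<Longrightarrow> B w (\<lambda>x. u x + v x) = B w u + B w v"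
    and "\<And>c u w. u \<in> V \<Longrightarrow> w \<in> V \<Longrightarrow> B w (\<lambda>x. c *\<^sub>R u x) = c * B w u"
    and "\<And>u. u \<in> V \<Longrightarrow> u \<noteq> (\<lambda>x. 0) \<Longrightarrow> B u u > 0"
    and "\<And>u v. u \<in> V \<Longrightarrow> v \<in> V \<Longrightarrow> F (\<lambda>x. u x + v x) = F u + F v"
    and "\<And>c u. u \<in> V \<Longrightarrow> F (\<lambda>x. c *\<^sub>R u x) = c * F u"
  shows "\<exists>v\<in>V. \<forall>w\<in>V. B v w = F w"
proof -
  interpret fs: vector_space "\<lambda>c (f :: real^3 \<Rightarrow> 'b) x. c *\<^sub>R f x" by (rule vector_space_fun)
  have V: "fs.subspace V"
    using zero add scale by (auto simp: fs.subspace_def zero_fun_def plus_fun_def)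
  obtain H :: "(real^3 \<Rightarrow> 'b) set" where H: "finite H" "S1 \<T> \<subseteq> fs.span H"
    using S1_finitely_spanned by blast
  \<comment> \<open>A maximal independent subset of \<open>V\<close> generates \<open>V\<close>, and
    it is finite because \<open>V\<close> lies in the span of finitely many functions.\<close>
  obtain S where S: "S \<subseteq> V" "fs.independent S" "V \<subseteq> fs.span S"
    using fs.maximal_independent_subset by blast
  have "finite S"
    using fs.independent_span_bound[OF H(1) S(2)] S(1) H(2) assms(1) by blast
  moreover have "fs.span S = V" using S V fs.span_minimal by blast
  ultimately show ?thesis
    using positive_bilinear_form_represents[OF fs.vector_space_axioms, of S V B F] S(1) V assms
    by (auto simp: zero_fun_def plus_fun_def)
qed

end

section \<open>One step of the flow\<close>

lemma energy_eq:
  "energy \<Omega> a11 a22 a12 a0 (m1, m2) =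
    1/2 * (a11 * grad_inner \<Omega> m1 m1 + a22 * grad_inner \<Omega> m2 m2)
    + a12 * grad_inner \<Omega> m1 m2 - a0 * L2_inner \<Omega> m1 m2"
  by (simp add: energy_def L2_norm_sq grad_inner_def)

lemma grad_inner_commute: "grad_inner \<Omega> u w = grad_inner \<Omega> w u"
  by (simp add: grad_inner_def L2_inner_commute)

lemma grad_inner_nonneg: "0 \<le> grad_inner \<Omega> u u"
  by (simp add: grad_inner_def L2_inner_nonneg)

locale coupled_flow = mesh +
  fixes J :: "(real^3 \<Rightarrow> real^3) \<Rightarrow> 'h::{real_inner,complete_space}" and cH a11 a22 a12 a0 \<tau> :: real
  assumes emb: "hilbert_embedding \<Omega> cH J" and cH: "cH \<ge> 1"
    and a_sum: "a11 + a22 > 0" and a_det: "a11 * a22 > a12\<^sup>2"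
    and \<tau>: "\<tau> > 0" and step: "cH\<^sup>2 * \<bar>a0\<bar> * \<tau> < 2"
begin

abbreviation "l \<equiv> L2_inner \<Omega>"
abbreviation "g \<equiv> grad_inner \<Omega>"

lemma a_pos: "a11 > 0" "a22 > 0"
proof -
  have "a11 * a22 > 0" using a_det zero_le_power2[of a12] by linarith
  then have "(a11 > 0 \<and> a22 > 0) \<or> (a11 < 0 \<and> a22 < 0)" by (simp add: zero_less_mult_iff)
  then show "a11 > 0" "a22 > 0" using a_sum by linarith+
qed

declare S1_add [simp] S1_scaleR [simp] S1_zero [simp]

lemma l_add_left: "u \<in> S1 \<T> \<Longrightarrow> v \<in> S1 \<T> \<Longrightarrow> w \<in> S1 \<T> \<Longrightarrow> l (\<lambda>x. u x + v x) w = l u w + l v w"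
  by (intro L2_inner_add_left S1_L2)

lemma g_add_left: "u \<in> S1 \<T> \<Longrightarrow> v \<in> S1 \<T> \<Longrightarrow> w \<in> S1 \<T> \<Longrightarrow> g (\<lambda>x. u x + v x) w = g u w + g v w"
  by (intro grad_inner_add_left S1_H1 open_\<Omega> lmeasurable_\<Omega>)

lemma g_scaleR_left: "u \<in> S1 \<T> \<Longrightarrow> w \<in> S1 \<T> \<Longrightarrow> g (\<lambda>x. c *\<^sub>R u x) w = c * g u w"
  by (intro grad_inner_scaleR_left S1_H1 open_\<Omega> lmeasurable_\<Omega>)

lemma J_add: "u \<in> S1 \<T> \<Longrightarrow> v \<in> S1 \<T> \<Longrightarrow> J (\<lambda>x. u x + v x) = J u + J v"
  and J_scaleR: "u \<in> S1 \<T> \<Longrightarrow> J (\<lambda>x. c *\<^sub>R u x) = c *\<^sub>R J u"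
  and J_bound: "u \<in> S1 \<T> \<Longrightarrow> inverse cH * L2_norm \<Omega> u \<le> norm (J u)"
  using emb S1_H1 unfolding hilbert_embedding_def by blast+

lemma l_add_right: "u \<in> S1 \<T> \<Longrightarrow> v \<in> S1 \<T> \<Longrightarrow> w \<in> S1 \<T> \<Longrightarrow> l w (\<lambda>x. u x + v x) = l w u + l w v"
  using l_add_left by (simp add: L2_inner_commute)

lemma g_add_right: "u \<in> S1 \<T> \<Longrightarrow> v \<in> S1 \<T> \<Longrightarrow> w \<in> S1 \<T> \<Longrightarrow> g w (\<lambda>x. u x + v x) = g w u + g w v"
  using g_add_left by (simp add: grad_inner_commute)

lemma l_scaleR_right: "l w (\<lambda>x. c *\<^sub>R u x) = c * l w u"
  using L2_inner_scaleR_left by (simp add: L2_inner_commute)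

lemma g_scaleR_right: "u \<in> S1 \<T> \<Longrightarrow> w \<in> S1 \<T> \<Longrightarrow> g w (\<lambda>x. c *\<^sub>R u x) = c * g w u"
  using g_scaleR_left by (simp add: grad_inner_commute)

lemmas bilinear = l_add_left l_add_right L2_inner_scaleR_left l_scaleR_right
  g_add_left g_add_right g_scaleR_left g_scaleR_right J_add J_scaleR

lemma zero_right:
  "u \<in> S1 \<T> \<Longrightarrow> l u (\<lambda>x. 0) = 0" "u \<in> S1 \<T> \<Longrightarrow> g u (\<lambda>x. 0) = 0" "J (\<lambda>x. 0) = 0"
  using l_scaleR_right[of u 0 "\<lambda>x. 0"] g_scaleR_right[of "\<lambda>x. 0" u 0] J_scaleR[of "\<lambda>x. 0" 0] by simp_all

lemma L2_le_J: "u \<in> S1 \<T> \<Longrightarrow> l u u \<le> cH\<^sup>2 * (norm (J u))\<^sup>2"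
proof -
  assume u: "u \<in> S1 \<T>"
  have "L2_norm \<Omega> u \<le> cH * norm (J u)" using J_bound[OF u] cH by (simp add: field_simps)
  then have "(L2_norm \<Omega> u)\<^sup>2 \<le> (cH * norm (J u))\<^sup>2" by (intro power_mono L2_norm_nonneg)
  then show ?thesis by (simp add: L2_norm_sq power_mult_distrib)
qed

text \<open>The Hilbert norm controls the L2 norm, so \<open>u\<close> vanishes almost everywhere in
  \<open>\<Omega>\<close>; continuity improves this to the closed domain, and the convention of zero
  values outside to equality of functions. Hence \<open>J\<close> is injective on finite element
  functions.\<close>

lemma J_eq_0_imp:
  assumes u: "u \<in> S1 \<T>" and "J u = 0"
  shows "u = (\<lambda>x. 0)"
proof -
  have "l u u = 0" using L2_le_J[OF u] assms(2) L2_inner_nonneg[of \<Omega> u] by simp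
  then have "AE x in lebesgue_on \<Omega>. u x \<bullet> u x = 0"
    unfolding L2_inner_def
    by (subst (asm) integral_nonneg_eq_0_iff_AE) (auto intro: L2_integrable_inner S1_L2[OF u])
  then have AE: "AE x in lebesgue. x \<in> \<Omega> \<longrightarrow> u x = 0" by (subst (asm) AE_restrict_space_iff) auto
  have cont: "continuous_on (closure \<Omega>) u" using u by (simp add: S1_def Union_\<T>)
  define Z where "Z = \<Omega> \<inter> u -` (- {0})"
  have "open Z"
    unfolding Z_def using continuous_on_subset[OF cont closure_subset] open_\<Omega>
    by (intro continuous_open_preimage) auto
  have "AE x in lebesgue. x \<notin> Z" using AE by eventually_elim (auto simp: Z_def)
  moreover have "Z \<in> sets lebesgue" using \<open>open Z\<close> by auto
  ultimately have "negligible Z" by (simp add: negligible_iff_null_sets AE_iff_null_sets)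
  then have "Z = {}" using \<open>open Z\<close> open_not_negligible by blast
  then have "u x = 0" if "x \<in> \<Omega>" for x using that by (auto simp: Z_def)
  then have "u x = 0" if "x \<in> closure \<Omega>" for x
    using continuous_constant_on_closure[OF cont, of 0] that by blast
  moreover have "u x = 0" if "x \<notin> closure \<Omega>" for x using u that by (simp add: S1_def Union_\<T>)
  ultimately show ?thesis by blast
qed

text \<open>Completing the square: \<open>a11\<close> times the form is the squared norm of a11 grad
  u1 + c grad u2 plus (a11 a22 - c^2) times that of grad u2. The coefficient \<open>c\<close> is
  free because the flow problem uses \<open>a12 / 2\<close> and the energy
  \<open>a12\<close>.\<close>

lemma grad_form_nonneg:
  assumes u: "u1 \<in> S1 \<T>" "u2 \<in> S1 \<T>" and c: "c\<^sup>2 \<le> a11 * a22"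
  shows "0 \<le> a11 * g u1 u1 + a22 * g u2 u2 + 2 * c * g u1 u2"
proof -
  let ?w = "\<lambda>x. a11 *\<^sub>R u1 x + c *\<^sub>R u2 x"
  have "g ?w ?w = a11 * (a11 * g u1 u1 + 2 * c * g u1 u2) + c\<^sup>2 * g u2 u2"
    using u by (simp add: bilinear grad_inner_commute[of _ u2 u1] power2_eq_square algebra_simps)
  moreover have "0 \<le> (a11 * a22 - c\<^sup>2) * g u2 u2" using c grad_inner_nonneg by simp
  ultimately have "0 \<le> a11 * (a11 * g u1 u1 + a22 * g u2 u2 + 2 * c * g u1 u2)"
    using grad_inner_nonneg[of \<Omega> ?w] by (simp add: algebra_simps)
  then show ?thesis using a_pos(1) by (simp add: zero_le_mult_iff)
qed

lemma abs_l_le: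
  assumes u: "u \<in> S1 \<T>" "w \<in> S1 \<T>"
  shows "\<bar>l u w\<bar> \<le> (l u u + l w w) / 2"
proof -
  have "0 \<le> l (\<lambda>x. u x + w x) (\<lambda>x. u x + w x)" "0 \<le> l (\<lambda>x. u x + (-1) *\<^sub>R w x) (\<lambda>x. u x + (-1) *\<^sub>R w x)"
    by (rule L2_inner_nonneg)+
  then have "0 \<le> l u u + l w w + 2 * l u w" "0 \<le> l u u + l w w - 2 * l u w"
    using u S1_scaleR[OF u(2), of "-1"]
    by (simp_all only: bilinear S1_add S1_scaleR) (simp_all add: L2_inner_commute[of _ w u])
  then show ?thesis by (simp add: abs_le_iff)
qed

lemma abs_g_le:
  assumes u: "u \<in> S1 \<T>" "w \<in> S1 \<T>"
  shows "\<bar>g u w\<bar> \<le> (g u u + g w w) / 2"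
proof -
  have "0 \<le> g (\<lambda>x. u x + w x) (\<lambda>x. u x + w x)" "0 \<le> g (\<lambda>x. u x + (-1) *\<^sub>R w x) (\<lambda>x. u x + (-1) *\<^sub>R w x)"
    by (rule grad_inner_nonneg)+
  then have "0 \<le> g u u + g w w + 2 * g u w" "0 \<le> g u u + g w w - 2 * g u w"
    using u S1_scaleR[OF u(2), of "-1"]
    by (simp_all only: bilinear S1_add S1_scaleR) (simp_all add: grad_inner_commute[of _ w u])
  then show ?thesis by (simp add: abs_le_iff)
qed

text \<open>The two left-hand sides added up, which gives one symmetric form on pairs of fields.
  Nothing is lost: the two test functions are independent, and setting one of them to 0 recovers
  either equation.\<close>

definition flow_form where
  "flow_form u1 u2 f1 f2 = J u1 \<bullet> J f1 + J u2 \<bullet> J f2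
     + \<tau> * (a11 * g u1 f1 + a22 * g u2 f2 + a12 / 2 * (g u2 f1 + g u1 f2))
     - a0 / 2 * \<tau> * (l u2 f1 + l u1 f2)"

definition flow_rhs where
  "flow_rhs m1 m2 f1 f2 = - a11 * g m1 f1 - a12 * g m2 f1 + a0 * l m2 f1
     - a22 * g m2 f2 - a12 * g m1 f2 + a0 * l m1 f2"

text \<open>The gradient part is nonnegative. The lower order term has no sign but is at most cH^2
  |a0| \<tau> / 2 times the squared Hilbert norms, and here the step size condition with bound 2
  enters.\<close>

lemma flow_form_pos:
  assumes u: "u1 \<in> S1 \<T>" "u2 \<in> S1 \<T>" and "u1 \<noteq> (\<lambda>x. 0) \<or> u2 \<noteq> (\<lambda>x. 0)"
  shows "flow_form u1 u2 u1 u2 > 0"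
proof -
  let ?N = "(norm (J u1))\<^sup>2 + (norm (J u2))\<^sup>2"
  have "J u1 \<noteq> 0 \<or> J u2 \<noteq> 0" using assms J_eq_0_imp by blast
  then have N: "?N > 0" by (auto simp: sum_power2_gt_zero_iff)
  have "(a12 / 2)\<^sup>2 \<le> a12\<^sup>2" by (simp add: power_divide)
  then have "(a12 / 2)\<^sup>2 \<le> a11 * a22" using a_det by linarith
  from grad_form_nonneg[OF u this]
  have G: "0 \<le> \<tau> * (a11 * g u1 u1 + a22 * g u2 u2 + a12 / 2 * (g u2 u1 + g u1 u2))"
    using \<tau> by (simp add: grad_inner_commute[of _ u2 u1])
  have "2 * \<bar>l u1 u2\<bar> \<le> cH\<^sup>2 * ?N"
    using abs_l_le[OF u] L2_le_J[OF u(1)] L2_le_J[OF u(2)] by (simp add: distrib_left)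
  then have "\<bar>a0\<bar> * \<tau> * (2 * \<bar>l u1 u2\<bar>) \<le> \<bar>a0\<bar> * \<tau> * (cH\<^sup>2 * ?N)"
    using \<tau> by (intro mult_left_mono) auto
  also have "\<dots> = (cH\<^sup>2 * \<bar>a0\<bar> * \<tau>) * ?N" by simp
  also have "\<dots> < 2 * ?N" using step N by (rule mult_strict_right_mono)
  finally have "\<bar>a0\<bar> * \<tau> * \<bar>l u1 u2\<bar> < ?N" by simp
  moreover have "a0 * \<tau> * l u1 u2 \<le> \<bar>a0\<bar> * \<tau> * \<bar>l u1 u2\<bar>"
    using \<tau> abs_ge_self[of "a0 * \<tau> * l u1 u2"] by (simp add: abs_mult)
  ultimately have "a0 * \<tau> * l u1 u2 < ?N" by linarith
  with G show ?thesis
    unfolding flow_form_def by (simp add: L2_inner_commute[of _ u2 u1] flip: power2_norm_eq_inner)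
qed

section \<open>Unique solvability of the coupled problem\<close>

lemma tangent_S1: "\<phi> \<in> tangent_space \<T> m \<Longrightarrow> \<phi> \<in> S1 \<T>"
  by (simp add: tangent_space_def)

lemma tangent_zero: "(\<lambda>x. 0) \<in> tangent_space \<T> m"
  by (simp add: tangent_space_def)

lemma tangent_add:
  "u \<in> tangent_space \<T> m \<Longrightarrow> w \<in> tangent_space \<T> m \<Longrightarrow> (\<lambda>x. u x + w x) \<in> tangent_space \<T> m"
  by (simp add: tangent_space_def inner_add_right)

lemma tangent_scaleR: "u \<in> tangent_space \<T> m \<Longrightarrow> (\<lambda>x. c *\<^sub>R u x) \<in> tangent_space \<T> m"
  by (simp add: tangent_space_def)

abbreviation "solves \<equiv> solves_flow_problem \<Omega> \<T> J a11 a22 a12 a0 \<tau>"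

lemma solves_iff:
  assumes m: "m1 \<in> S1 \<T>" "m2 \<in> S1 \<T>"
  shows "solves (m1, m2) (v1, v2) \<longleftrightarrow> v1 \<in> tangent_space \<T> m1 \<and> v2 \<in> tangent_space \<T> m2 \<and>
    (\<forall>f1\<in>tangent_space \<T> m1. \<forall>f2\<in>tangent_space \<T> m2. flow_form v1 v2 f1 f2 = flow_rhs m1 m2 f1 f2)"
proof (intro iffI conjI ballI)
  fix f1 f2 assume s: "solves (m1, m2) (v1, v2)" and "f1 \<in> tangent_space \<T> m1" "f2 \<in> tangent_space \<T> m2"
  then have "flow_equation \<Omega> J a11 a12 a0 \<tau> m1 m2 v1 v2 f1" "flow_equation \<Omega> J a22 a12 a0 \<tau> m2 m1 v2 v1 f2"
    by (auto simp: solves_flow_problem_def)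
  then show "flow_form v1 v2 f1 f2 = flow_rhs m1 m2 f1 f2"
    by (simp add: flow_equation_def flow_form_def flow_rhs_def algebra_simps flip: grad_inner_def)
next
  assume *: "v1 \<in> tangent_space \<T> m1 \<and> v2 \<in> tangent_space \<T> m2 \<and>
    (\<forall>f1\<in>tangent_space \<T> m1. \<forall>f2\<in>tangent_space \<T> m2. flow_form v1 v2 f1 f2 = flow_rhs m1 m2 f1 f2)"
  then have v: "v1 \<in> S1 \<T>" "v2 \<in> S1 \<T>" using tangent_S1 by auto
  have "flow_equation \<Omega> J a11 a12 a0 \<tau> m1 m2 v1 v2 f1" if "f1 \<in> tangent_space \<T> m1" for f1
  proof -
    have "flow_form v1 v2 f1 (\<lambda>x. 0) = flow_rhs m1 m2 f1 (\<lambda>x. 0)" using * that tangent_zero by blast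
    then show ?thesis using v m
      by (simp add: flow_equation_def flow_form_def flow_rhs_def zero_right algebra_simps flip: grad_inner_def)
  qed
  moreover have "flow_equation \<Omega> J a22 a12 a0 \<tau> m2 m1 v2 v1 f2" if "f2 \<in> tangent_space \<T> m2" for f2
  proof -
    have "flow_form v1 v2 (\<lambda>x. 0) f2 = flow_rhs m1 m2 (\<lambda>x. 0) f2" using * that tangent_zero by blast
    then show ?thesis using v m
      by (simp add: flow_equation_def flow_form_def flow_rhs_def zero_right algebra_simps flip: grad_inner_def)
  qed
  ultimately show "solves (m1, m2) (v1, v2)" using * by (simp add: solves_flow_problem_def)
qed (auto simp: solves_flow_problem_def)

text \<open>A pair of fields is treated as one finite element function with values in the product of
  two copies of \<open>real^3\<close>, so that the representation result for a single function space
  covers the coupled system.\<close>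

lemma solution_exists:
  assumes m: "m1 \<in> S1 \<T>" "m2 \<in> S1 \<T>"
  shows "\<exists>v1 v2. solves (m1, m2) (v1, v2)"
proof -
  let ?p = "\<lambda>w :: real^3 \<Rightarrow> (real^3) \<times> (real^3). \<lambda>x. fst (w x)"
  let ?q = "\<lambda>w :: real^3 \<Rightarrow> (real^3) \<times> (real^3). \<lambda>x. snd (w x)"
  define V where "V = {w \<in> S1 \<T>. ?p w \<in> tangent_space \<T> m1 \<and> ?q w \<in> tangent_space \<T> m2}"
  have pq: "?p w \<in> S1 \<T>" "?q w \<in> S1 \<T>" if "w \<in> V" for w
    using that tangent_S1 by (auto simp: V_def)
  have "\<exists>v\<in>V. \<forall>w\<in>V. flow_form (?p v) (?q v) (?p w) (?q w) = flow_rhs m1 m2 (?p w) (?q w)"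
  proof (rule S1_subspace_represents)
    show "V \<subseteq> S1 \<T>" "(\<lambda>x. 0) \<in> V" by (auto simp: V_def tangent_zero)
    show "(\<lambda>x. u x + w x) \<in> V" if "u \<in> V" "w \<in> V" for u w
      using that by (simp add: V_def tangent_add)
    show "(\<lambda>x. c *\<^sub>R u x) \<in> V" if "u \<in> V" for c u
      using that by (simp add: V_def tangent_scaleR)
    show "flow_form (?p u) (?q u) (?p u) (?q u) > 0" if "u \<in> V" "u \<noteq> (\<lambda>x. 0)" for u
    proof (rule flow_form_pos[OF pq[OF that(1)]])
      show "?p u \<noteq> (\<lambda>x. 0) \<or> ?q u \<noteq> (\<lambda>x. 0)"
        using that(2) by (auto simp: fun_eq_iff prod_eq_iff)
    qed
  qed (simp_all add: flow_form_def flow_rhs_def bilinear pq m inner_add_left inner_add_right algebra_simps)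
  then obtain v where v: "v \<in> V" "\<And>w. w \<in> V \<Longrightarrow> flow_form (?p v) (?q v) (?p w) (?q w) = flow_rhs m1 m2 (?p w) (?q w)"
    by blast
  have "flow_form (?p v) (?q v) f1 f2 = flow_rhs m1 m2 f1 f2"
    if f: "f1 \<in> tangent_space \<T> m1" "f2 \<in> tangent_space \<T> m2" for f1 f2
  proof -
    have "(\<lambda>x. (f1 x, 0) + (0, f2 x)) \<in> S1 \<T>"
      using tangent_S1[OF f(1)] tangent_S1[OF f(2)]
      by (intro S1_add S1_linear_image[where f="\<lambda>y. (y, 0)"] S1_linear_image[where f="\<lambda>y. (0, y)"])
        (auto intro!: linearI)
    then have "(\<lambda>x. (f1 x, f2 x)) \<in> V" using f by (simp add: V_def)
    from v(2)[OF this] show ?thesis by simp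
  qed
  then have "solves (m1, m2) (?p v, ?q v)"
    using v(1) by (simp add: solves_iff[OF m] V_def)
  then show ?thesis by blast
qed

lemma solution_unique:
  assumes m: "m1 \<in> S1 \<T>" "m2 \<in> S1 \<T>"
    and v: "solves (m1, m2) (v1, v2)" and w: "solves (m1, m2) (w1, w2)"
  shows "v1 = w1 \<and> v2 = w2"
proof -
  \<comment> \<open>Scaling by -1 replaces subtraction, so that the rules for sums and multiples
    apply.\<close>
  let ?d1 = "\<lambda>x. v1 x + (-1) *\<^sub>R w1 x" and ?d2 = "\<lambda>x. v2 x + (-1) *\<^sub>R w2 x"
  have vw: "v1 \<in> tangent_space \<T> m1" "w1 \<in> tangent_space \<T> m1" "v2 \<in> tangent_space \<T> m2" "w2 \<in> tangent_space \<T> m2"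
    using v w by (auto simp: solves_flow_problem_def)
  then have S: "v1 \<in> S1 \<T>" "w1 \<in> S1 \<T>" "v2 \<in> S1 \<T>" "w2 \<in> S1 \<T>" using tangent_S1 by auto
  have d: "?d1 \<in> tangent_space \<T> m1" "?d2 \<in> tangent_space \<T> m2"
    using vw by - (intro tangent_add tangent_scaleR; assumption)+
  have dS: "?d1 \<in> S1 \<T>" "?d2 \<in> S1 \<T>" using d tangent_S1 by auto
  have "flow_form ?d1 ?d2 f1 f2 = flow_form v1 v2 f1 f2 - flow_form w1 w2 f1 f2"
    if "f1 \<in> S1 \<T>" "f2 \<in> S1 \<T>" for f1 f2
    unfolding flow_form_def using S S1_scaleR[of w1 "-1"] S1_scaleR[of w2 "-1"] that
    by (simp only: bilinear) (simp add: inner_diff_left algebra_simps)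
  then have "flow_form ?d1 ?d2 ?d1 ?d2 = 0"
    using v w d dS by (simp only: solves_iff[OF m])
  then have "?d1 = (\<lambda>x. 0) \<and> ?d2 = (\<lambda>x. 0)"
    using flow_form_pos[OF dS] by fastforce
  then show ?thesis by (simp add: fun_eq_iff)
qed

lemma ex1_solution:
  assumes "fst m \<in> S1 \<T>" "snd m \<in> S1 \<T>"
  shows "\<exists>!v. solves m v"
proof -
  obtain m1 m2 where m: "m = (m1, m2)" by fastforce
  show ?thesis
    using solution_exists[of m1 m2] solution_unique[of m1 m2] assms unfolding m
    by (metis (no_types, lifting) fst_conv snd_conv surj_pair)
qed

text \<open>The scheme evaluates the coupling terms at the midpoint m + \<tau> v / 2, for which the
  increment of a bilinear expression is exact, and the diagonal gradient terms at the new iterate m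
  + \<tau> v. Only the latter leave a remainder, the term with \<tau>^2 / 2.\<close>

lemma energy_step:
  assumes m: "m1 \<in> S1 \<T>" "m2 \<in> S1 \<T>" and v: "solves (m1, m2) (v1, v2)"
  shows "energy \<Omega> a11 a22 a12 a0 (\<lambda>x. m1 x + \<tau> *\<^sub>R v1 x, \<lambda>x. m2 x + \<tau> *\<^sub>R v2 x) - energy \<Omega> a11 a22 a12 a0 (m1, m2)
    = - \<tau> * ((norm (J v1))\<^sup>2 + (norm (J v2))\<^sup>2) - \<tau>\<^sup>2 / 2 * (a11 * g v1 v1 + a22 * g v2 v2)"
proof -
  have vt: "v1 \<in> tangent_space \<T> m1" "v2 \<in> tangent_space \<T> m2"
    using v by (auto simp: solves_flow_problem_def)
  then have S: "v1 \<in> S1 \<T>" "v2 \<in> S1 \<T>" using tangent_S1 by auto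
  have "flow_form v1 v2 v1 v2 = flow_rhs m1 m2 v1 v2" using v vt by (simp add: solves_iff[OF m])
  then have "\<tau> * flow_form v1 v2 v1 v2 = \<tau> * flow_rhs m1 m2 v1 v2" by simp
  then show ?thesis
    unfolding power2_norm_eq_inner energy_eq flow_form_def flow_rhs_def
    using S m
    by (simp add: bilinear L2_inner_commute[of _ v2 v1] grad_inner_commute[of _ v2 v1]
        L2_inner_commute[of _ m2 v1] grad_inner_commute[of _ m2 v1]
        L2_inner_commute[of _ v1 m1] grad_inner_commute[of _ v1 m1]
        L2_inner_commute[of _ v2 m1] grad_inner_commute[of _ v2 m1]
        L2_inner_commute[of _ v2 m2] grad_inner_commute[of _ v2 m2]
        power2_eq_square algebra_simps)
qed

end

section \<open>Iterates of the flow\<close>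

lemma mult_le_abs_mult: "a * b \<le> \<bar>a\<bar> * \<bar>b\<bar>" for a b :: real
  using abs_ge_self[of "a * b"] by (simp only: abs_mult)

lemma L1_norm_eq: "L1_norm \<Omega> (f :: real^3 \<Rightarrow> real) = (\<integral>x. \<bar>f x\<bar> \<partial>lebesgue_on \<Omega>)"
  by (simp add: L1_norm_def)

lemma H1_norm_sq: "(H1_norm \<Omega> u)\<^sup>2 = L2_inner \<Omega> u u + grad_inner \<Omega> u u"
  by (simp add: H1_norm_def L2_norm_sq grad_inner_def L2_inner_nonneg)

locale coupled_flow_run = coupled_flow +
  fixes m0 :: field_pair
  assumes init: "initial_pair \<T> m0"
begin

abbreviation "m \<equiv> flow_iterate \<Omega> \<T> J a11 a22 a12 a0 \<tau> m0"
abbreviation "v i \<equiv> velocity \<Omega> \<T> J a11 a22 a12 a0 \<tau> (m i)"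
abbreviation "E \<equiv> energy \<Omega> a11 a22 a12 a0"

lemma velocity_solves:
  assumes "fst n \<in> S1 \<T>" "snd n \<in> S1 \<T>"
  shows "solves n (velocity \<Omega> \<T> J a11 a22 a12 a0 \<tau> n)"
  unfolding velocity_def by (rule theI'[OF ex1_solution[OF assms]])

declare flow_iterate.simps(2) [simp del]

lemma m_Suc_pair:
  "m (Suc i) = (\<lambda>x. fst (m i) x + \<tau> *\<^sub>R fst (v i) x, \<lambda>x. snd (m i) x + \<tau> *\<^sub>R snd (v i) x)"
  by (simp add: flow_iterate.simps(2) Let_def)

lemma m_Suc:
  "fst (m (Suc i)) = (\<lambda>x. fst (m i) x + \<tau> *\<^sub>R fst (v i) x)"
  "snd (m (Suc i)) = (\<lambda>x. snd (m i) x + \<tau> *\<^sub>R snd (v i) x)"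
  unfolding m_Suc_pair by simp_all

lemma solves_tangent:
  "solves n w \<Longrightarrow> fst w \<in> tangent_space \<T> (fst n)" "solves n w \<Longrightarrow> snd w \<in> tangent_space \<T> (snd n)"
  by (auto simp: solves_flow_problem_def split: prod.splits)

lemma m_S1: "fst (m i) \<in> S1 \<T> \<and> snd (m i) \<in> S1 \<T>"
proof (induction i)
  case 0
  then show ?case using init by (auto simp: initial_pair_def)
next
  case (Suc i)
  have "solves (m i) (v i)" using Suc velocity_solves by blast
  then have "fst (v i) \<in> S1 \<T>" "snd (v i) \<in> S1 \<T>" using solves_tangent tangent_S1 by blast+
  then show ?case unfolding m_Suc using Suc by simp
qed

lemma v_solves: "solves (m i) (v i)"
  using m_S1 velocity_solves by blast

lemmas v_tangent = solves_tangent[OF v_solves]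
lemmas v_S1 = tangent_S1[OF v_tangent(1)] tangent_S1[OF v_tangent(2)]

lemma energy_decay:
  "E (m (Suc i)) - E (m i) = - \<tau> * ((norm (J (fst (v i))))\<^sup>2 + (norm (J (snd (v i))))\<^sup>2)
    - \<tau>\<^sup>2 / 2 * (a11 * g (fst (v i)) (fst (v i)) + a22 * g (snd (v i)) (snd (v i)))"
proof -
  have "solves (fst (m i), snd (m i)) (fst (v i), snd (v i))" using v_solves[of i] by simp
  from energy_step[OF conjunct1[OF m_S1] conjunct2[OF m_S1] this]
  show ?thesis unfolding m_Suc_pair prod.collapse .
qed

text \<open>Tangency at a vertex turns each update into a Pythagorean sum. As nothing is projected
  back to the sphere, lengths never drop below 1, which later gives the sign of the constraint
  error.\<close>

lemma nodal_growth:
  assumes "\<And>z. z \<in> vertices \<T> \<Longrightarrow> norm (n 0 z) = 1"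
    and "\<And>i. w i \<in> tangent_space \<T> (n i)" "\<And>i. n (Suc i) = (\<lambda>x. n i x + \<tau> *\<^sub>R w i x)"
    and "z \<in> vertices \<T>"
  shows "(norm (n N z))\<^sup>2 = 1 + \<tau>\<^sup>2 * (\<Sum>i<N. (norm (w i z))\<^sup>2)"
proof (induction N)
  case 0
  then show ?case using assms by simp
next
  case (Suc N)
  have "n N z \<bullet> w N z = 0" using assms(2)[of N] assms(4) by (simp add: tangent_space_def)
  then have "(norm (n (Suc N) z))\<^sup>2 = (norm (n N z))\<^sup>2 + \<tau>\<^sup>2 * (norm (w N z))\<^sup>2"
    unfolding assms(3) power2_norm_eq_inner
    by (simp add: inner_add_left inner_add_right inner_commute power2_eq_square)
  with Suc show ?case by (simp add: algebra_simps)
qed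

lemma nodal_max_sum_bound:
  assumes "\<And>i. w i \<in> S1 \<T>"
  shows "(\<Sum>K\<in>\<T>. (\<Sum>i<N. nodal_max (w i) K) * measure lebesgue (interior K)) \<le> 256 * (\<Sum>i<N. l (w i) (w i))"
proof -
  have "(\<Sum>K\<in>\<T>. (\<Sum>i<N. nodal_max (w i) K) * measure lebesgue (interior K))
      = (\<Sum>i<N. \<Sum>K\<in>\<T>. nodal_max (w i) K * measure lebesgue (interior K))"
    by (subst sum.swap) (simp add: sum_distrib_right)
  also have "\<dots> \<le> (\<Sum>i<N. 256 * l (w i) (w i))"
    using assms by (intro sum_mono nodal_max_sum_le)
  finally show ?thesis by (simp add: sum_distrib_left)
qed

text \<open>Stated for an abstract sequence so that it serves both components. Both bounds rest on
  \<open>c K\<close>, which dominates the excess of |n|^2 over 1 at every corner of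
  \<open>K\<close>, hence inside \<open>K\<close> as well.\<close>

lemma L2_and_constraint_growth:
  assumes n0: "\<And>z. z \<in> vertices \<T> \<Longrightarrow> norm (n 0 z) = 1"
    and w: "\<And>i. w i \<in> tangent_space \<T> (n i)" and suc: "\<And>i. n (Suc i) = (\<lambda>x. n i x + \<tau> *\<^sub>R w i x)"
    and n: "\<And>i. n i \<in> S1 \<T>"
  shows "l (n N) (n N) \<le> 256 * (l (n 0) (n 0) + \<tau>\<^sup>2 * (\<Sum>i<N. l (w i) (w i)))"
    and "L1_norm \<Omega> (\<lambda>x. nodal_interp \<T> (\<lambda>y. (norm (n N y))\<^sup>2) x - 1) \<le> 256 * \<tau>\<^sup>2 * (\<Sum>i<N. l (w i) (w i))"
proof -
  have wS: "w i \<in> S1 \<T>" for i using w tangent_S1 by blast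
  define c where "c K = \<tau>\<^sup>2 * (\<Sum>i<N. nodal_max (w i) K)" for K
  have c0: "0 \<le> c K" if "K \<in> \<T>" for K
    unfolding c_def using that by (intro mult_nonneg_nonneg sum_nonneg nodal_max_nonneg) auto
  have vert: "z \<in> vertices \<T>" if "K \<in> \<T>" "z \<in> corners K" for K z
    using that by (auto simp: vertices_eq)
  have at_corner: "1 \<le> (norm (n N z))\<^sup>2 \<and> (norm (n N z))\<^sup>2 \<le> 1 + c K" if "K \<in> \<T>" "z \<in> corners K" for K z
  proof -
    have "(\<Sum>i<N. (norm (w i z))\<^sup>2) \<le> (\<Sum>i<N. nodal_max (w i) K)"
      using that by (intro sum_mono nodal_max_ge)
    then have "\<tau>\<^sup>2 * (\<Sum>i<N. (norm (w i z))\<^sup>2) \<le> c K" unfolding c_def by (intro mult_left_mono) auto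
    moreover have "0 \<le> \<tau>\<^sup>2 * (\<Sum>i<N. (norm (w i z))\<^sup>2)" by (intro mult_nonneg_nonneg sum_nonneg) auto
    ultimately show ?thesis using nodal_growth[where n=n and w=w and N=N, OF n0 w suc vert[OF that]] by simp
  qed
  have sum_c: "(\<Sum>K\<in>\<T>. c K * measure lebesgue (interior K)) \<le> 256 * \<tau>\<^sup>2 * (\<Sum>i<N. l (w i) (w i))"
  proof -
    have "(\<Sum>K\<in>\<T>. c K * measure lebesgue (interior K))
        = \<tau>\<^sup>2 * (\<Sum>K\<in>\<T>. (\<Sum>i<N. nodal_max (w i) K) * measure lebesgue (interior K))"
      unfolding c_def mult.assoc by (rule sum_distrib_left[symmetric])
    also have "\<dots> \<le> \<tau>\<^sup>2 * (256 * (\<Sum>i<N. l (w i) (w i)))"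
      by (intro mult_left_mono nodal_max_sum_bound wS) simp
    finally show ?thesis by simp
  qed
  have "nodal_max (n 0) K = 1" if "K \<in> \<T>" for K
    using nodal_max_attained[OF that, of "n 0"] n0 vert[OF that] by (metis power_one)
  \<comment> \<open>The initial field has length 1 at all vertices, so the inequality bounds the
    total volume by the initial mass, and the estimate refers to the data instead of the size of
    \<open>\<Omega>\<close>.\<close>
  then have "(\<Sum>K\<in>\<T>. measure lebesgue (interior K)) \<le> 256 * l (n 0) (n 0)"
    using nodal_max_sum_le[OF n[of 0]] by simp
  moreover have "l (n N) (n N) \<le> (\<Sum>K\<in>\<T>. (1 + c K) * measure lebesgue (interior K))"
    unfolding L2_inner_def
  proof (rule integral_le_elementwise)
    fix K x assume K: "K \<in> \<T>" "x \<in> K"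
    have "(norm (n N x))\<^sup>2 \<le> nodal_max (n N) K" using S1_norm_sq_le_nodal_max n K by blast
    also have "\<dots> \<le> 1 + c K"
      by (rule nodal_max_attained[OF K(1), of "n N"]) (use at_corner[OF K(1)] in auto)
    finally show "n N x \<bullet> n N x \<le> 1 + c K" by (simp add: power2_norm_eq_inner)
  qed (use c0 in fastforce)
  ultimately show "l (n N) (n N) \<le> 256 * (l (n 0) (n 0) + \<tau>\<^sup>2 * (\<Sum>i<N. l (w i) (w i)))"
    using sum_c by (simp add: distrib_right sum.distrib)
  have "L1_norm \<Omega> (\<lambda>x. nodal_interp \<T> (\<lambda>y. (norm (n N y))\<^sup>2) x - 1)
      \<le> (\<Sum>K\<in>\<T>. c K * measure lebesgue (interior K))"
    unfolding L1_norm_eq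
  proof (rule integral_le_elementwise[OF c0])
    let ?I = "nodal_interp \<T> (\<lambda>y. (norm (n N y))\<^sup>2)"
    fix K x assume K: "K \<in> \<T>" "x \<in> K"
    obtain b where b: "\<And>z. z \<in> corners K \<Longrightarrow> 0 \<le> b z" "sum b (corners K) = 1"
      "x = (\<Sum>z\<in>corners K. b z *\<^sub>R z)" using barycentric[OF K] by blast
    have "?I x = (\<Sum>z\<in>corners K. b z *\<^sub>R ?I z)"
      by (rule S1_barycentric[OF nodal_interp_works(1) K b(2,3)])
    also have "\<dots> = (\<Sum>z\<in>corners K. b z * (norm (n N z))\<^sup>2)"
      using vert[OF K(1)] by (intro sum.cong) (auto simp: nodal_interp_works(2))
    finally have I: "?I x = (\<Sum>z\<in>corners K. b z * (norm (n N z))\<^sup>2)" .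
    \<comment> \<open>A convex combination of values between 1 and \<open>1 + c K\<close> lies
      between these bounds too.\<close>
    have "(\<Sum>z\<in>corners K. b z * (norm (n N z))\<^sup>2) \<le> (\<Sum>z\<in>corners K. b z * (1 + c K))"
      using b(1) at_corner[OF K(1)] by (intro sum_mono mult_left_mono) auto
    moreover have "(\<Sum>z\<in>corners K. b z * 1) \<le> (\<Sum>z\<in>corners K. b z * (norm (n N z))\<^sup>2)"
      using b(1) at_corner[OF K(1)] by (intro sum_mono mult_left_mono) auto
    ultimately show "\<bar>?I x - 1\<bar> \<le> c K"
      unfolding I using b(2) by (simp flip: sum_distrib_right)
  qed
  with sum_c show "L1_norm \<Omega> (\<lambda>x. nodal_interp \<T> (\<lambda>y. (norm (n N y))\<^sup>2) x - 1) \<le> 256 * \<tau>\<^sup>2 * (\<Sum>i<N. l (w i) (w i))"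
    by linarith
qed

section \<open>Energy balance over many steps\<close>

abbreviation "speed i \<equiv> (norm (J (fst (v i))))\<^sup>2 + (norm (J (snd (v i))))\<^sup>2"
abbreviation "mass0 \<equiv> l (fst m0) (fst m0) + l (snd m0) (snd m0)"

lemma L2_growth_components:
  "l (fst (m N)) (fst (m N)) \<le> 256 * (l (fst m0) (fst m0) + \<tau>\<^sup>2 * (\<Sum>i<N. l (fst (v i)) (fst (v i))))"
  "l (snd (m N)) (snd (m N)) \<le> 256 * (l (snd m0) (snd m0) + \<tau>\<^sup>2 * (\<Sum>i<N. l (snd (v i)) (snd (v i))))"
  "L1_norm \<Omega> (\<lambda>x. nodal_interp \<T> (\<lambda>y. (norm (fst (m N) y))\<^sup>2) x - 1) \<le> 256 * \<tau>\<^sup>2 * (\<Sum>i<N. l (fst (v i)) (fst (v i)))"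
  "L1_norm \<Omega> (\<lambda>x. nodal_interp \<T> (\<lambda>y. (norm (snd (m N) y))\<^sup>2) x - 1) \<le> 256 * \<tau>\<^sup>2 * (\<Sum>i<N. l (snd (v i)) (snd (v i)))"
proof -
  have init': "norm (fst (m 0) z) = 1" "norm (snd (m 0) z) = 1" if "z \<in> vertices \<T>" for z
    using init that by (auto simp: initial_pair_def)
  note * = L2_and_constraint_growth[of "\<lambda>i. fst (m i)" "\<lambda>i. fst (v i)", OF init'(1) v_tangent(1) m_Suc(1), of N]
    L2_and_constraint_growth[of "\<lambda>i. snd (m i)" "\<lambda>i. snd (v i)", OF init'(2) v_tangent(2) m_Suc(2), of N]
  show "l (fst (m N)) (fst (m N)) \<le> 256 * (l (fst m0) (fst m0) + \<tau>\<^sup>2 * (\<Sum>i<N. l (fst (v i)) (fst (v i))))"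
    "L1_norm \<Omega> (\<lambda>x. nodal_interp \<T> (\<lambda>y. (norm (fst (m N) y))\<^sup>2) x - 1) \<le> 256 * \<tau>\<^sup>2 * (\<Sum>i<N. l (fst (v i)) (fst (v i)))"
    using *(1,2) m_S1 by simp_all
  show "l (snd (m N)) (snd (m N)) \<le> 256 * (l (snd m0) (snd m0) + \<tau>\<^sup>2 * (\<Sum>i<N. l (snd (v i)) (snd (v i))))"
    "L1_norm \<Omega> (\<lambda>x. nodal_interp \<T> (\<lambda>y. (norm (snd (m N) y))\<^sup>2) x - 1) \<le> 256 * \<tau>\<^sup>2 * (\<Sum>i<N. l (snd (v i)) (snd (v i)))"
    using *(3,4) m_S1 by simp_all
qed

lemma sum_l_le_speed:
  "(\<Sum>i<N. l (fst (v i)) (fst (v i))) + (\<Sum>i<N. l (snd (v i)) (snd (v i))) \<le> cH\<^sup>2 * (\<Sum>i<N. speed i)"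
proof -
  have "(\<Sum>i<N. l (fst (v i)) (fst (v i)) + l (snd (v i)) (snd (v i))) \<le> (\<Sum>i<N. cH\<^sup>2 * speed i)"
    using L2_le_J v_S1 by (intro sum_mono) (simp add: distrib_left add_mono)
  then show ?thesis by (simp only: sum.distrib[symmetric] sum_distrib_left)
qed

lemma grad_part_nonneg: "0 \<le> a11 * g u u + a22 * g w w"
  using a_pos grad_inner_nonneg by (intro add_nonneg_nonneg mult_nonneg_nonneg) auto

text \<open>Telescoping, with the gradient part of the dissipation dropped; that part returns in the
  proof of termination.\<close>

lemma speed_sum_le_energy_drop: "\<tau> * (\<Sum>i<N. speed i) \<le> E m0 - E (m N)"
proof (induction N)
  case (Suc N)
  have "0 \<le> \<tau>\<^sup>2 / 2 * (a11 * g (fst (v N)) (fst (v N)) + a22 * g (snd (v N)) (snd (v N)))"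
    by (intro mult_nonneg_nonneg grad_part_nonneg) auto
  then have "\<tau> * speed N \<le> E (m N) - E (m (Suc N))" using energy_decay[of N] by linarith
  with Suc show ?case by (simp only: sum.lessThan_Suc distrib_left)
qed simp

lemma energy_antimono: "E (m (Suc i)) \<le> E (m i)"
proof -
  have "0 \<le> \<tau>\<^sup>2 / 2 * (a11 * g (fst (v i)) (fst (v i)) + a22 * g (snd (v i)) (snd (v i)))"
    by (intro mult_nonneg_nonneg grad_part_nonneg) auto
  moreover have "0 \<le> \<tau> * speed i" using \<tau> by simp
  ultimately show ?thesis using energy_decay[of i] by linarith
qed

text \<open>The determinant condition makes the gradient part nonnegative, so only the
  \<open>a0\<close> coupling can push the energy below zero, and Young's inequality measures it by
  the masses.\<close>

lemma energy_lower: "- \<bar>a0\<bar> / 2 * (l (fst (m N)) (fst (m N)) + l (snd (m N)) (snd (m N))) \<le> E (m N)"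
proof -
  have S: "fst (m N) \<in> S1 \<T>" "snd (m N) \<in> S1 \<T>" using m_S1 by auto
  have "E (m N) = E (fst (m N), snd (m N))" by simp
  moreover have "0 \<le> a11 * g (fst (m N)) (fst (m N)) + a22 * g (snd (m N)) (snd (m N))
      + 2 * a12 * g (fst (m N)) (snd (m N))"
    using S a_det by (intro grad_form_nonneg) auto
  moreover have "a0 * l (fst (m N)) (snd (m N))
      \<le> \<bar>a0\<bar> * ((l (fst (m N)) (fst (m N)) + l (snd (m N)) (snd (m N))) / 2)"
  proof -
    have "a0 * l (fst (m N)) (snd (m N)) \<le> \<bar>a0\<bar> * \<bar>l (fst (m N)) (snd (m N))\<bar>"
      by (rule mult_le_abs_mult)
    also have "\<dots> \<le> \<bar>a0\<bar> * ((l (fst (m N)) (fst (m N)) + l (snd (m N)) (snd (m N))) / 2)"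
      using abs_l_le[OF S] by (intro mult_left_mono) auto
    finally show ?thesis .
  qed
  ultimately show ?thesis unfolding energy_eq by (simp add: algebra_simps)
qed

text \<open>Write D for the drop. The lower bound for the energy and the growth of the masses give D
  \<le> E m0 + 128 |a0| mass0 + \<theta> D / 2 with \<theta> = 256 cH^2 |a0| \<tau> \<le> 1, so at
  least half of D remains on the left. Here 128 is 256 times the factor 1/2 of the lower
  bound.\<close>

lemma energy_drop_le:
  assumes small: "256 * cH\<^sup>2 * \<bar>a0\<bar> * \<tau> \<le> 1"
  shows "E m0 - E (m N) \<le> 2 * (E m0 + 128 * \<bar>a0\<bar> * mass0)"
proof -
  let ?D = "E m0 - E (m N)" and ?X = "\<Sum>i<N. speed i"
  have D: "\<tau> * ?X \<le> ?D" by (rule speed_sum_le_energy_drop)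
  have "l (fst (m N)) (fst (m N)) + l (snd (m N)) (snd (m N))
      \<le> 256 * (mass0 + \<tau>\<^sup>2 * ((\<Sum>i<N. l (fst (v i)) (fst (v i))) + (\<Sum>i<N. l (snd (v i)) (snd (v i)))))"
    using L2_growth_components(1,2)[of N] by (simp add: distrib_left)
  also have "\<dots> \<le> 256 * (mass0 + \<tau>\<^sup>2 * (cH\<^sup>2 * ?X))"
    using sum_l_le_speed[of N] by (intro mult_left_mono add_left_mono) auto
  finally have "\<bar>a0\<bar> / 2 * (l (fst (m N)) (fst (m N)) + l (snd (m N)) (snd (m N)))
      \<le> \<bar>a0\<bar> / 2 * (256 * (mass0 + \<tau>\<^sup>2 * (cH\<^sup>2 * ?X)))"
    by (intro mult_left_mono) auto
  with energy_lower[of N] have "- (128 * \<bar>a0\<bar> * mass0) - (256 * cH\<^sup>2 * \<bar>a0\<bar> * \<tau>) * (\<tau> * ?X) / 2 \<le> E (m N)"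
    by (simp add: power2_eq_square algebra_simps)
  moreover have "(256 * cH\<^sup>2 * \<bar>a0\<bar> * \<tau>) * (\<tau> * ?X) \<le> 1 * (\<tau> * ?X)"
    using small \<tau> by (intro mult_right_mono mult_nonneg_nonneg sum_nonneg) auto
  ultimately show ?thesis using D by argo
qed

text \<open>Of the 129, 128 come from the mass term on the left; one more pays for the
  \<open>a0\<close> coupling inside \<open>E m0\<close>. All coefficients are merged into one factor
  so that masses and gradients combine to H1 norms.\<close>

lemma energy_upper:
  "E m0 + 128 * \<bar>a0\<bar> * mass0 \<le>
    (a11 + a22 + \<bar>a12\<bar> + 129 * \<bar>a0\<bar>) * ((H1_norm \<Omega> (fst m0))\<^sup>2 + (H1_norm \<Omega> (snd m0))\<^sup>2)"
proof -
  have S: "fst m0 \<in> S1 \<T>" "snd m0 \<in> S1 \<T>" using m_S1[of 0] by auto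
  let ?g1 = "g (fst m0) (fst m0)" and ?g2 = "g (snd m0) (snd m0)"
  have g: "0 \<le> ?g1" "0 \<le> ?g2" by (auto simp: grad_inner_nonneg)
  have l: "0 \<le> mass0" using L2_inner_nonneg by (intro add_nonneg_nonneg)
  have "a12 * g (fst m0) (snd m0) \<le> \<bar>a12\<bar> * \<bar>g (fst m0) (snd m0)\<bar>" by (rule mult_le_abs_mult)
  also have "\<dots> \<le> \<bar>a12\<bar> * ((?g1 + ?g2) / 2)" using abs_g_le[OF S] by (intro mult_left_mono) auto
  also have "\<dots> \<le> \<bar>a12\<bar> * (?g1 + ?g2)" using g by (intro mult_left_mono) auto
  finally have 1: "a12 * g (fst m0) (snd m0) \<le> \<bar>a12\<bar> * (?g1 + ?g2)" .
  have "- a0 * l (fst m0) (snd m0) \<le> \<bar>a0\<bar> * \<bar>l (fst m0) (snd m0)\<bar>"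
    using mult_le_abs_mult[of "- a0" "l (fst m0) (snd m0)"] by (simp only: abs_minus_cancel)
  also have "\<dots> \<le> \<bar>a0\<bar> * (mass0 / 2)" using abs_l_le[OF S] by (intro mult_left_mono) auto
  also have "\<dots> \<le> \<bar>a0\<bar> * mass0" using l by (intro mult_left_mono) auto
  finally have 2: "- a0 * l (fst m0) (snd m0) \<le> \<bar>a0\<bar> * mass0" .
  have 3: "1 / 2 * (a11 * ?g1 + a22 * ?g2) \<le> (a11 + a22) * (?g1 + ?g2)"
    using mult_nonneg_nonneg[OF less_imp_le[OF a_pos(1)] g(1)] mult_nonneg_nonneg[OF less_imp_le[OF a_pos(1)] g(2)]
      mult_nonneg_nonneg[OF less_imp_le[OF a_pos(2)] g(1)] mult_nonneg_nonneg[OF less_imp_le[OF a_pos(2)] g(2)]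
    by (simp add: distrib_left distrib_right)
  have "E m0 + 128 * \<bar>a0\<bar> * mass0 = E (fst m0, snd m0) + 128 * \<bar>a0\<bar> * mass0" by simp
  also have "\<dots> \<le> (a11 + a22 + \<bar>a12\<bar>) * (?g1 + ?g2) + 129 * \<bar>a0\<bar> * mass0"
  proof -
    have "(a11 + a22 + \<bar>a12\<bar>) * (?g1 + ?g2) = (a11 + a22) * (?g1 + ?g2) + \<bar>a12\<bar> * (?g1 + ?g2)"
      by (rule distrib_right)
    moreover have "129 * \<bar>a0\<bar> * mass0 = 128 * \<bar>a0\<bar> * mass0 + \<bar>a0\<bar> * mass0" by simp
    moreover have "- a0 * l (fst m0) (snd m0) = - (a0 * l (fst m0) (snd m0))" by simp
    ultimately show ?thesis unfolding energy_eq using 1 2 3 by linarith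
  qed
  also have "\<dots> \<le> (a11 + a22 + \<bar>a12\<bar> + 129 * \<bar>a0\<bar>) * (?g1 + ?g2) + (a11 + a22 + \<bar>a12\<bar> + 129 * \<bar>a0\<bar>) * mass0"
  proof (intro add_mono)
    show "(a11 + a22 + \<bar>a12\<bar>) * (?g1 + ?g2) \<le> (a11 + a22 + \<bar>a12\<bar> + 129 * \<bar>a0\<bar>) * (?g1 + ?g2)"
      using g by (intro mult_right_mono) auto
    show "129 * \<bar>a0\<bar> * mass0 \<le> (a11 + a22 + \<bar>a12\<bar> + 129 * \<bar>a0\<bar>) * mass0"
      using a_pos l by (intro mult_right_mono) auto
  qed
  also have "\<dots> = (a11 + a22 + \<bar>a12\<bar> + 129 * \<bar>a0\<bar>) * ((H1_norm \<Omega> (fst m0))\<^sup>2 + (H1_norm \<Omega> (snd m0))\<^sup>2)"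
    by (simp add: H1_norm_sq distrib_left)
  finally show ?thesis .
qed

text \<open>Without termination every step would lower the energy by at least the fixed amount
  \<open>\<tau> * (k * \<eta>)\<close>, against the bound on the total drop, which does not depend
  on the number of steps.\<close>

lemma stops_eventually:
  assumes small: "256 * cH\<^sup>2 * \<bar>a0\<bar> * \<tau> \<le> 1" and "\<epsilon> > 0"
  shows "\<exists>i. stopping_criterion \<Omega> J \<tau> \<epsilon> (v i)"
proof (rule ccontr)
  assume never: "\<nexists>i. stopping_criterion \<Omega> J \<tau> \<epsilon> (v i)"
  define \<eta> where "\<eta> = \<epsilon>\<^sup>2 * measure lebesgue \<Omega>"
  have \<eta>: "\<eta> > 0" unfolding \<eta>_def using \<open>\<epsilon> > 0\<close> measure_\<Omega>_pos by simp
  \<comment> \<open>Up to a common factor \<tau>, the energy identity weighs the Hilbert norms by 1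
    and the gradients by \<tau> times half of \<open>a11\<close> or \<open>a22\<close>; the stopping
    criterion weighs them by 1 and \<tau>. \<open>k\<close> is the smallest ratio of these
    weights.\<close>
  define k where "k = min 1 (min (a11 / 2) (a22 / 2))"
  have k: "0 < k" "k \<le> 1" "k \<le> a11 / 2" "k \<le> a22 / 2" using a_pos by (auto simp: k_def)
  have drop: "\<tau> * (k * \<eta>) \<le> E (m i) - E (m (Suc i))" for i
  proof -
    let ?j1 = "(norm (J (fst (v i))))\<^sup>2" and ?j2 = "(norm (J (snd (v i))))\<^sup>2"
    let ?g1 = "g (fst (v i)) (fst (v i))" and ?g2 = "g (snd (v i)) (snd (v i))"
    have g: "0 \<le> ?g1" "0 \<le> ?g2" by (auto simp: grad_inner_nonneg)
    have "\<eta> < max (?j1 + \<tau> * ?g1) (?j2 + \<tau> * ?g2)"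
    proof -
      have "\<not> stopping_criterion \<Omega> J \<tau> \<epsilon> (v i)" using never by blast
      then show ?thesis
        by (simp add: stopping_criterion_def \<eta>_def not_le case_prod_beta L2_norm_sq grad_inner_def less_max_iff_disj)
    qed
    also have "\<dots> \<le> (?j1 + ?j2) + \<tau> * (?g1 + ?g2)"
      using g \<tau> by (simp add: distrib_left)
    finally have "k * \<eta> \<le> k * (?j1 + ?j2) + \<tau> * (k * ?g1 + k * ?g2)"
      using mult_left_mono[of \<eta> "(?j1 + ?j2) + \<tau> * (?g1 + ?g2)" k] k(1) by (simp add: algebra_simps)
    also have "\<dots> \<le> 1 * (?j1 + ?j2) + \<tau> * (a11 / 2 * ?g1 + a22 / 2 * ?g2)"
      using k g \<tau> by (intro add_mono mult_right_mono mult_left_mono) auto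
    finally have "\<tau> * (k * \<eta>) \<le> \<tau> * (1 * (?j1 + ?j2) + \<tau> * (a11 / 2 * ?g1 + a22 / 2 * ?g2))"
      using \<tau> by (intro mult_left_mono) auto
    also have "\<dots> = E (m i) - E (m (Suc i))"
      using energy_decay[of i] by (simp add: power2_eq_square algebra_simps)
    finally show ?thesis .
  qed
  have "real N * (\<tau> * (k * \<eta>)) \<le> E m0 - E (m N)" for N
  proof (induction N)
    case (Suc N)
    with drop[of N] show ?case by (simp add: of_nat_Suc distrib_right)
  qed simp
  then have bound: "real N * (\<tau> * (k * \<eta>)) \<le> 2 * (E m0 + 128 * \<bar>a0\<bar> * mass0)" for N
    using energy_drop_le[OF small] order_trans by blast
  have "\<tau> * (k * \<eta>) > 0" using \<tau> k \<eta> by simp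
  then obtain N where "2 * (E m0 + 128 * \<bar>a0\<bar> * mass0) < real N * (\<tau> * (k * \<eta>))"
    using reals_Archimedean3 by blast
  with bound[of N] show False by linarith
qed

text \<open>Of the two factors \<tau> in the growth estimate, one combines with the sum of speeds to
  an energy drop and the other survives as the rate; 512 is 256 times the factor 2 from the
  absorption. The bound holds at every iteration, so nothing about the stopping index has to be
  known.\<close>

lemma constraint_violation:
  assumes small: "256 * cH\<^sup>2 * \<bar>a0\<bar> * \<tau> \<le> 1" and "mh \<in> {fst (m N), snd (m N)}"
  shows "L1_norm \<Omega> (\<lambda>x. nodal_interp \<T> (\<lambda>y. (norm (mh y))\<^sup>2) x - 1) \<le>
    512 * cH\<^sup>2 * (a11 + a22 + \<bar>a12\<bar> + 129 * \<bar>a0\<bar>) * \<tau> *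
      (1 + ((H1_norm \<Omega> (fst m0))\<^sup>2 + (H1_norm \<Omega> (snd m0))\<^sup>2))"
proof -
  let ?s1 = "\<Sum>i<N. l (fst (v i)) (fst (v i))" and ?s2 = "\<Sum>i<N. l (snd (v i)) (snd (v i))"
  let ?A = "a11 + a22 + \<bar>a12\<bar> + 129 * \<bar>a0\<bar>"
  let ?H = "(H1_norm \<Omega> (fst m0))\<^sup>2 + (H1_norm \<Omega> (snd m0))\<^sup>2"
  have s: "0 \<le> ?s1" "0 \<le> ?s2" by (auto intro!: sum_nonneg L2_inner_nonneg)
  have "L1_norm \<Omega> (\<lambda>x. nodal_interp \<T> (\<lambda>y. (norm (mh y))\<^sup>2) x - 1) \<le> 256 * \<tau>\<^sup>2 * max ?s1 ?s2"
  proof -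
    have "256 * \<tau>\<^sup>2 * ?s1 \<le> 256 * \<tau>\<^sup>2 * max ?s1 ?s2" "256 * \<tau>\<^sup>2 * ?s2 \<le> 256 * \<tau>\<^sup>2 * max ?s1 ?s2"
      by (intro mult_left_mono; simp)+
    then show ?thesis
      using assms(2) L2_growth_components(3,4)[of N] by (elim insertE emptyE) (blast intro: order_trans)+
  qed
  also have "\<dots> \<le> 256 * \<tau>\<^sup>2 * (cH\<^sup>2 * (\<Sum>i<N. speed i))"
    using s sum_l_le_speed[of N] by (intro mult_left_mono) auto
  also have "\<dots> = 256 * cH\<^sup>2 * \<tau> * (\<tau> * (\<Sum>i<N. speed i))" by (simp add: power2_eq_square)
  also have "\<dots> \<le> 256 * cH\<^sup>2 * \<tau> * (2 * (?A * (1 + ?H)))"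
  proof (intro mult_left_mono)
    have "\<tau> * (\<Sum>i<N. speed i) \<le> 2 * (E m0 + 128 * \<bar>a0\<bar> * mass0)"
      using speed_sum_le_energy_drop energy_drop_le[OF small] order_trans by blast
    also have "\<dots> \<le> 2 * (?A * ?H)" using energy_upper by simp
    also have "\<dots> \<le> 2 * (?A * (1 + ?H))" using a_pos by (intro mult_left_mono) auto
    finally show "\<tau> * (\<Sum>i<N. speed i) \<le> 2 * (?A * (1 + ?H))" .
  qed (use \<tau> in auto)
  also have "\<dots> = 512 * cH\<^sup>2 * ?A * \<tau> * (1 + ?H)" by simp
  finally show ?thesis .
qed

end

theorem proposition4p6:
  fixes \<kappa> cH :: real
  assumes "cH \<ge> 1"
  shows "\<exists>cT>0. \<forall>a11 a22 a12 a0 :: real. a11 + a22 > 0 \<and> a11 * a22 > a12\<^sup>2 \<longrightarrow>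
    (\<exists>C>0. \<forall>\<Omega> I \<T> (J :: (real^3 \<Rightarrow> real^3) \<Rightarrow> 'h::{real_inner,complete_space}) h \<tau> \<epsilon> m0.
      lipschitz_polyhedral_domain \<Omega> \<and> shape_regular_family \<Omega> \<kappa> I \<T> \<and> h \<in> I \<and>
      hilbert_embedding \<Omega> cH J \<and> \<tau> > 0 \<and> \<epsilon> > 0 \<and> initial_pair (\<T> h) m0 \<and>
      cH\<^sup>2 * \<bar>a0\<bar> * \<tau> < 2 \<longrightarrow>
      (let m = flow_iterate \<Omega> (\<T> h) J a11 a22 a12 a0 \<tau> m0;
           v = (\<lambda>i. velocity \<Omega> (\<T> h) J a11 a22 a12 a0 \<tau> (m i));
           E = energy \<Omega> a11 a22 a12 a0;
           stops = (\<lambda>i. stopping_criterion \<Omega> J \<tau> \<epsilon> (v i))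
       in
         \<comment> \<open>(i)\<close>
         (\<forall>i. \<exists>!w. solves_flow_problem \<Omega> (\<T> h) J a11 a22 a12 a0 \<tau> (m i) w) \<and>
         \<comment> \<open>(ii)\<close>
         (cH * cT * \<bar>a0\<bar> * \<tau> < 1 \<longrightarrow> (\<exists>i. stops i)) \<and>
         \<comment> \<open>(iii)\<close>
         (\<forall>i. E (m (Suc i)) - E (m i) =
            - \<tau> * ((norm (J (fst (v i))))\<^sup>2 + (norm (J (snd (v i))))\<^sup>2)
            - \<tau>\<^sup>2 / 2 * (a11 * (L2_norm \<Omega> (grad \<Omega> (fst (v i))))\<^sup>2
                        + a22 * (L2_norm \<Omega> (grad \<Omega> (snd (v i))))\<^sup>2)) \<and>
         (\<forall>i. E (m (Suc i)) \<le> E (m i)) \<and>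
         \<comment> \<open>(iv)\<close>
         (cH * cT * \<bar>a0\<bar> * \<tau> < 1 \<longrightarrow>
           (let output = m (LEAST i. stops i) in
            \<forall>mh\<in>{fst output, snd output}.
              L1_norm \<Omega> (\<lambda>x. nodal_interp (\<T> h) (\<lambda>y. (norm (mh y))\<^sup>2) x - 1)
                \<le> C * \<tau> * (1 + ((H1_norm \<Omega> (fst m0))\<^sup>2 + (H1_norm \<Omega> (snd m0))\<^sup>2))))))"
proof (rule exI[of _ "256 * cH"], intro conjI allI impI, goal_cases)
  case 1
  show ?case using assms by simp
next
  case (2 a11 a22 a12 a0)
  note a = this
  let ?C = "512 * cH\<^sup>2 * (a11 + a22 + \<bar>a12\<bar> + 129 * \<bar>a0\<bar>)"
  show ?case
  proof (rule exI[of _ ?C], intro conjI allI impI, goal_cases)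
    case 1
    have "0 < a11 + a22 + \<bar>a12\<bar> + 129 * \<bar>a0\<bar>" using a by linarith
    then show ?case using assms by simp
  next
    case (2 \<Omega> I \<T> J h \<tau> \<epsilon> m0)
    note hyps = this
    interpret coupled_flow_run \<Omega> "\<T> h" J cH a11 a22 a12 a0 \<tau> m0
      using 2 a assms by unfold_locales (auto simp: shape_regular_family_def)
    \<comment> \<open>The witness \<open>256 * cH\<close> carries a factor \<open>cH\<close> itself,
      because the step size condition has only one, while passing from squared L2 norms to squared
      Hilbert norms costs its square.\<close>
    have small: "256 * cH\<^sup>2 * \<bar>a0\<bar> * \<tau> \<le> 1" if "cH * (256 * cH) * \<bar>a0\<bar> * \<tau> < 1"
      using that by (simp add: power2_eq_square mult_ac)
    show ?case
      unfolding Let_def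
    proof (intro conjI allI impI, goal_cases)
      case (1 i)
      show ?case using m_S1[of i] by (intro ex1_solution) auto
    next
      case 2
      then show ?case using hyps by (intro stops_eventually small) auto
    next
      case (3 i)
      show ?case using energy_decay[of i] unfolding L2_norm_sq grad_inner_def .
    next
      case (4 i)
      show ?case by (rule energy_antimono)
    next
      case 5
      then show ?case by (intro ballI constraint_violation small)
    qed
  qed
qed

end
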